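(* For every integer $n\geq 2$, there exists a constant $A_{n}>0$ such that $$\mathrm{Kiss}(M) \leq A_{n}\, \mathrm{vol}(M) \,\frac{e^{(n-1)\, \mathrm{sys}(M)/2}}{\mathrm{sys}(M)}$$ for every closed hyperbolic $n$-manifold $M$.
   Context: A closed hyperbolic $n$-manifold is a quotient $M=\mathbb{H}^n/\Gamma$ of hyperbolic $n$-space by a discrete, torsion-free, cocompact group $\Gamma$ of isometries (not necessarily orientation-preserving). $\mathrm{vol}(M)$ is its hyperbolic volume. Closed oriented geodesics in $M$ are in one-to-one correspondence with non-trivial conjugacy classes in $\Gamma$ (equivalently, with non-trivial free homotopy classes of oriented loops). The systole $\mathrm{sys}(M)$ is the minimal length among all non-trivial closed geodesics in $M$. The kissing number $\mathrm{Kiss}(M)$ is the number of distinct free homotopy classes of non-trivial oriented closed geodesics in $M$ whose length equals $\mathrm{sys}(M)$. *)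

theory Defs
  imports "HOL-Analysis.Analysis"
begin

section \<open>Hyperbolic space\<close>

text \<open>The hyperboloid model: the sheet \<open>t > 0\<close> of \<open>t\<^sup>2 - x \<bullet> x = 1\<close> in \<open>'a \<times> real\<close>. Its dimension
  is \<open>DIM('a)\<close>, so hyperbolic \<open>n\<close>-space is \<open>'a hyperbolic\<close> for any \<open>'a\<close> with \<open>DIM('a) = n\<close>, for
  instance \<open>(real ^ 'n) hyperbolic\<close> with \<open>CARD('n) = n\<close>.\<close>

typedef (overloaded) ('a::euclidean_space) hyperbolic =
  "{(x, t). t\<^sup>2 - x \<bullet> x = 1 \<and> t > 0} :: ('a \<times> real) set"
  by (intro exI[of _ "(0, 1)"]) simp

setup_lifting type_definition_hyperbolic

lift_definition hspace :: "'a::euclidean_space hyperbolic \<Rightarrow> 'a" is fst .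
lift_definition htime :: "'a::euclidean_space hyperbolic \<Rightarrow> real" is snd .

text \<open>The point of the hyperboloid above \<open>x\<close>; this is a global chart.\<close>

lift_definition hchart :: "'a::euclidean_space \<Rightarrow> 'a hyperbolic" is "\<lambda>x. (x, sqrt (1 + x \<bullet> x))"
  by (simp add: add_pos_nonneg)

definition lorentz :: "'a::euclidean_space hyperbolic \<Rightarrow> 'a hyperbolic \<Rightarrow> real" where
  "lorentz p q = htime p * htime q - hspace p \<bullet> hspace q"

lemma htime_square: "(htime p)\<^sup>2 = 1 + hspace p \<bullet> hspace p"
  by transfer (auto simp: algebra_simps)

lemma htime_pos: "htime p > 0"
  by transfer auto

lemma hyperbolic_eqI:
  assumes "hspace p = hspace q"
  shows "p = q"
proof -
  have "htime p = htime q"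
    using assms htime_square[of p] htime_square[of q] htime_pos[of p] htime_pos[of q]
    by (metis order_less_imp_le power2_eq_iff_nonneg)
  with assms show ?thesis
    by transfer (auto simp: prod_eq_iff)
qed

lemma lorentz_self: "lorentz p p = 1"
  using htime_square[of p] by (simp add: lorentz_def power2_eq_square)

lemma lorentz_commute: "lorentz p q = lorentz q p"
  by (simp add: lorentz_def inner_commute mult.commute)

text \<open>On the Lorentz-orthogonal complement of \<open>q\<close> the form is definite; in coordinates it is
  \<open>y \<bullet> z - (y \<bullet> x) (z \<bullet> x) / t\<^sup>2\<close> where \<open>q = (x, t)\<close>, and it is the pullback of the inner product
  under \<open>y \<mapsto> y - (y \<bullet> x) / (t (t + 1)) x\<close>.\<close>

lemma spacelike_form:
  fixes x y z :: "'a::euclidean_space"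
  assumes "t\<^sup>2 = 1 + x \<bullet> x" "t > 0"
  defines "c \<equiv> 1 / (t * (t + 1))"
  shows "(y - (c * (y \<bullet> x)) *\<^sub>R x) \<bullet> (z - (c * (z \<bullet> x)) *\<^sub>R x) = y \<bullet> z - (y \<bullet> x) * (z \<bullet> x) / t\<^sup>2"
proof -
  have xx: "x \<bullet> x = t\<^sup>2 - 1"
    using assms by simp
  have "t \<noteq> 0" "t + 1 \<noteq> 0"
    using assms by auto
  then have c: "2 * c - c\<^sup>2 * (x \<bullet> x) = 1 / t\<^sup>2"
    unfolding c_def xx by (simp add: divide_simps power2_eq_square) algebra
  have "(y - (c * (y \<bullet> x)) *\<^sub>R x) \<bullet> (z - (c * (z \<bullet> x)) *\<^sub>R x)
      = y \<bullet> z - (2 * c - c\<^sup>2 * (x \<bullet> x)) * ((y \<bullet> x) * (z \<bullet> x))"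
    by (simp add: inner_diff_left inner_diff_right inner_commute power2_eq_square algebra_simps)
  then show ?thesis
    unfolding c by simp
qed

lemma lorentz_Gram:
  "(lorentz p r - lorentz p q * lorentz q r)\<^sup>2 \<le> ((lorentz p q)\<^sup>2 - 1) * ((lorentz q r)\<^sup>2 - 1)"
proof -
  define x t where "x = hspace q" and "t = htime q"
  have t: "t\<^sup>2 = 1 + x \<bullet> x" "t > 0"
    by (simp_all add: x_def t_def htime_square htime_pos)
  define b where "b = (\<lambda>p. lorentz p q)"
  define u where "u = (\<lambda>p. hspace p - b p *\<^sub>R x)"
  define L where "L = (\<lambda>y. y - (1 / (t * (t + 1)) * (y \<bullet> x)) *\<^sub>R x)"
  have ux: "u p \<bullet> x = (htime p - b p * t) * t" for p
  proof -
    have "u p \<bullet> x = hspace p \<bullet> x - b p * (x \<bullet> x)"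
      by (simp add: u_def inner_diff_left)
    also have "\<dots> = hspace p \<bullet> x - b p * (t\<^sup>2 - 1)"
      using t by simp
    also have "\<dots> = (htime p - b p * t) * t"
      by (simp add: b_def lorentz_def x_def t_def algebra_simps power2_eq_square)
    finally show ?thesis .
  qed
  have form: "L (u p) \<bullet> L (u r) = b p * b r - lorentz p r" for p r
  proof -
    have "L (u p) \<bullet> L (u r) = u p \<bullet> u r - (u p \<bullet> x) * (u r \<bullet> x) / t\<^sup>2"
      unfolding L_def by (rule spacelike_form[OF t])
    also have "(u p \<bullet> x) * (u r \<bullet> x) / t\<^sup>2 = (htime p - b p * t) * (htime r - b r * t)"
      unfolding ux using t(2) by (simp add: power2_eq_square)
    also have "u p \<bullet> u r = hspace p \<bullet> hspace r - b p * (hspace r \<bullet> x) - b r * (hspace p \<bullet> x)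
        + b p * b r * (t\<^sup>2 - 1)"
      using t by (simp add: u_def inner_diff_left inner_diff_right inner_commute algebra_simps)
    finally have *: "L (u p) \<bullet> L (u r) =
        hspace p \<bullet> hspace r - b p * (hspace r \<bullet> x) - b r * (hspace p \<bullet> x)
        + b p * b r * (t\<^sup>2 - 1) - (htime p - b p * t) * (htime r - b r * t)" .
    have "hspace p \<bullet> x = htime p * t - b p" "hspace r \<bullet> x = htime r * t - b r"
      by (simp_all add: b_def lorentz_def x_def t_def)
    with * show ?thesis
      by (simp add: lorentz_def algebra_simps power2_eq_square)
  qed
  have "(L (u p) \<bullet> L (u r))\<^sup>2 \<le> (L (u p) \<bullet> L (u p)) * (L (u r) \<bullet> L (u r))"
    by (rule Cauchy_Schwarz_ineq)
  then show ?thesis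
    unfolding form
    by (simp add: lorentz_self b_def lorentz_commute[of r q] power2_eq_square algebra_simps)
qed

lemma lorentz_ge_1: "lorentz p q \<ge> 1"
proof -
  have nt: "htime p = norm (1::real, hspace p)" for p :: "'a hyperbolic"
    using htime_square[of p] htime_pos[of p]
    by (simp add: norm_Pair power2_norm_eq_inner real_sqrt_unique less_imp_le)
  have "1 + hspace p \<bullet> hspace q = (1::real, hspace p) \<bullet> (1, hspace q)"
    by simp
  also have "\<dots> \<le> htime p * htime q"
    unfolding nt by (rule norm_cauchy_schwarz)
  finally show ?thesis
    by (simp add: lorentz_def)
qed

lemma lorentz_eq_1_iff: "lorentz p q = 1 \<longleftrightarrow> p = q"
proof
  assume 1: "lorentz p q = 1"
  have "lorentz p r = lorentz q r" for r
    using lorentz_Gram[of p r q] 1 by simp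
  from this[of "hchart (hspace p)"] this[of "hchart 0"]
  have t: "htime p = htime q"
    by (simp add: lorentz_def htime.rep_eq hspace.rep_eq hchart.rep_eq)
  have "(hspace p - hspace q) \<bullet> (hspace p - hspace q)
      = (htime p)\<^sup>2 + (htime q)\<^sup>2 - 2 - 2 * (htime p * htime q - 1)"
    using 1 unfolding htime_square lorentz_def
    by (simp add: inner_diff_left inner_diff_right inner_commute)
  also have "\<dots> = 0"
    using t by (simp add: power2_eq_square)
  finally show "p = q"
    by (intro hyperbolic_eqI) simp
qed (simp add: lorentz_self)

instantiation hyperbolic :: (euclidean_space) metric_space
begin

definition dist_hyperbolic :: "'a hyperbolic \<Rightarrow> 'a hyperbolic \<Rightarrow> real" where
  "dist_hyperbolic p q = arcosh (lorentz p q)"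

definition uniformity_hyperbolic :: "('a hyperbolic \<times> 'a hyperbolic) filter" where
  "uniformity_hyperbolic = (INF e\<in>{0 <..}. principal {(x, y). dist x y < e})"

definition open_hyperbolic :: "'a hyperbolic set \<Rightarrow> bool" where
  "open_hyperbolic U \<longleftrightarrow> (\<forall>x\<in>U. eventually (\<lambda>(x', y). x' = x \<longrightarrow> y \<in> U) uniformity)"

instance
proof
  fix p q r :: "'a hyperbolic"
  show "dist p q = 0 \<longleftrightarrow> p = q"
    by (simp add: dist_hyperbolic_def lorentz_ge_1 lorentz_eq_1_iff)
  show "dist p q \<le> dist p r + dist q r"
  proof -
    let ?a = "lorentz p r" and ?b = "lorentz r q"
    have ge: "?a \<ge> 1" "?b \<ge> 1" "lorentz p q \<ge> 1"
      by (rule lorentz_ge_1)+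
    have "lorentz p q - ?a * ?b \<le> sqrt ((?a\<^sup>2 - 1) * (?b\<^sup>2 - 1))"
      using lorentz_Gram[of p q r] by (rule real_le_rsqrt)
    then have "lorentz p q \<le> cosh (arcosh ?a + arcosh ?b)"
      using ge by (simp add: cosh_add sinh_arcosh_real real_sqrt_mult)
    then have "cosh (arcosh (lorentz p q)) \<le> cosh (arcosh ?a + arcosh ?b)"
      using ge by simp
    then have "arcosh (lorentz p q) \<le> arcosh ?a + arcosh ?b"
      using ge by (subst (asm) cosh_real_nonneg_le_iff) auto
    then show ?thesis
      by (simp add: dist_hyperbolic_def lorentz_commute[of q r])
  qed
qed (rule uniformity_hyperbolic_def open_hyperbolic_def)+

end

lemma continuous_hchart: "continuous_on UNIV (hchart :: 'a::euclidean_space \<Rightarrow> 'a hyperbolic)"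
  unfolding continuous_on_def
proof (intro ballI)
  fix x :: 'a
  have *: "dist (hchart y) (hchart x) =
      arcosh (sqrt (1 + y \<bullet> y) * sqrt (1 + x \<bullet> x) - y \<bullet> x)" for y
    by (simp add: dist_hyperbolic_def lorentz_def htime.rep_eq hspace.rep_eq hchart.rep_eq)
  have ge: "sqrt (1 + y \<bullet> y) * sqrt (1 + x \<bullet> x) - y \<bullet> x \<ge> 1" for y
    using lorentz_ge_1[of "hchart y" "hchart x"]
    by (simp add: lorentz_def htime.rep_eq hspace.rep_eq hchart.rep_eq)
  have "continuous_on UNIV (\<lambda>y. dist (hchart y) (hchart x))"
    unfolding * by (rule continuous_on_compose2[OF continuous_on_arcosh[OF order.refl]])
      (use ge in \<open>auto intro!: continuous_intros\<close>)
  then have "((\<lambda>y. dist (hchart y) (hchart x)) \<longlongrightarrow> dist (hchart x) (hchart x)) (at x)"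
    unfolding continuous_on_def by (rule bspec) simp
  then show "(hchart \<longlongrightarrow> hchart x) (at x within UNIV)"
    unfolding tendsto_dist_iff[of hchart] by simp
qed

text \<open>The Riemannian volume; in the chart \<^const>\<open>hchart\<close> its density is \<open>1 / t\<close>.\<close>

definition hyperbolic_volume :: "'a::euclidean_space hyperbolic measure" where
  "hyperbolic_volume =
     distr (density lborel (\<lambda>x. ennreal (1 / sqrt (1 + x \<bullet> x)))) borel hchart"

definition hyperbolic_isometry ::
    "('a::euclidean_space hyperbolic \<Rightarrow> 'a hyperbolic) \<Rightarrow> bool" where
  "hyperbolic_isometry f \<longleftrightarrow> surj f \<and> (\<forall>p q. dist (f p) (f q) = dist p q)"


section \<open>Quotients of hyperbolic space\<close>

type_synonym 'a isometries = "('a hyperbolic \<Rightarrow> 'a hyperbolic) set"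

definition isometry_group :: "'a::euclidean_space isometries \<Rightarrow> bool" where
  "isometry_group \<Gamma> \<longleftrightarrow> (\<forall>\<gamma>\<in>\<Gamma>. hyperbolic_isometry \<gamma>) \<and> id \<in> \<Gamma> \<and>
     (\<forall>\<gamma>\<in>\<Gamma>. \<forall>\<delta>\<in>\<Gamma>. \<gamma> \<circ> \<delta> \<in> \<Gamma>) \<and> (\<forall>\<gamma>\<in>\<Gamma>. inv \<gamma> \<in> \<Gamma>)"

definition torsion_free :: "'a::euclidean_space isometries \<Rightarrow> bool" where
  "torsion_free \<Gamma> \<longleftrightarrow> (\<forall>\<gamma>\<in>\<Gamma>. \<forall>k>0. \<gamma> ^^ k = id \<longrightarrow> \<gamma> = id)"

definition orbit :: "'a::euclidean_space isometries \<Rightarrow> 'a hyperbolic \<Rightarrow> 'a hyperbolic set" where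
  "orbit \<Gamma> p = (\<lambda>\<gamma>. \<gamma> p) ` \<Gamma>"

text \<open>The points of the quotient are the orbits, and their distance is \<^const>\<open>setdist\<close>. For discrete
  \<open>\<Gamma>\<close> this is a metric (for torsion-free \<open>\<Gamma>\<close> the Riemannian distance of the quotient manifold), and
  it induces the quotient topology.\<close>

definition quotient_points :: "'a::euclidean_space isometries \<Rightarrow> 'a hyperbolic set set" where
  "quotient_points \<Gamma> = range (orbit \<Gamma>)"

definition quotient_top :: "'a::euclidean_space isometries \<Rightarrow> 'a hyperbolic set topology" where
  "quotient_top \<Gamma> = Metric_space.mtopology (quotient_points \<Gamma>) setdist"

text \<open>\<^const>\<open>discrete\<close> refers to the topology of pointwise convergence on functions, which on
  isometries is the compact-open topology.\<close>

definition closed_hyperbolic :: "'a::euclidean_space isometries \<Rightarrow> bool" where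
  "closed_hyperbolic \<Gamma> \<longleftrightarrow>
     isometry_group \<Gamma> \<and> discrete \<Gamma> \<and> torsion_free \<Gamma> \<and> compact_space (quotient_top \<Gamma>)"

definition fundamental_domain ::
    "'a::euclidean_space isometries \<Rightarrow> 'a hyperbolic set \<Rightarrow> bool" where
  "fundamental_domain \<Gamma> F \<longleftrightarrow> F \<in> sets borel \<and> (\<forall>X\<in>quotient_points \<Gamma>. \<exists>!p. p \<in> X \<and> p \<in> F)"

text \<open>All Borel fundamental domains of a discrete group have the same volume, since
  \<^const>\<open>hyperbolic_volume\<close> is invariant under isometries and the group is countable.\<close>

definition vol :: "'a::euclidean_space isometries \<Rightarrow> real" where
  "vol \<Gamma> = measure hyperbolic_volume (SOME F. fundamental_domain \<Gamma> F)"


section \<open>Closed geodesics\<close>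

text \<open>An oriented closed geodesic of length \<open>l\<close>, parametrised by arc length as an \<open>l\<close>-periodic
  curve. As in Riemannian geometry it need only be length minimising locally, and it may run several
  times around a shorter one; \<open>l > 0\<close> excludes the constant curves.\<close>

definition closed_geodesic ::
    "'a::euclidean_space isometries \<Rightarrow> real \<Rightarrow> (real \<Rightarrow> 'a hyperbolic set) \<Rightarrow> bool" where
  "closed_geodesic \<Gamma> l c \<longleftrightarrow> l > 0 \<and> range c \<subseteq> quotient_points \<Gamma> \<and> (\<forall>t. c (t + l) = c t) \<and>
     (\<forall>t. \<exists>\<epsilon>>0. \<forall>s\<in>{t-\<epsilon><..<t+\<epsilon>}. \<forall>s'\<in>{t-\<epsilon><..<t+\<epsilon>}. setdist (c s) (c s') = \<bar>s - s'\<bar>)"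

definition systole :: "'a::euclidean_space isometries \<Rightarrow> real" where
  "systole \<Gamma> = Inf {l. \<exists>c. closed_geodesic \<Gamma> l c}"

text \<open>Free homotopy of loops parametrised by the unit interval, as for \<^const>\<open>homotopic_loops\<close>.\<close>

definition free_homotopy_class ::
    "'a::euclidean_space isometries \<Rightarrow> (real \<Rightarrow> 'a hyperbolic set) \<Rightarrow>
     (real \<Rightarrow> 'a hyperbolic set) set" where
  "free_homotopy_class \<Gamma> f =
     {g. homotopic_with (\<lambda>h. h 0 = h 1) (top_of_set {0..1}) (quotient_top \<Gamma>) f g}"

definition systolic_classes ::
    "'a::euclidean_space isometries \<Rightarrow> (real \<Rightarrow> 'a hyperbolic set) set set" where
  "systolic_classes \<Gamma> =
     {free_homotopy_class \<Gamma> (\<lambda>s. c (systole \<Gamma> * s)) | c. closed_geodesic \<Gamma> (systole \<Gamma>) c}"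

definition kissing_number :: "'a::euclidean_space isometries \<Rightarrow> nat" where
  "kissing_number \<Gamma> = card (systolic_classes \<Gamma>)"

end

theory Submission
  imports Defs
begin

text \<open>Write \<open>l\<close> for the systole and \<open>n\<close> for the dimension. Every systolic geodesic has length \<open>l\<close>, so
  counting balls along these geodesics shows that the number of classes times \<open>l\<close> is at most a constant
  times the volume times the maximal number of lifts of systolic geodesics passing near a point \<open>x\<close>.

  If \<open>l\<close> is not small, follow these lifts for time \<open>T = l/2 + 1/4\<close>. The points reached are separated:
  if two of them were close, with \<open>\<gamma>\<^sub>1\<close> and \<open>\<gamma>\<^sub>2\<close> the translations along the two lifts, then
  \<open>\<gamma>\<^sub>2\<^sup>-\<^sup>1 \<gamma>\<^sub>1\<close> would move the point of the first lift at time \<open>T - l\<close> by less than \<open>l\<close>. Since they lie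
  in a shell of radius about \<open>l/2\<close> around \<open>x\<close>, their number is \<open>O(exp ((n - 1) l/2))\<close>.

  If \<open>l\<close> is small, the corresponding group elements lie in a compact set of Lorentz maps. By the
  Zassenhaus commutator argument, quotients of two that are close to each other commute with a common
  element, which forces both to translate along the same line, so their number is bounded.\<close>

section \<open>The Lorentz form and geodesic lines\<close>

text \<open>\<open>kissing_number\<close> is a cardinality and would be 0 for infinitely many
  classes, so the estimate is proved for finite sets of classes, and its uniformity yields
  finiteness. The constant may depend on the dimension only: the finite net of Lorentz operators is
  fixed before the group, and a conjugation moves \<open>x\<close> to the base point, so that one
  compact set serves all groups and all points.

  The exponent has n - 1 and not n because in the chart the volume density is the reciprocal of the
  time coordinate: a shell of bounded width and radius r has volume at most about sinh^n r / cosh r.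
  The factor 1 / l comes from the counting: a class contributes about max 1 l balls, and about max 1
  (1/l) group elements can yield the same nearby axis; the quotient is l in both regimes. The two
  cases are separated at l = 1/2: from there on T - l is not positive and has absolute value l/2 -
  1/4, while below it the displacements in question stay under 1, the range of the operator
  bound.\<close>

definition emb :: "'a::euclidean_space hyperbolic \<Rightarrow> 'a \<times> real" where
  "emb p = (hspace p, htime p)"

definition lform :: "'a::euclidean_space \<times> real \<Rightarrow> 'a \<times> real \<Rightarrow> real" where
  "lform u v = snd u * snd v - fst u \<bullet> fst v"

lemma lform_simps [simp]:
  "lform (u + v) w = lform u w + lform v w" "lform w (u + v) = lform w u + lform w v"
  "lform (u - v) w = lform u w - lform v w" "lform w (u - v) = lform w u - lform w v"
  "lform (c *\<^sub>R u) w = c * lform u w" "lform w (c *\<^sub>R u) = c * lform w u"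
  "lform (- u) w = - lform u w" "lform w (- u) = - lform w u"
  "lform 0 w = 0" "lform w 0 = 0"
  by (simp_all add: lform_def inner_add_left inner_add_right inner_diff_left inner_diff_right
      algebra_simps)

lemma lform_commute: "lform u v = lform v u"
  by (simp add: lform_def inner_commute mult.commute)

lemma linear_lform: "linear (lform u)"
  by (rule linearI) simp_all

text \<open>Nondegeneracy of the form: pairing \<open>u\<close> with itself after negating its space
  part gives the squared Euclidean norm.\<close>

lemma lform_eq_0_imp_eq_0:
  assumes "\<And>v. lform u v = 0"
  shows "u = 0"
proof -
  have "lform u (- fst u, snd u) = 0" by (rule assms)
  then have "snd u * snd u + fst u \<bullet> fst u = 0" by (simp add: lform_def)
  moreover have "snd u * snd u \<ge> 0" "fst u \<bullet> fst u \<ge> 0" by simp_all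
  ultimately have "snd u * snd u = 0" "fst u \<bullet> fst u = 0" by linarith+
  then show ?thesis by (simp add: prod_eq_iff)
qed

lemma lform_emb: "lform (emb p) (emb q) = lorentz p q"
  by (simp add: lform_def emb_def lorentz_def)

lemma lform_emb_self [simp]: "lform (emb p) (emb p) = 1"
  by (simp add: lform_emb lorentz_self)

lemma emb_inj: "emb p = emb q \<longleftrightarrow> p = q"
  by (auto simp: emb_def intro: hyperbolic_eqI)

lemma emb_hchart: "emb (hchart x) = (x, sqrt (1 + x \<bullet> x))"
  by (simp add: emb_def htime.rep_eq hspace.rep_eq hchart.rep_eq)

lemma hchart_hspace [simp]: "hchart (hspace p) = p" and hspace_hchart [simp]: "hspace (hchart x) = x"
  by (auto intro: hyperbolic_eqI simp: hspace.rep_eq hchart.rep_eq)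

lemma emb_hchart_fst:
  assumes "lform v v = 1" "snd v > 0"
  shows "emb (hchart (fst v)) = v"
proof -
  have "sqrt (1 + fst v \<bullet> fst v) = snd v"
    using assms by (intro real_sqrt_unique) (auto simp: lform_def power2_eq_square)
  then show ?thesis by (simp add: emb_hchart prod_eq_iff)
qed

text \<open>The form separates the two sheets: if \<open>v\<close> were on the lower one,
  \<open>- v\<close> would be a point of the hyperboloid, and \<open>lorentz_ge_1\<close> would make
  its pairing with \<open>emb p\<close> positive.\<close>

lemma snd_pos_of_lform:
  assumes "lform v v = 1" "lform v (emb p) > 0"
  shows "snd v > 0"
proof (rule ccontr)
  assume "\<not> snd v > 0"
  moreover have "snd v \<noteq> 0"
    using assms(1) by (auto simp: lform_def) (smt (verit) inner_ge_zero)
  ultimately have "snd (- v) > 0" "lform (- v) (- v) = 1" using assms by auto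
  then have "emb (hchart (fst (- v))) = - v" by (intro emb_hchart_fst)
  then have "lorentz (hchart (fst (- v))) p = - lform v (emb p)"
    by (metis lform_emb lform_simps(7))
  with lorentz_ge_1[of "hchart (fst (- v))" p] assms show False by linarith
qed

lemma span_range_emb: "span (range (emb :: 'a::euclidean_space hyperbolic \<Rightarrow> _)) = UNIV"
proof -
  let ?S = "span (range (emb :: 'a hyperbolic \<Rightarrow> _))"
  have e: "emb p \<in> ?S" for p :: "'a hyperbolic" by (simp add: span_base)
  have 1: "(0, 1) \<in> ?S" using e[of "hchart 0"] by (simp add: emb_hchart)
  have "(b, 0) \<in> ?S" for b :: 'a
  proof -
    have "emb (hchart b) - sqrt (1 + b \<bullet> b) *\<^sub>R (0, 1) \<in> ?S" by (intro span_diff e span_scale 1)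
    then show ?thesis by (simp add: emb_hchart)
  qed
  then have "Basis \<subseteq> ?S" using 1 by (auto simp: Basis_prod_def)
  then have "span Basis \<subseteq> ?S" by (intro span_minimal subspace_span)
  then show ?thesis by (simp only: span_Basis) auto
qed

lemma cosh_dist: "cosh (dist p q) = lorentz p q" for p q :: "'a::euclidean_space hyperbolic"
  by (simp add: dist_hyperbolic_def lorentz_ge_1)

lemma dist_eq_absI:
  fixes p q :: "'a::euclidean_space hyperbolic"
  assumes "lorentz p q = cosh a"
  shows "dist p q = \<bar>a\<bar>"
proof -
  have "dist p q = arcosh (cosh \<bar>a\<bar>)" by (simp add: dist_hyperbolic_def assms)
  also have "\<dots> = \<bar>a\<bar>" by (rule arcosh_cosh_real) simp
  finally show ?thesis .
qed

lemma lorentz_eq_cosh: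
  fixes p q :: "'a::euclidean_space hyperbolic"
  assumes "dist p q = \<bar>a\<bar>"
  shows "lorentz p q = cosh a"
  using cosh_dist[of p q] assms by simp

definition geodesic_line :: "(real \<Rightarrow> 'a::euclidean_space hyperbolic) \<Rightarrow> bool" where
  "geodesic_line g \<longleftrightarrow> (\<forall>s t. dist (g s) (g t) = \<bar>s - t\<bar>)"

text \<open>\<open>u\<close> and \<open>v\<close> are light-like vectors spanning the plane that
  cuts the line out of the hyperboloid; their directions are its two ideal endpoints. An isometry
  translating the line acts diagonally on this basis.\<close>

definition null_frame :: "(real \<Rightarrow> 'a::euclidean_space hyperbolic) \<Rightarrow> 'a \<times> real \<Rightarrow> 'a \<times> real \<Rightarrow> bool" where
  "null_frame g u v \<longleftrightarrow> lform u u = 0 \<and> lform v v = 0 \<and> lform u v = 1/2 \<and>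
     (\<forall>t. emb (g t) = exp t *\<^sub>R u + exp (- t) *\<^sub>R v)"

lemma null_frame_imp_geodesic_line:
  assumes "null_frame g u v"
  shows "geodesic_line g"
  unfolding geodesic_line_def
proof (intro allI)
  fix s t
  have "lorentz (g s) (g t) = cosh (s - t)"
    using assms unfolding null_frame_def
    by (simp flip: lform_emb add: lform_commute[of v u] cosh_def exp_diff exp_minus field_simps)
  then show "dist (g s) (g t) = \<bar>s - t\<bar>" by (rule dist_eq_absI)
qed

text \<open>The equality case of the triangle inequality: \<open>emb (g s)\<close> is a linear
  combination of \<open>emb (g a)\<close> and \<open>emb (g b)\<close>, so its pairing with
  \<open>r\<close> is fixed by the two distances and comes out as 1.\<close>

lemma null_frame_determined:
  assumes g: "null_frame g u v" and ab: "a \<noteq> b"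
    and "dist r (g a) = \<bar>s - a\<bar>" "dist r (g b) = \<bar>s - b\<bar>"
  shows "r = g s"
proof -
  have ra: "lorentz r (g a) = cosh (s - a)" "lorentz r (g b) = cosh (s - b)"
    using assms by (auto intro: lorentz_eq_cosh)
  have "sinh (b - a) *\<^sub>R emb (g s) = sinh (b - s) *\<^sub>R emb (g a) + sinh (s - a) *\<^sub>R emb (g b)"
  proof -
    have "sinh (b - a) * exp s = sinh (b - s) * exp a + sinh (s - a) * exp b"
      "sinh (b - a) * exp (- s) = sinh (b - s) * exp (- a) + sinh (s - a) * exp (- b)"
      by (simp_all add: sinh_def exp_diff exp_minus field_simps)
    then show ?thesis
      using g unfolding null_frame_def
      by (simp add: scaleR_add_right scaleR_add_left algebra_simps)
  qed
  then have "lform (emb r) (sinh (b - a) *\<^sub>R emb (g s))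
      = lform (emb r) (sinh (b - s) *\<^sub>R emb (g a) + sinh (s - a) *\<^sub>R emb (g b))" by simp
  then have "sinh (b - a) * lorentz r (g s)
      = sinh (b - s) * cosh (s - a) + sinh (s - a) * cosh (s - b)"
    using ra by (simp add: lform_emb)
  also have "\<dots> = sinh (b - s) * cosh (s - a) + cosh (b - s) * sinh (s - a)"
    using cosh_minus[of "b - s"] by simp
  also have "\<dots> = sinh (b - a)"
    by (simp flip: sinh_add)
  finally have "lorentz r (g s) = 1" using ab by simp
  then show ?thesis by (simp add: lorentz_eq_1_iff)
qed

lemma null_frame_exists:
  fixes p q :: "'a::euclidean_space hyperbolic"
  assumes "p \<noteq> q"
  obtains g u v where "null_frame g u v" "g 0 = p" "g (dist p q) = q"
proof -
  define a where "a = dist p q"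
  have a: "a > 0" using assms by (simp add: a_def)
  then have sa: "sinh a > 0" by simp
  have pq: "lform (emb p) (emb q) = cosh a" by (simp add: lform_emb a_def cosh_dist)
  \<comment> \<open>The unit tangent vector at \<open>p\<close> towards \<open>q\<close>; the line
    is \<open>cosh t\<close> times \<open>emb p\<close> plus \<open>sinh t\<close> times
    \<open>w\<close>.\<close>
  define w where "w = (1 / sinh a) *\<^sub>R (emb q - cosh a *\<^sub>R emb p)"
  have pw: "lform (emb p) w = 0" using pq by (simp add: w_def)
  have qp: "lform (emb q) (emb p) = cosh a" using pq by (simp add: lform_commute)
  have "lform w w = (1 / sinh a)\<^sup>2 * (1 - (cosh a)\<^sup>2)"
    using pq qp sa by (simp add: w_def power2_eq_square field_simps)
  also have "\<dots> = - 1" using sa by (simp add: cosh_square_eq power_divide)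
  finally have ww: "lform w w = -1" .
  define u v where "u = (1/2) *\<^sub>R (emb p + w)" and "v = (1/2) *\<^sub>R (emb p - w)"
  have wp: "lform w (emb p) = 0" using pw by (simp add: lform_commute)
  have uv: "lform u u = 0" "lform v v = 0" "lform u v = 1/2" "lform v u = 1/2"
    using pw wp ww by (simp_all add: u_def v_def)
  define V where "V t = exp t *\<^sub>R u + exp (- t) *\<^sub>R v" for t
  define g where "g t = hchart (fst (V t))" for t
  have VV: "lform (V t) (V t) = 1" for t
    by (simp add: V_def uv exp_minus)
  have "u + v = emb p" by (simp add: u_def v_def flip: scaleR_add_right)
  then have "lform (V t) (emb p) = exp t / 2 + exp (- t) / 2" for t
    by (simp flip: \<open>u + v = emb p\<close> add: V_def uv)
  then have "lform (V t) (emb p) > 0" for t by (simp add: add_pos_pos)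
  then have emb_g: "emb (g t) = V t" for t
    unfolding g_def using VV by (intro emb_hchart_fst snd_pos_of_lform[of _ p])
  have "null_frame g u v" by (simp add: null_frame_def uv emb_g V_def)
  moreover have "g 0 = p"
    using \<open>u + v = emb p\<close> by (simp flip: emb_inj add: emb_g V_def)
  moreover have "V a = emb q"
  proof -
    have "V a = ((exp a + exp (- a)) / 2) *\<^sub>R emb p + ((exp a - exp (- a)) / 2) *\<^sub>R w"
      by (simp add: V_def u_def v_def algebra_simps add_divide_distrib diff_divide_distrib)
    also have "\<dots> = cosh a *\<^sub>R emb p + sinh a *\<^sub>R w" by (simp add: cosh_def sinh_def)
    also have "\<dots> = emb q" using sa by (simp add: w_def)
    finally show ?thesis .
  qed
  then have "g a = q" by (simp flip: emb_inj add: emb_g)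
  ultimately show thesis using that a_def by blast
qed

text \<open>Compare \<open>g\<close> with the explicit line through \<open>g 0\<close> and
  \<open>g 1\<close>: the distances from these two points determine every other point.\<close>

lemma geodesic_line_imp_null_frame:
  assumes g: "geodesic_line g"
  obtains u v where "null_frame g u v"
proof -
  have d: "dist (g s) (g t) = \<bar>s - t\<bar>" for s t using g by (simp add: geodesic_line_def)
  have "g 0 \<noteq> g 1" using d[of 0 1] by auto
  then obtain h u v where h: "null_frame h u v" "h 0 = g 0" "h (dist (g 0) (g 1)) = g 1"
    by (rule null_frame_exists)
  then have h1: "h 1 = g 1" by (simp add: d)
  have "g s = h s" for s
    by (rule null_frame_determined[OF h(1), of 0 1]) (auto simp: h h1 d)
  then have "g = h" by auto
  with h that show thesis by auto
qed

lemma geodesic_line_determined: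
  assumes "geodesic_line g" "a \<noteq> b" "dist r (g a) = \<bar>s - a\<bar>" "dist r (g b) = \<bar>s - b\<bar>"
  shows "r = g s"
  using assms geodesic_line_imp_null_frame null_frame_determined by metis

lemma geodesic_line_exists:
  fixes p q :: "'a::euclidean_space hyperbolic"
  assumes "p \<noteq> q"
  obtains g where "geodesic_line g" "g 0 = p" "g (dist p q) = q"
  using null_frame_exists[OF assms] null_frame_imp_geodesic_line by metis

lemma geodesic_line_eqI:
  assumes "geodesic_line g" "geodesic_line h" "a \<noteq> b" "g a = h a" "g b = h b"
  shows "g = h"
proof
  fix s
  show "g s = h s"
    using assms(1) by (intro geodesic_line_determined[OF assms(2,3)])
      (auto simp: geodesic_line_def simp flip: assms(4,5))
qed

lemma geodesic_line_shift: "geodesic_line g \<Longrightarrow> geodesic_line (\<lambda>t. g (t + a))"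
  by (simp add: geodesic_line_def)

lemma geodesic_line_reverse: "geodesic_line g \<Longrightarrow> geodesic_line (\<lambda>t. g (- t))"
  by (simp add: geodesic_line_def abs_minus_commute)

lemma geodesic_line_compose:
  "geodesic_line g \<Longrightarrow> (\<And>p q. dist (f p) (f q) = dist p q) \<Longrightarrow> geodesic_line (\<lambda>t. f (g t))"
  by (simp add: geodesic_line_def)

lemma continuous_geodesic_line:
  assumes "geodesic_line g"
  shows "continuous_on A g"
  using assms unfolding continuous_on_iff geodesic_line_def by (metis dist_real_def)

section \<open>Topology\<close>

lemma htime_eq_cosh: "htime p = cosh (dist p (hchart 0))"
  by (simp add: cosh_dist lorentz_def htime.rep_eq hspace.rep_eq hchart.rep_eq)

lemma norm_hspace_square: "(norm (hspace p))\<^sup>2 = (htime p)\<^sup>2 - 1"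
  by (simp add: htime_square power2_norm_eq_inner)

lemma norm_hspace: "norm (hspace p) = sinh (dist p (hchart 0))"
proof -
  have "(norm (hspace p))\<^sup>2 = (sinh (dist p (hchart 0)))\<^sup>2"
    by (simp add: norm_hspace_square htime_eq_cosh cosh_square_eq)
  then show ?thesis by (simp add: power2_eq_iff_nonneg)
qed

lemma compact_cball_hyperbolic: "compact (cball p r)" for p :: "'a::euclidean_space hyperbolic"
proof -
  let ?R = "r + dist p (hchart 0)"
  have "compact (hchart ` cball (0::'a) (sinh ?R))"
    by (intro compact_continuous_image continuous_on_subset[OF continuous_hchart]) auto
  moreover have "cball p r \<subseteq> hchart ` cball 0 (sinh ?R)"
  proof
    fix q assume "q \<in> cball p r"
    then have "dist q (hchart 0) \<le> ?R"
      using dist_triangle[of q "hchart 0" p] by (simp add: dist_commute)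
    then have "hspace q \<in> cball 0 (sinh ?R)" by (simp add: norm_hspace)
    then show "q \<in> hchart ` cball 0 (sinh ?R)" by (metis hchart_hspace image_eqI)
  qed
  ultimately show ?thesis
    by (metis compact_Int_closed closed_cball inf.absorb_iff2)
qed

lemma hyperbolic_countable_dense:
  obtains D :: "'a::euclidean_space hyperbolic set"
  where "countable D" "\<And>p e. e > 0 \<Longrightarrow> \<exists>q\<in>D. dist p q < e"
proof -
  obtain D :: "'a set" where D: "countable D" "\<And>X. open X \<Longrightarrow> X \<noteq> {} \<Longrightarrow> \<exists>d\<in>D. d \<in> X"
    using countable_dense_setE by metis
  have "\<exists>q\<in>hchart ` D. dist p q < e" if "e > 0" for p :: "'a hyperbolic" and e
  proof -
    have "open (hchart -` ball p e)"
      using continuous_hchart by (intro open_vimage) auto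
    moreover have "hspace p \<in> hchart -` ball p e" using that by simp
    ultimately obtain d where "d \<in> D" "d \<in> hchart -` ball p e" using D(2) by blast
    then show ?thesis by auto
  qed
  with D(1) that show thesis by blast
qed

section \<open>Isometries are Lorentz maps\<close>

definition lorentz_map :: "('a::euclidean_space \<times> real \<Rightarrow> 'a \<times> real) \<Rightarrow> bool" where
  "lorentz_map A \<longleftrightarrow> linear A \<and> (\<forall>u v. lform (A u) (A v) = lform u v)"

lemma hyperbolic_isometry_lorentz:
  "hyperbolic_isometry f \<Longrightarrow> lorentz (f p) (f q) = lorentz p q"
  by (simp add: hyperbolic_isometry_def flip: cosh_dist)

text \<open>The linear map is defined on a basis chosen inside the hyperboloid. Its pairings with
  image points are then right everywhere; since \<open>f\<close> is onto, image points span, and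
  nondegeneracy forces agreement at all points, not only at the basis.\<close>

lemma hyperbolic_isometry_linear_extension:
  fixes f :: "'a::euclidean_space hyperbolic \<Rightarrow> 'a hyperbolic"
  assumes f: "hyperbolic_isometry f"
  shows "\<exists>A. lorentz_map A \<and> (\<forall>p. A (emb p) = emb (f p))"
proof -
  obtain B where B: "B \<subseteq> range (emb :: 'a hyperbolic \<Rightarrow> _)" "independent B"
    "range (emb :: 'a hyperbolic \<Rightarrow> _) \<subseteq> span B"
    using maximal_independent_subset by metis
  have spB: "span B = UNIV"
    using B(3) span_range_emb by (metis span_minimal subspace_span top.extremum_uniqueI)
  define F where "F v = emb (f (inv emb v))" for v
  have F: "F (emb p) = emb (f p)" for p
    by (simp add: F_def inv_f_f inj_def emb_inj)
  obtain A where A: "linear A" "\<And>b. b \<in> B \<Longrightarrow> A b = F b"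
    using linear_independent_extend[OF B(2)] by metis
  have 1: "lform (A v) (emb (f q)) = lform v (emb q)" for v q
  proof -
    have "lform (emb (f q)) (A v) = lform (emb q) v"
    proof (rule linear_eq_on_span[where f = "\<lambda>v. lform (emb (f q)) (A v)" and B = B])
      show "linear (\<lambda>v. lform (emb (f q)) (A v))"
        using linear_compose[OF A(1) linear_lform] by (simp add: o_def)
      show "linear (lform (emb q))" by (rule linear_lform)
      show "v \<in> span B" by (simp add: spB)
      fix b assume "b \<in> B"
      then obtain p where "b = emb p" using B by auto
      with \<open>b \<in> B\<close> show "lform (emb (f q)) (A b) = lform (emb q) b"
        using A(2) F hyperbolic_isometry_lorentz[OF f] by (simp add: lform_emb)
    qed
    then show ?thesis by (simp add: lform_commute)
  qed
  have surj: "surj f" using f by (simp add: hyperbolic_isometry_def)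
  have 2: "A (emb p) = emb (f p)" for p
  proof -
    have "lform (A (emb p) - emb (f p)) w = 0" for w
    proof (rule linear_eq_0_on_span[where f = "lform _" and b = "range emb"])
      show "linear (lform (A (emb p) - emb (f p)))" by (rule linear_lform)
      show "w \<in> span (range emb)" by (simp add: span_range_emb)
      fix v :: "'a \<times> real" assume "v \<in> range emb"
      then obtain q where "v = emb (f q)" using surj by (metis imageE surjD)
      then show "lform (A (emb p) - emb (f p)) v = 0"
        by (simp add: 1 lform_emb hyperbolic_isometry_lorentz[OF f])
    qed
    then have "A (emb p) - emb (f p) = 0" by (rule lform_eq_0_imp_eq_0)
    then show ?thesis by simp
  qed
  have 3: "lform (A u) (A v) = lform u v" for u v
  proof (rule linear_eq_on_span[where f = "\<lambda>v. lform (A u) (A v)" and B = "range emb"])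
    show "linear (\<lambda>v. lform (A u) (A v))"
      using linear_compose[OF A(1) linear_lform] by (simp add: o_def)
    show "linear (lform u)" by (rule linear_lform)
    show "v \<in> span (range emb)" by (simp add: span_range_emb)
    fix b assume "b \<in> range (emb :: 'a hyperbolic \<Rightarrow> _)"
    then obtain q where "b = emb q" by auto
    then show "lform (A u) (A b) = lform u b" by (simp only: 1 2)
  qed
  from A 2 3 show ?thesis unfolding lorentz_map_def by blast
qed

definition rep :: "('a::euclidean_space hyperbolic \<Rightarrow> 'a hyperbolic) \<Rightarrow> 'a \<times> real \<Rightarrow> 'a \<times> real" where
  "rep f = (SOME A. lorentz_map A \<and> (\<forall>p. A (emb p) = emb (f p)))"

lemma
  assumes "hyperbolic_isometry f"
  shows lorentz_map_rep: "lorentz_map (rep f)" and rep_emb: "rep f (emb p) = emb (f p)"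
  using someI_ex[OF hyperbolic_isometry_linear_extension[OF assms]] by (auto simp: rep_def)

lemma linear_rep: "hyperbolic_isometry f \<Longrightarrow> linear (rep f)"
  and lform_rep: "hyperbolic_isometry f \<Longrightarrow> lform (rep f u) (rep f v) = lform u v"
  using lorentz_map_rep unfolding lorentz_map_def by blast+

lemma linear_eqI_emb:
  assumes "linear A" "linear B" "\<And>p. A (emb p) = B (emb p)"
  shows "A = B"
proof
  fix v
  show "A v = B v"
    by (rule linear_eq_on_span[OF assms(1,2), where B = "range emb"])
      (auto simp: assms(3) span_range_emb)
qed

lemma rep_eqI:
  assumes "hyperbolic_isometry f" "linear A" "\<And>p. A (emb p) = emb (f p)"
  shows "rep f = A"
  using assms by (intro linear_eqI_emb) (auto simp: linear_rep rep_emb)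

lemma hyperbolic_isometry_id: "hyperbolic_isometry id"
  by (simp add: hyperbolic_isometry_def)

lemma hyperbolic_isometry_comp:
  "hyperbolic_isometry f \<Longrightarrow> hyperbolic_isometry g \<Longrightarrow> hyperbolic_isometry (f \<circ> g)"
  unfolding hyperbolic_isometry_def using comp_surj[of g f] by simp

lemma hyperbolic_isometry_bij: "hyperbolic_isometry f \<Longrightarrow> bij f"
  unfolding hyperbolic_isometry_def bij_def inj_def by (metis dist_eq_0_iff)

lemma hyperbolic_isometry_inv:
  assumes "hyperbolic_isometry f"
  shows "hyperbolic_isometry (inv f)"
proof -
  have b: "bij f" using assms by (rule hyperbolic_isometry_bij)
  have "dist (inv f p) (inv f q) = dist p q" for p q
    using assms b unfolding hyperbolic_isometry_def by (metis surj_f_inv_f)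
  then show ?thesis
    using b by (simp add: hyperbolic_isometry_def bij_imp_bij_inv bij_is_surj)
qed

lemma rep_id: "rep id = id"
  by (rule rep_eqI) (auto simp: hyperbolic_isometry_id linear_id)

lemma rep_comp:
  assumes "hyperbolic_isometry f" "hyperbolic_isometry g"
  shows "rep (f \<circ> g) = rep f \<circ> rep g"
  using assms
  by (intro rep_eqI) (auto simp: hyperbolic_isometry_comp rep_emb linear_rep intro: linear_compose)

lemma rep_inject:
  assumes "hyperbolic_isometry f" "hyperbolic_isometry g" "rep f = rep g"
  shows "f = g"
proof
  fix p
  have "emb (f p) = emb (g p)" using assms rep_emb by metis
  then show "f p = g p" by (simp add: emb_inj)
qed

text \<open>The reflection in the perpendicular bisector of \<open>p\<close> and \<open>q\<close>.\<close>

definition swap_map :: "'a::euclidean_space hyperbolic \<Rightarrow> 'a hyperbolic \<Rightarrow> 'a \<times> real \<Rightarrow> 'a \<times> real" where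
  "swap_map p q v = v + (lform v (emb q - emb p) / (lorentz p q - 1)) *\<^sub>R (emb q - emb p)"

lemma
  assumes "p \<noteq> q"
  shows linear_swap_map: "linear (swap_map p q)"
    and lform_swap_map: "lform (swap_map p q u) (swap_map p q v) = lform u v"
    and swap_map_left: "swap_map p q (emb p) = emb q"
    and swap_map_involution: "swap_map p q (swap_map p q v) = v"
proof -
  define d where "d = emb q - emb p"
  define c where "c = lorentz p q - 1"
  have c: "c \<noteq> 0" using assms by (simp add: c_def lorentz_eq_1_iff)
  \<comment> \<open>With this value the formula for \<open>swap_map\<close> is the usual orthogonal
    reflection in the complement of \<open>d\<close>.\<close>
  have dd: "lform d d = - 2 * c"
    by (simp add: d_def c_def lform_emb lorentz_self lorentz_commute[of q p])
  have s: "swap_map p q v = v + (lform v d / c) *\<^sub>R d" for v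
    by (simp add: swap_map_def d_def c_def)
  show "linear (swap_map p q)"
    by (rule linearI) (simp_all add: s add_divide_distrib algebra_simps)
  show "lform (swap_map p q u) (swap_map p q v) = lform u v"
    using c by (simp add: s dd lform_commute[of d v] field_simps)
  have "lform (emb p) d = c"
    by (simp add: d_def c_def lform_emb lorentz_self)
  then show "swap_map p q (emb p) = emb q"
    using c by (simp add: s) (simp add: d_def)
  have "lform (swap_map p q v) d = - lform v d"
    using c by (simp add: s dd field_simps)
  then show "swap_map p q (swap_map p q v) = v"
    by (simp add: s[of "swap_map p q v"]) (simp add: s)
qed

text \<open>A Lorentz map may exchange the two sheets; carrying one point of the hyperboloid to
  another excludes this, since pairings with that point stay positive. The same argument for the
  right inverse \<open>B\<close> gives surjectivity.\<close>

lemma lorentz_map_isometry: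
  fixes p q :: "'a::euclidean_space hyperbolic"
  assumes A: "lorentz_map A" and inv: "\<And>v. A (B v) = v" and p: "A (emb p) = emb q"
  obtains f where "hyperbolic_isometry f" "f p = q" "\<And>r. emb (f r) = A (emb r)"
proof -
  define f where "f r = hchart (fst (A (emb r)))" for r
  have AA: "lform (A u) (A v) = lform u v" for u v using A unfolding lorentz_map_def by blast
  have emb_f: "emb (f r) = A (emb r)" for r
    unfolding f_def
  proof (intro emb_hchart_fst snd_pos_of_lform[of _ q])
    show "lform (A (emb r)) (A (emb r)) = 1" by (simp add: AA)
    then show "lform (A (emb r)) (A (emb r)) = 1" .
    have "lform (A (emb r)) (emb q) = lorentz r p" by (simp add: AA lform_emb flip: p)
    also have "\<dots> > 0" using lorentz_ge_1[of r p] by simp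
    finally show "lform (A (emb r)) (emb q) > 0" .
  qed
  have BB: "lform (B u) (B v) = lform u v" for u v using AA[of "B u" "B v"] inv by simp
  have Bq: "B (emb q) = emb p"
  proof -
    have "lform (B (emb q) - emb p) w = 0" for w
      using AA[of "B (emb q)" w] AA[of "emb p" w] by (simp add: inv p)
    then have "B (emb q) - emb p = 0" by (rule lform_eq_0_imp_eq_0)
    then show ?thesis by simp
  qed
  have "\<exists>r. f r = s" for s
  proof -
    have "emb (hchart (fst (B (emb s)))) = B (emb s)"
    proof (intro emb_hchart_fst snd_pos_of_lform[of _ p])
      show "lform (B (emb s)) (B (emb s)) = 1" by (simp add: BB)
      then show "lform (B (emb s)) (B (emb s)) = 1" .
      have "lform (B (emb s)) (emb p) = lorentz s q" by (simp add: BB lform_emb flip: Bq)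
      also have "\<dots> > 0" using lorentz_ge_1[of s q] by simp
      finally show "lform (B (emb s)) (emb p) > 0" .
    qed
    then show ?thesis by (metis emb_f emb_inj inv)
  qed
  then have "surj f" by (metis surjI)
  moreover have "dist (f r) (f s) = dist r s" for r s
    by (simp add: dist_hyperbolic_def AA emb_f flip: lform_emb)
  ultimately have "hyperbolic_isometry f" by (simp add: hyperbolic_isometry_def)
  moreover have "f p = q" by (metis emb_f emb_inj p)
  ultimately show thesis using that emb_f by blast
qed

lemma hyperbolic_transitive:
  fixes p q :: "'a::euclidean_space hyperbolic"
  obtains f where "hyperbolic_isometry f" "f p = q"
proof (cases "p = q")
  case True
  then show ?thesis using that[of id] hyperbolic_isometry_id by auto
next
  case False
  show ?thesis
    by (rule lorentz_map_isometry[of "swap_map p q" "swap_map p q" p q])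
      (use False that in \<open>auto simp: lorentz_map_def linear_swap_map lform_swap_map
        swap_map_left swap_map_involution\<close>)
qed

section \<open>Axes\<close>

text \<open>The shift \<open>l\<close> is signed and may be 0: a negative value means motion against
  the parametrisation, 0 that the line is fixed pointwise.\<close>

definition translates :: "('a::euclidean_space hyperbolic \<Rightarrow> 'a hyperbolic) \<Rightarrow>
    (real \<Rightarrow> 'a hyperbolic) \<Rightarrow> real \<Rightarrow> bool" where
  "translates f g l \<longleftrightarrow> geodesic_line g \<and> (\<forall>t. f (g t) = g (t + l))"

lemma translates_reverse: "translates f g l \<Longrightarrow> translates f (\<lambda>t. g (- t)) (- l)"
  by (auto simp: translates_def geodesic_line_reverse)

lemma translates_conj:
  assumes "translates f g l" "hyperbolic_isometry h"
  shows "translates (h \<circ> f \<circ> inv h) (\<lambda>t. h (g t)) l"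
  using assms hyperbolic_isometry_bij[of h]
  unfolding translates_def by (auto simp: bij_is_inj hyperbolic_isometry_def intro: geodesic_line_compose)

lemma exp_combination_eq_0:
  fixes x y :: "'b::real_vector"
  assumes "\<And>t. exp t *\<^sub>R x + exp (- t) *\<^sub>R y = 0"
  shows "x = 0 \<and> y = 0"
proof -
  have 0: "x + y = 0" using assms[of 0] by simp
  have "exp 1 *\<^sub>R x + exp (- 1) *\<^sub>R y = 0" by (rule assms)
  moreover have "y = - x" using 0 by (simp add: add_eq_0_iff)
  ultimately have "(exp 1 - exp (- 1)) *\<^sub>R x = 0" by (simp add: algebra_simps)
  moreover have "exp 1 \<noteq> (exp (- 1) :: real)" by simp
  ultimately show ?thesis using \<open>y = - x\<close> by auto
qed

text \<open>Comparing the coefficients of \<open>exp t\<close> and \<open>exp (- t)\<close> shows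
  that the ideal endpoints are eigenvectors.\<close>

lemma translates_null_frame:
  assumes f: "hyperbolic_isometry f" and "translates f g l" and uv: "null_frame g u v"
  shows "rep f u = exp l *\<^sub>R u" "rep f v = exp (- l) *\<^sub>R v"
proof -
  interpret linear "rep f" using f by (rule linear_rep)
  have "exp t *\<^sub>R (rep f u - exp l *\<^sub>R u) + exp (- t) *\<^sub>R (rep f v - exp (- l) *\<^sub>R v) = 0" for t
  proof -
    have "rep f (emb (g t)) = emb (g (t + l))"
      using assms by (simp add: rep_emb translates_def)
    then show ?thesis
      using uv exp_add[of "- l" "- t"] unfolding null_frame_def
      by (simp add: add scale exp_add algebra_simps)
  qed
  from exp_combination_eq_0[OF this]
  show "rep f u = exp l *\<^sub>R u" "rep f v = exp (- l) *\<^sub>R v" by auto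
qed

text \<open>The product of the time parts exceeds the inner product of the space parts by 1/2 and
  dominates it in absolute value, so it is positive; the common sign is read off at time 0.\<close>

lemma null_frame_time:
  assumes "null_frame g u v"
  shows "snd u > 0" "snd v > 0"
proof -
  have nn: "(snd w)\<^sup>2 = fst w \<bullet> fst w" if "lform w w = 0" for w :: "'a \<times> real"
    using that by (simp add: lform_def power2_eq_square)
  have pos: "exp t * snd u + exp (- t) * snd v > 0" for t
  proof -
    have "snd (emb (g t)) > 0" by (simp add: emb_def htime_pos)
    then show ?thesis using assms by (simp add: null_frame_def)
  qed
  have l: "snd u * snd v - fst u \<bullet> fst v = 1/2"
    using assms by (simp add: null_frame_def lform_def)
  have "\<bar>fst u \<bullet> fst v\<bar> \<le> \<bar>snd u * snd v\<bar>"
  proof -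
    have "(snd u * snd v)\<^sup>2 = (fst u \<bullet> fst u) * (fst v \<bullet> fst v)"
      using assms nn[of u] nn[of v] by (simp add: null_frame_def power_mult_distrib)
    then show ?thesis
      using Cauchy_Schwarz_ineq[of "fst u" "fst v"] by (simp add: abs_le_square_iff)
  qed
  then have "snd u * snd v > 0" using l by linarith
  then show "snd u > 0" "snd v > 0"
    using pos[of 0] by (auto simp: zero_less_mult_iff)
qed

text \<open>Subtract the multiple of \<open>u\<close> that kills the time part; the difference is
  still null, and a null vector without time part vanishes.\<close>

lemma null_proportional:
  assumes "lform u u = 0" "lform w w = 0" "lform u w = 0" "snd u > 0" "snd w > 0"
  obtains k where "k > 0" "w = k *\<^sub>R u"
proof -
  define k where "k = snd w / snd u"
  define z where "z = w - k *\<^sub>R u"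
  have "lform z z = 0" using assms by (simp add: z_def lform_commute[of w u])
  moreover have "snd z = 0" using assms by (simp add: z_def k_def)
  ultimately have "z = 0" by (simp add: lform_def prod_eq_iff)
  then have "w = k *\<^sub>R u" unfolding z_def by (rule eq_iff_diff_eq_0[THEN iffD2])
  moreover have "k > 0" using assms by (simp add: k_def)
  ultimately show thesis by (rule that[rotated])
qed

text \<open>The attracting endpoints \<open>u\<close> and \<open>x\<close> of the two axes are
  eigenvectors for \<open>exp l\<close> and \<open>exp m\<close>. Invariance of the form makes them
  orthogonal, and orthogonal null vectors with positive time parts are proportional; likewise for
  the repelling endpoints. So both axes have the same ends.\<close>

lemma axis_unique_positive:
  assumes f: "hyperbolic_isometry f" and t: "translates f g l" "translates f h m"
    and lm: "l > 0" "m > 0"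
  shows "m = l \<and> (\<exists>a. \<forall>t. h t = g (t + a))"
proof -
  have gl: "geodesic_line g" "geodesic_line h" using t unfolding translates_def by blast+
  obtain u v where uv: "null_frame g u v" using geodesic_line_imp_null_frame[OF gl(1)] .
  obtain x y where xy: "null_frame h x y" using geodesic_line_imp_null_frame[OF gl(2)] .
  have null: "lform u u = 0" "lform v v = 0" "lform x x = 0" "lform y y = 0"
    using uv xy unfolding null_frame_def by blast+
  note eig = translates_null_frame[OF f t(1) uv] translates_null_frame[OF f t(2) xy]
  have lr: "lform (rep f z) (rep f w) = lform z w" for z w using f by (rule lform_rep)
  have "exp (l + m) * lform u x = lform u x"
    using lr[of u x] eig exp_add[of l m] by (simp add: mult_ac)
  moreover have "exp (l + m) \<noteq> 1" using lm by simp
  ultimately have ux: "lform u x = 0" by simp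
  have "exp (- (l + m)) * lform v y = lform v y"
    using lr[of v y] eig exp_add[of "- l" "- m"] by (simp add: mult_ac)
  moreover have "exp (- (l + m)) \<noteq> 1" using lm by simp
  ultimately have vy: "lform v y = 0" by simp
  obtain k where k: "k > 0" "x = k *\<^sub>R u"
    using null_proportional[OF null(1,3) ux null_frame_time(1)[OF uv] null_frame_time(1)[OF xy]] .
  obtain j where j: "j > 0" "y = j *\<^sub>R v"
    using null_proportional[OF null(2,4) vy null_frame_time(2)[OF uv] null_frame_time(2)[OF xy]] .
  \<comment> \<open>The normalisation 1/2 ties the two scale factors, \<open>j = 1 / k\<close>, and
    rescaling by \<open>k\<close> and \<open>1 / k\<close> is the parameter shift by
    \<open>ln k\<close>.\<close>
  have "lform u v = 1/2" "lform x y = 1/2" using uv xy unfolding null_frame_def by blast+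
  moreover have "lform x y = k * (j * lform u v)" unfolding k(2) j(2) lform_simps by simp
  ultimately have kj: "k * j = 1" by (simp only:)
  have j': "j = exp (- ln k)" using k(1) inverse_unique[OF kj] by (simp add: exp_minus)
  have "u \<noteq> 0" using null_frame_time(1)[OF uv] by auto
  have "k *\<^sub>R (exp l *\<^sub>R u) = exp m *\<^sub>R (k *\<^sub>R u)"
    using linear_scale[OF linear_rep[OF f], of k u] unfolding k(2)[symmetric] eig by (rule sym)
  then have ml: "m = l" using \<open>u \<noteq> 0\<close> k(1) by simp
  have "h t = g (t + ln k)" for t
  proof -
    have "emb (h t) = emb (g (t + ln k))"
    proof -
      have "emb (h t) = exp t *\<^sub>R x + exp (- t) *\<^sub>R y"
        using xy unfolding null_frame_def by blast
      also have "\<dots> = (exp t * k) *\<^sub>R u + (exp (- t) * exp (- ln k)) *\<^sub>R v"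
        unfolding k(2) j(2) j'[symmetric] by simp
      also have "\<dots> = exp (t + ln k) *\<^sub>R u + exp (- (t + ln k)) *\<^sub>R v"
        using k(1) exp_add[of t "ln k"] exp_add[of "- t" "- ln k"] by simp
      also have "\<dots> = emb (g (t + ln k))"
        using uv by (simp add: null_frame_def)
      finally show ?thesis .
    qed
    then show ?thesis by (simp add: emb_inj)
  qed
  then have "\<exists>a. \<forall>t. h t = g (t + a)" by (intro exI[of _ "ln k"] allI)
  with ml show ?thesis by (rule conjI)
qed

text \<open>Reversing a line changes the sign of its shift, which reduces everything to positive
  shifts. The quotient \<open>m / l\<close> is 1 or -1 and records whether the two parametrisations
  agree in direction.\<close>

lemma axis_unique:
  assumes f: "hyperbolic_isometry f" and t: "translates f g l" "translates f h m"
    and lm: "l \<noteq> 0" "m \<noteq> 0"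
  shows "\<bar>m\<bar> = \<bar>l\<bar> \<and> (\<exists>a. \<forall>t. h t = g (t * (m / l) + a))"
proof -
  consider "l > 0" "m > 0" | "l > 0" "m < 0" | "l < 0" "m > 0" | "l < 0" "m < 0"
    using lm by linarith
  then show ?thesis
  proof cases
    case 1
    then have ml: "m = l" and "\<exists>a. \<forall>t. h t = g (t + a)"
      using axis_unique_positive[OF f t] by blast+
    moreover have "g (t * (m / l) + a) = g (t + a)" for t a using ml lm by simp
    ultimately show ?thesis by (simp only:)
  next
    case 2
    then have ml: "- m = l" and "\<exists>a. \<forall>t. h (- t) = g (t + a)"
      using axis_unique_positive[OF f t(1) translates_reverse[OF t(2)]] by simp_all
    then obtain a where a: "\<And>t. h (- t) = g (t + a)" by blast
    have "h t = g (t * (m / l) + a)" for t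
    proof -
      have "l = - m" using ml by simp
      then have "t * (m / l) = - t" using lm by simp
      then show ?thesis using a[of "- t"] by simp
    qed
    then have "\<exists>a. \<forall>t. h t = g (t * (m / l) + a)" by blast
    then show ?thesis using ml by (intro conjI) simp
  next
    case 3
    then have ml: "m = - l" and "\<exists>a. \<forall>t. h t = g (- (t + a))"
      using axis_unique_positive[OF f translates_reverse[OF t(1)] t(2)] by simp_all
    then obtain a where a: "\<And>t. h t = g (- (t + a))" by blast
    have "h t = g (t * (m / l) + (- a))" for t using a[of "t"] ml lm by simp
    then have "\<exists>a. \<forall>t. h t = g (t * (m / l) + a)" by blast
    then show ?thesis using ml by (intro conjI) simp
  next
    case 4
    then have ml: "- m = - l" and "\<exists>a. \<forall>t. h (- t) = g (- (t + a))"
      using axis_unique_positive[OF f translates_reverse[OF t(1)] translates_reverse[OF t(2)]]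
      by simp_all
    then obtain a where a: "\<And>t. h (- t) = g (- (t + a))" by blast
    have "h t = g (t * (m / l) + (- a))" for t using a[of "- t"] ml lm by simp
    then have "\<exists>a. \<forall>t. h t = g (t * (m / l) + a)" by blast
    then show ?thesis using ml by (intro conjI) simp
  qed
qed

section \<open>Invariance of the volume\<close>

lemma nn_integral_lborel_translate:
  fixes f :: "'b::euclidean_space \<Rightarrow> ennreal"
  assumes f[measurable]: "f \<in> borel_measurable borel"
  shows "(\<integral>\<^sup>+x. f (t + x) \<partial>lborel) = (\<integral>\<^sup>+x. f x \<partial>lborel)"
    and "(\<integral>\<^sup>+x. f (t - x) \<partial>lborel) = (\<integral>\<^sup>+x. f x \<partial>lborel)"
proof -
  have "(\<integral>\<^sup>+x. f x \<partial>lborel) = (\<integral>\<^sup>+x. f (t + c *\<^sub>R x) \<partial>lborel)" if "\<bar>c\<bar> = 1" for c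
    using that by (subst lborel_affine[of c t])
      (auto simp: nn_integral_density nn_integral_distr)
  from this[of 1] this[of "-1"]
  show "(\<integral>\<^sup>+x. f (t + x) \<partial>lborel) = (\<integral>\<^sup>+x. f x \<partial>lborel)"
    "(\<integral>\<^sup>+x. f (t - x) \<partial>lborel) = (\<integral>\<^sup>+x. f x \<partial>lborel)" by simp_all
qed

lemma nn_integral_lborel_scale:
  fixes f :: "'b::euclidean_space \<Rightarrow> ennreal"
  assumes f[measurable]: "f \<in> borel_measurable borel" and "c > 0"
  shows "(\<integral>\<^sup>+x. f x \<partial>lborel) = ennreal (c ^ DIM('b)) * (\<integral>\<^sup>+x. f (c *\<^sub>R x) \<partial>lborel)"
proof -
  have "(\<integral>\<^sup>+x. f x \<partial>lborel) =
      (\<integral>\<^sup>+x. f x \<partial>density (distr lborel borel (\<lambda>x. 0 + c *\<^sub>R x)) (\<lambda>_. ennreal (\<bar>c\<bar> ^ DIM('b))))"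
    by (rule arg_cong[where f = "\<lambda>M. nn_integral M f"]) (rule lborel_affine, use assms(2) in simp)
  also have "\<dots> = ennreal (c ^ DIM('b)) * (\<integral>\<^sup>+x. f (c *\<^sub>R x) \<partial>lborel)"
    using assms(2) by (simp add: nn_integral_density nn_integral_distr nn_integral_cmult)
  finally show ?thesis .
qed

text \<open>Uniqueness of translation invariant measures, by evaluating
  \<open>\<integral>\<integral> 1\<^sub>S(A x + y) 1\<^sub>B(y) dy dx\<close> in two ways.\<close>

lemma emeasure_linear_vimage:
  fixes A :: "'b::euclidean_space \<Rightarrow> 'b"
  assumes A: "linear A" and inv: "\<And>v. A (A' v) = v"
    and S[measurable]: "S \<in> sets borel" and B[measurable]: "B \<in> sets borel"
  shows "emeasure lborel (A -` S) * emeasure lborel B = emeasure lborel S * emeasure lborel (A -` B)"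
proof -
  interpret A: linear A by (rule A)
  have mA[measurable]: "A \<in> borel_measurable borel"
    by (rule borel_measurable_continuous_onI[OF linear_continuous_on[OF
      linear_conv_bounded_linear[THEN iffD1, OF A]]])
  have vS: "A -` X \<in> sets borel" if "X \<in> sets borel" for X
    using measurable_sets[OF mA that] by simp
  have int: "emeasure lborel (A -` X) = (\<integral>\<^sup>+x. indicator X (A x) \<partial>lborel)"
    if "X \<in> sets borel" for X
    using vS[OF that] by (simp flip: nn_integral_indicator add: indicator_vimage)
  have I: "(\<integral>\<^sup>+x. \<integral>\<^sup>+y. indicator S (A x + y) * indicator B y \<partial>lborel \<partial>lborel)
      = (\<integral>\<^sup>+y. \<integral>\<^sup>+x. indicator S (A x + y) * indicator B y \<partial>lborel \<partial>lborel)"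
    by (intro lborel_pair.Fubini'[symmetric]) measurable
  have 1: "(\<integral>\<^sup>+x. indicator S (A x + y) * indicator B y \<partial>lborel)
      = emeasure lborel (A -` S) * indicator B y" for y
  proof -
    have "A x + y = A (A' y + x)" for x by (simp add: A.add inv)
    then have "(\<integral>\<^sup>+x. indicator S (A x + y) * indicator B y \<partial>lborel)
        = (\<integral>\<^sup>+x. indicator S (A (A' y + x)) \<partial>lborel) * indicator B y"
      by (simp add: nn_integral_multc)
    also have "(\<integral>\<^sup>+x. indicator S (A (A' y + x)) \<partial>lborel) = emeasure lborel (A -` S)"
      using nn_integral_lborel_translate(1)[of "\<lambda>x. indicator S (A x)" "A' y"] S by (simp add: int)
    finally show ?thesis .
  qed
  have 2: "(\<integral>\<^sup>+x. \<integral>\<^sup>+y. indicator S (A x + y) * indicator B y \<partial>lborel \<partial>lborel)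
      = (\<integral>\<^sup>+x. \<integral>\<^sup>+y. indicator S y * indicator B (y - A x) \<partial>lborel \<partial>lborel)"
  proof (rule nn_integral_cong)
    fix x
    show "(\<integral>\<^sup>+y. indicator S (A x + y) * indicator B y \<partial>lborel)
        = (\<integral>\<^sup>+y. indicator S y * indicator B (y - A x) \<partial>lborel)"
      using nn_integral_lborel_translate(1)[of "\<lambda>y. indicator S y * indicator B (y - A x)" "A x"]
      by simp
  qed
  have 3: "\<dots> = (\<integral>\<^sup>+y. \<integral>\<^sup>+x. indicator S y * indicator B (y - A x) \<partial>lborel \<partial>lborel)"
    by (intro lborel_pair.Fubini'[symmetric]) measurable
  have 4: "(\<integral>\<^sup>+x. indicator S y * indicator B (y - A x) \<partial>lborel)
      = indicator S y * emeasure lborel (A -` B)" for y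
  proof -
    have "y - A x = A (A' y - x)" for x by (simp add: A.diff inv)
    then have "(\<integral>\<^sup>+x. indicator S y * indicator B (y - A x) \<partial>lborel)
        = indicator S y * (\<integral>\<^sup>+x. indicator B (A (A' y - x)) \<partial>lborel)"
      by (simp add: nn_integral_cmult)
    also have "(\<integral>\<^sup>+x. indicator B (A (A' y - x)) \<partial>lborel) = emeasure lborel (A -` B)"
      using nn_integral_lborel_translate(2)[of "\<lambda>x. indicator B (A x)" "A' y"] B by (simp add: int)
    finally show ?thesis .
  qed
  from I[unfolded 1 2 3 4] show ?thesis
    by (simp add: nn_integral_multc nn_integral_cmult)
qed

lemma ennreal_square_eqD:
  fixes a b :: ennreal
  assumes "a * a = b * b"
  shows "a = b"
proof (cases a; cases b)
  fix x y :: real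
  assume xy: "0 \<le> x" "a = ennreal x" "0 \<le> y" "b = ennreal y"
  then have "x * x = y * y" using assms by (simp flip: ennreal_mult)
  then show "a = b" using xy by (metis abs_mult_self_eq abs_of_nonneg real_sqrt_abs2)
qed (use assms in \<open>auto simp: ennreal_top_mult ennreal_mult_top ennreal_mult[symmetric] split: if_splits\<close>)

text \<open>The Euclidean norm is recovered from the form and the base point. So a Lorentz map
  fixing the base point is orthogonal, and the size of any Lorentz map is controlled by how far it
  moves the base point.\<close>

lemma norm_square_lform: "(norm v)\<^sup>2 = 2 * (lform v (emb (hchart 0)))\<^sup>2 - lform v v"
  by (cases v) (simp add: lform_def emb_hchart norm_Pair power2_norm_eq_inner flip: power2_eq_square)

lemma borel_measurable_rep:
  assumes "hyperbolic_isometry f"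
  shows "rep f \<in> borel_measurable borel"
  by (rule borel_measurable_continuous_onI[OF linear_continuous_on[OF
    linear_conv_bounded_linear[THEN iffD1, OF linear_rep[OF assms]]]])

lemma rep_inv: "hyperbolic_isometry f \<Longrightarrow> rep f (rep (inv f) v) = v"
  using rep_comp[of f "inv f"] hyperbolic_isometry_inv[of f] hyperbolic_isometry_bij[of f]
  by (metis bij_is_surj comp_apply id_apply rep_id surj_iff)

text \<open>By \<open>emeasure_linear_vimage\<close> it is enough to test one set, the unit ball. It
  is invariant under isometries fixing the base point, and a reflection is an involution, so its
  scaling factor squares to 1. Every other isometry is a composition of these two kinds.\<close>

lemma emeasure_lborel_rep_vimage:
  fixes f :: "'a::euclidean_space hyperbolic \<Rightarrow> 'a hyperbolic"
  assumes f: "hyperbolic_isometry f" and S: "S \<in> sets borel"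
  shows "emeasure lborel (rep f -` S) = emeasure lborel S"
proof -
  let ?B = "ball 0 1 :: ('a \<times> real) set" and ?o = "hchart 0 :: 'a hyperbolic"
  have b: "emeasure lborel ?B \<noteq> 0" "emeasure lborel ?B \<noteq> \<infinity>"
  proof -
    have "unit_ball_vol (real DIM('a \<times> real)) > 0" by (rule unit_ball_vol_pos) simp
    then have "\<not> unit_ball_vol (real DIM('a \<times> real)) \<le> 0" by linarith
    then show "emeasure lborel ?B \<noteq> 0" "emeasure lborel ?B \<noteq> \<infinity>"
      by (auto simp: emeasure_ball ennreal_eq_0_iff simp del: DIM_prod)
  qed
  have *: "emeasure lborel (rep h -` X) = emeasure lborel X"
    if h: "hyperbolic_isometry h" and eq: "emeasure lborel (rep h -` ?B) = emeasure lborel ?B"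
      and X: "X \<in> sets borel" for h X
  proof -
    have "emeasure lborel ?B * emeasure lborel (rep h -` X)
        = emeasure lborel ?B * emeasure lborel X"
      using emeasure_linear_vimage[OF linear_rep[OF h] rep_inv[OF h] X, of ?B] eq
      by (simp add: mult.commute)
    then show ?thesis using b by (auto simp: ennreal_mult_cancel_left)
  qed
  have fix_o: "emeasure lborel (rep h -` X) = emeasure lborel X"
    if h: "hyperbolic_isometry h" "h ?o = ?o" and X: "X \<in> sets borel" for h X
  proof -
    have "norm (rep h v) = norm v" for v
    proof -
      have "lform (rep h v) (emb ?o) = lform v (emb ?o)"
        using lform_rep[OF h(1), of v "emb ?o"] h by (simp add: rep_emb)
      then have "(norm (rep h v))\<^sup>2 = (norm v)\<^sup>2"
        by (simp add: norm_square_lform lform_rep h)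
      then show ?thesis by (metis norm_ge_zero power2_eq_iff_nonneg)
    qed
    then have "rep h -` ?B = ?B" by (intro set_eqI) (simp only: vimage_eq mem_ball_0)
    then show ?thesis using *[OF h(1)] X by simp
  qed
  show ?thesis
  proof (cases "f ?o = ?o")
    case True
    then show ?thesis using fix_o[OF f] S by simp
  next
    case False
    define A where "A = swap_map ?o (f ?o)"
    have A: "lorentz_map A" "A (A v) = v" "A (emb ?o) = emb (f ?o)" for v
      using False unfolding A_def lorentz_map_def
      by (auto simp: linear_swap_map lform_swap_map swap_map_left swap_map_involution)
    obtain \<sigma> where \<sigma>: "hyperbolic_isometry \<sigma>" "\<sigma> ?o = f ?o" "\<And>r. emb (\<sigma> r) = A (emb r)"
      using lorentz_map_isometry[of A A, OF A] by blast
    have rs: "rep \<sigma> = A" using \<sigma> A by (intro rep_eqI) (auto simp: lorentz_map_def)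
    have ss: "\<sigma> (\<sigma> r) = r" for r by (simp flip: emb_inj add: \<sigma> A)
    have m: "A -` X \<in> sets borel" if "X \<in> sets borel" for X
      using measurable_sets[OF borel_measurable_rep[OF \<sigma>(1)] that] by (simp add: rs)
    have "emeasure lborel (A -` ?B) * emeasure lborel (A -` ?B)
        = emeasure lborel (A -` (A -` ?B)) * emeasure lborel ?B"
      using emeasure_linear_vimage[of A A "A -` ?B" ?B] A m[of ?B]
      by (simp add: lorentz_map_def)
    also have "A -` (A -` ?B) = ?B" by (intro set_eqI) (simp only: vimage_eq A(2))
    finally have "emeasure lborel (A -` ?B) = emeasure lborel ?B"
      by (rule ennreal_square_eqD)
    then have "emeasure lborel (A -` S) = emeasure lborel S"
      using *[OF \<sigma>(1)] S by (simp add: rs)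
    moreover have "rep f = A \<circ> rep (\<sigma> \<circ> f)"
    proof -
      have "f = \<sigma> \<circ> (\<sigma> \<circ> f)" using ss by auto
      then show ?thesis
        using rep_comp[OF \<sigma>(1) hyperbolic_isometry_comp[OF \<sigma>(1) f]] rs by simp
    qed
    then have "rep f -` S = rep (\<sigma> \<circ> f) -` (A -` S)" by auto
    moreover have "(\<sigma> \<circ> f) ?o = ?o" using \<sigma>(2) ss by (metis comp_apply)
    ultimately show ?thesis
      using fix_o[OF hyperbolic_isometry_comp[OF \<sigma>(1) f], of "A -` S"] m[OF S] by simp
  qed
qed

text \<open>Lorentz maps preserve Lebesgue measure and commute with forming cones over subsets of the
  hyperboloid, and the Lebesgue measure of a cone is proportional to the volume of its base.\<close>

definition hcone :: "'a::euclidean_space hyperbolic set \<Rightarrow> ('a \<times> real) set" where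
  "hcone E = {(y, s). s > 0 \<and> 0 < s\<^sup>2 - y \<bullet> y \<and> s\<^sup>2 - y \<bullet> y \<le> 1 \<and>
     hchart ((1 / sqrt (s\<^sup>2 - y \<bullet> y)) *\<^sub>R y) \<in> E}"

lemma hcone_iff: "v \<in> hcone E \<longleftrightarrow> (\<exists>c r. 0 < c \<and> c \<le> 1 \<and> r \<in> E \<and> v = c *\<^sub>R emb r)"
proof
  assume v: "v \<in> hcone E"
  obtain y s where ys: "v = (y, s)" by (cases v)
  define c where "c = sqrt (s\<^sup>2 - y \<bullet> y)"
  have c: "0 < c" "c \<le> 1" "s > 0" "c\<^sup>2 = s\<^sup>2 - y \<bullet> y" "hchart ((1 / c) *\<^sub>R y) \<in> E"
    using v by (auto simp: hcone_def ys c_def)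
  have "emb (hchart (fst ((1 / c) *\<^sub>R v))) = (1 / c) *\<^sub>R v"
    using c by (intro emb_hchart_fst) (auto simp: lform_def ys field_simps power2_eq_square)
  then have "v = c *\<^sub>R emb (hchart ((1 / c) *\<^sub>R y))" using c by (simp add: ys)
  then show "\<exists>c r. 0 < c \<and> c \<le> 1 \<and> r \<in> E \<and> v = c *\<^sub>R emb r" using c by blast
next
  assume "\<exists>c r. 0 < c \<and> c \<le> 1 \<and> r \<in> E \<and> v = c *\<^sub>R emb r"
  then obtain c r where c: "0 < c" "c \<le> 1" "r \<in> E" "v = c *\<^sub>R emb r" by blast
  have eq: "(c * htime r)\<^sup>2 - (c *\<^sub>R hspace r) \<bullet> (c *\<^sub>R hspace r) = c\<^sup>2"
    using htime_square[of r] by (simp add: power_mult_distrib algebra_simps power2_eq_square)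
  have c2: "0 < c\<^sup>2" "c\<^sup>2 \<le> 1" "sqrt (c\<^sup>2) = c" using c by (simp_all add: power_le_one)
  have "hchart ((1 / c) *\<^sub>R (c *\<^sub>R hspace r)) = r" using c by simp
  then show "v \<in> hcone E"
    using c htime_pos[of r] c2 unfolding hcone_def emb_def c(4)
    by (simp only: mem_Collect_eq prod.case scaleR_Pair real_scaleR_def eq) simp
qed

lemma rep_vimage_hcone:
  assumes f: "hyperbolic_isometry f"
  shows "rep f -` hcone E = hcone (f -` E)"
proof -
  have sc: "rep f (c *\<^sub>R v) = c *\<^sub>R rep f v" for c v by (simp add: linear_rep linear_scale f)
  have "rep f v \<in> hcone E \<longleftrightarrow> v \<in> hcone (f -` E)" for v
  proof
    assume "rep f v \<in> hcone E"
    then obtain c r where c: "0 < c" "c \<le> 1" "r \<in> E" "rep f v = c *\<^sub>R emb r"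
      unfolding hcone_iff by blast
    obtain r' where r': "r = f r'" using f by (metis hyperbolic_isometry_def surjD)
    have "rep f v = rep f (c *\<^sub>R emb r')" using c r' by (simp add: sc rep_emb f)
    then have "v = c *\<^sub>R emb r'"
      using rep_inv[OF hyperbolic_isometry_inv[OF f]] hyperbolic_isometry_bij[OF f]
      by (metis inv_inv_eq)
    then show "v \<in> hcone (f -` E)" unfolding hcone_iff using c r' by blast
  next
    assume "v \<in> hcone (f -` E)"
    then show "rep f v \<in> hcone E" unfolding hcone_iff by (force simp: sc rep_emb f)
  qed
  then show ?thesis by (intro set_eqI) (simp only: vimage_eq)
qed

lemma borel_measurable_hchart [measurable]: "hchart \<in> borel_measurable borel"
  by (rule borel_measurable_continuous_onI[OF continuous_hchart])

lemma sets_hyperbolic_volume [measurable_cong, simp]: "sets hyperbolic_volume = sets borel"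
  and space_hyperbolic_volume [simp]: "space hyperbolic_volume = UNIV"
  by (simp_all add: hyperbolic_volume_def)

lemma emeasure_hyperbolic_volume:
  assumes E[measurable]: "E \<in> sets borel"
  shows "emeasure hyperbolic_volume E =
    (\<integral>\<^sup>+x. indicator E (hchart x) * ennreal (1 / sqrt (1 + x \<bullet> x)) \<partial>lborel)"
proof -
  have "emeasure hyperbolic_volume E
      = (\<integral>\<^sup>+x. ennreal (1 / sqrt (1 + x \<bullet> x)) * indicator (hchart -` E) x \<partial>lborel)"
    unfolding hyperbolic_volume_def
    by (subst emeasure_distr) (auto simp: emeasure_density measurable_sets_borel[OF borel_measurable_hchart E])
  then show ?thesis by (simp add: indicator_vimage mult.commute)
qed

text \<open>The value is 1 over \<open>DIM('a) + 1\<close>, the ratio of the Lebesgue measure of a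
  cone to the volume of its base.\<close>

definition cone_const :: "'a::euclidean_space itself \<Rightarrow> ennreal" where
  "cone_const _ = (\<integral>\<^sup>+c. ennreal (c ^ DIM('a)) * indicator {0..1} c \<partial>lborel)"

lemma cone_const: "cone_const TYPE('a::euclidean_space) \<noteq> 0" "cone_const TYPE('a) \<noteq> \<infinity>"
proof -
  have "cone_const TYPE('a) \<le> (\<integral>\<^sup>+c. indicator {0..1::real} c \<partial>lborel)"
    unfolding cone_const_def
    by (intro nn_integral_mono) (auto simp: indicator_def power_le_one)
  also have "\<dots> = 1" by simp
  finally show "cone_const TYPE('a) \<noteq> \<infinity>" by (auto simp: top_unique)
  have "ennreal ((1/2) ^ DIM('a)) * emeasure lborel {1/2..1::real} \<le> cone_const TYPE('a)"
  proof -
    have "ennreal ((1/2) ^ DIM('a)) * emeasure lborel {1/2..1::real}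
        = (\<integral>\<^sup>+c. ennreal ((1/2) ^ DIM('a)) * indicator {1/2..1::real} c \<partial>lborel)"
      by (simp add: nn_integral_cmult_indicator)
    also have "\<dots> \<le> cone_const TYPE('a)"
      unfolding cone_const_def
      by (intro nn_integral_mono) (auto simp: indicator_def intro!: ennreal_leI power_mono)
    finally show ?thesis .
  qed
  moreover have "ennreal ((1/2) ^ DIM('a)) * emeasure lborel {1/2..1::real} > 0"
    by (simp add: ennreal_zero_less_mult_iff zero_less_iff_neq_zero ennreal_inverse_eq_0_iff)
  ultimately show "cone_const TYPE('a) \<noteq> 0" by auto
qed

lemma sets_hcone [measurable]:
  assumes [measurable]: "E \<in> sets borel"
  shows "hcone E \<in> sets borel"
proof -
  have "{v \<in> space (borel \<Otimes>\<^sub>M borel). snd v > 0 \<and> 0 < (snd v)\<^sup>2 - fst v \<bullet> fst v \<and>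
      (snd v)\<^sup>2 - fst v \<bullet> fst v \<le> 1 \<and>
      hchart ((1 / sqrt ((snd v)\<^sup>2 - fst v \<bullet> fst v)) *\<^sub>R fst v) \<in> E} \<in> sets (borel \<Otimes>\<^sub>M borel)"
    by measurable
  also have "{v \<in> space (borel \<Otimes>\<^sub>M borel). snd v > 0 \<and> 0 < (snd v)\<^sup>2 - fst v \<bullet> fst v \<and>
      (snd v)\<^sup>2 - fst v \<bullet> fst v \<le> 1 \<and>
      hchart ((1 / sqrt ((snd v)\<^sup>2 - fst v \<bullet> fst v)) *\<^sub>R fst v) \<in> E} = hcone E"
    by (auto simp: hcone_def space_pair_measure)
  finally show ?thesis unfolding borel_prod .
qed

text \<open>Over a fixed \<open>y\<close>, change the height \<open>s\<close> to the Lorentz length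
  \<open>c\<close>, with \<open>s = sqrt (c\<^sup>2 + y \<bullet> y)\<close>; after Fubini, rescale
  \<open>y\<close> to \<open>c\<close> times \<open>x\<close>. The powers of \<open>c\<close>
  separate, and the remaining integral over \<open>x\<close> has the density of
  \<open>hyperbolic_volume\<close>.\<close>

lemma emeasure_hcone:
  fixes E :: "'a::euclidean_space hyperbolic set"
  assumes E[measurable]: "E \<in> sets borel"
  shows "emeasure lborel (hcone E) = cone_const TYPE('a) * emeasure hyperbolic_volume E"
proof -
  define k where "k y c = indicator E (hchart ((1 / c) *\<^sub>R y)) * ennreal (c / sqrt (c\<^sup>2 + y \<bullet> y))
      * indicator {0..1} c" for y :: 'a and c :: real
  have k[measurable]: "(\<lambda>(y, c). k y c) \<in> borel_measurable (borel \<Otimes>\<^sub>M borel)"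
    unfolding k_def by measurable
  have inner: "(\<integral>\<^sup>+s. indicator (hcone E) (y, s) \<partial>lborel) = (\<integral>\<^sup>+c. k y c \<partial>lborel)"
    if y: "y \<noteq> 0" for y :: 'a
  proof -
    have yy: "y \<bullet> y > 0" using y by simp
    define f where "f s = (indicator E (hchart ((1 / sqrt (s\<^sup>2 - y \<bullet> y)) *\<^sub>R y)) :: ennreal)" for s
    define g where "g c = sqrt (c\<^sup>2 + y \<bullet> y)" for c :: real
    have [measurable]: "f \<in> borel_measurable borel" unfolding f_def by measurable
    have pos: "c\<^sup>2 + y \<bullet> y > 0" for c :: real using yy by (simp add: add_nonneg_pos)
    have "(\<integral>\<^sup>+s. indicator (hcone E) (y, s) \<partial>lborel)
        = (\<integral>\<^sup>+s. f s * indicator {g 0..g 1} s \<partial>lborel)"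
    \<comment> \<open>The cone excludes the light cone, that is the height \<open>g 0\<close>, and
      the closed interval includes it; they can differ at this one height only.\<close>
    proof (rule nn_integral_cong_AE, rule AE_I'[of "{g 0}"])
      show "{g 0} \<in> null_sets lborel" by (rule finite_imp_null_set_lborel) simp
      have "s > 0 \<and> 0 < s\<^sup>2 - y \<bullet> y \<and> s\<^sup>2 - y \<bullet> y \<le> 1 \<longleftrightarrow> s \<in> {g 0..g 1}" if "s \<noteq> g 0" for s
      proof -
        have g: "g 0 > 0" "(g 0)\<^sup>2 = y \<bullet> y" "g 1 > 0" "(g 1)\<^sup>2 = 1 + y \<bullet> y"
          using yy by (simp_all add: g_def add_pos_nonneg)
        show ?thesis
        proof (cases "s > 0")
          case True
          then have "y \<bullet> y < s\<^sup>2 \<longleftrightarrow> g 0 < s" "s\<^sup>2 \<le> 1 + y \<bullet> y \<longleftrightarrow> s \<le> g 1"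
            using power_mono_iff[of s "g 0" 2] power_mono_iff[of s "g 1" 2] g by auto
          then show ?thesis using that True by auto
        qed (use g in auto)
      qed
      then show "{s \<in> space lborel. indicator (hcone E) (y, s) \<noteq> f s * indicator {g 0..g 1} s}
          \<subseteq> {g 0}"
        by (auto simp: hcone_def f_def indicator_def split: if_splits)
    qed
    also have "\<dots> = (\<integral>\<^sup>+c. f (g c) * ennreal (c / g c) * indicator {0..1} c \<partial>lborel)"
    proof (rule nn_integral_substitution_aux)
      show "(g has_real_derivative c / g c) (at c)" for c
        unfolding g_def using pos[of c] by (auto intro!: derivative_eq_intros simp: field_simps)
      show "continuous_on {0..1} (\<lambda>c. c / g c)"
        unfolding g_def using pos by (auto intro!: continuous_intros) (smt (verit))
    qed (auto simp: g_def)
    also have "\<dots> = (\<integral>\<^sup>+c. k y c \<partial>lborel)"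
      by (intro nn_integral_cong) (auto simp: k_def f_def g_def indicator_def)
    finally show ?thesis .
  qed
  have outer: "(\<integral>\<^sup>+y. k y c \<partial>lborel)
      = ennreal (c ^ DIM('a)) * indicator {0..1} c * emeasure hyperbolic_volume E" if c: "c \<noteq> 0" for c
  proof (cases "c \<in> {0..1}")
    case True
    then have c: "c > 0" using c by simp
    have kc: "k (c *\<^sub>R x) c = indicator E (hchart x) * ennreal (1 / sqrt (1 + x \<bullet> x))" for x
    proof -
      have "sqrt (c\<^sup>2 + (c *\<^sub>R x) \<bullet> (c *\<^sub>R x)) = sqrt (c\<^sup>2 * (1 + x \<bullet> x))"
        by (simp add: power2_eq_square algebra_simps)
      also have "\<dots> = c * sqrt (1 + x \<bullet> x)"
        using c by (simp add: real_sqrt_mult)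
      finally show ?thesis using c True by (simp add: k_def)
    qed
    have "(\<integral>\<^sup>+y. k y c \<partial>lborel) = ennreal (c ^ DIM('a)) * (\<integral>\<^sup>+x. k (c *\<^sub>R x) c \<partial>lborel)"
      by (rule nn_integral_lborel_scale[OF _ c]) measurable
    then show ?thesis using True by (simp add: emeasure_hyperbolic_volume kc)
  qed (simp add: k_def)
  have "emeasure lborel (hcone E) = emeasure (lborel \<Otimes>\<^sub>M lborel) (hcone E)"
    by (simp add: lborel_prod)
  also have "\<dots> = (\<integral>\<^sup>+y. \<integral>\<^sup>+s. indicator (hcone E) (y, s) \<partial>lborel \<partial>lborel)"
    by (rule lborel.emeasure_pair_measure) (metis lborel_prod sets_hcone[OF E] sets_lborel)
  also have "\<dots> = (\<integral>\<^sup>+y. \<integral>\<^sup>+c. k y c \<partial>lborel \<partial>lborel)"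
    by (intro nn_integral_cong_AE) (use AE_lborel_singleton[of "0::'a"] inner in auto)
  also have "\<dots> = (\<integral>\<^sup>+c. \<integral>\<^sup>+y. k y c \<partial>lborel \<partial>lborel)"
    by (intro lborel_pair.Fubini'[symmetric]) measurable
  also have "\<dots> = (\<integral>\<^sup>+c. ennreal (c ^ DIM('a)) * indicator {0..1} c * emeasure hyperbolic_volume E \<partial>lborel)"
    by (intro nn_integral_cong_AE) (use AE_lborel_singleton[of "0::real"] outer in auto)
  also have "\<dots> = cone_const TYPE('a) * emeasure hyperbolic_volume E"
    by (simp add: cone_const_def nn_integral_multc)
  finally show ?thesis .
qed

lemma borel_measurable_isometry:
  assumes "hyperbolic_isometry f"
  shows "f \<in> borel_measurable borel"
proof (rule borel_measurable_continuous_onI)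
  show "continuous_on UNIV f"
    using assms unfolding continuous_on_iff hyperbolic_isometry_def by metis
qed

lemma emeasure_hyperbolic_volume_vimage:
  assumes f: "hyperbolic_isometry f" and E: "E \<in> sets borel"
  shows "emeasure hyperbolic_volume (f -` E) = emeasure hyperbolic_volume E"
proof -
  have fE: "f -` E \<in> sets borel"
    using measurable_sets[OF borel_measurable_isometry[OF f] E] by simp
  have "cone_const TYPE('a) * emeasure hyperbolic_volume (f -` E) = emeasure lborel (rep f -` hcone E)"
    by (simp add: emeasure_hcone fE rep_vimage_hcone f)
  also have "\<dots> = cone_const TYPE('a) * emeasure hyperbolic_volume E"
    by (simp add: emeasure_lborel_rep_vimage f sets_hcone E emeasure_hcone)
  finally show ?thesis using cone_const[where 'a='a] by (simp add: ennreal_mult_cancel_left)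
qed

section \<open>Volumes of balls and shells\<close>

lemma emeasure_hyperbolic_ball_transfer:
  fixes p q :: "'a::euclidean_space hyperbolic"
  shows "emeasure hyperbolic_volume (ball p r) = emeasure hyperbolic_volume (ball q r)"
proof -
  obtain f where f: "hyperbolic_isometry f" "f p = q" by (rule hyperbolic_transitive)
  have "dist (f p) (f x) = dist p x" for x using f(1) by (simp add: hyperbolic_isometry_def)
  then have "f -` ball q r = ball p r" by (auto simp flip: f(2))
  then show ?thesis using emeasure_hyperbolic_volume_vimage[OF f(1), of "ball q r"] by simp
qed

definition ball_volume :: "'a::euclidean_space itself \<Rightarrow> real \<Rightarrow> real" where
  "ball_volume _ r = measure hyperbolic_volume (ball (hchart (0::'a)) r)"

lemma emeasure_hyperbolic_volume_le:
  fixes E :: "'a::euclidean_space hyperbolic set"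
  assumes E[measurable]: "E \<in> sets borel" and R: "R \<ge> 0" and c: "c > 0"
    and le: "\<And>p. p \<in> E \<Longrightarrow> norm (hspace p) \<le> R" "\<And>p. p \<in> E \<Longrightarrow> htime p \<ge> c"
  shows "emeasure hyperbolic_volume E \<le> ennreal (unit_ball_vol DIM('a) * R ^ DIM('a) / c)"
proof -
  have "emeasure hyperbolic_volume E
      = (\<integral>\<^sup>+x. indicator E (hchart x) * ennreal (1 / sqrt (1 + x \<bullet> x)) \<partial>lborel)"
    by (rule emeasure_hyperbolic_volume) fact
  also have "\<dots> \<le> (\<integral>\<^sup>+x. ennreal (1 / c) * indicator (cball (0::'a) R) x \<partial>lborel)"
  proof (rule nn_integral_mono)
    fix x :: 'a
    have "x \<in> cball 0 R \<and> 1 / sqrt (1 + x \<bullet> x) \<le> 1 / c" if "hchart x \<in> E"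
      using le(1)[OF that] le(2)[OF that] c
      by (auto simp: htime.rep_eq hchart.rep_eq intro!: divide_left_mono mult_pos_pos add_pos_nonneg)
    then show "indicator E (hchart x) * ennreal (1 / sqrt (1 + x \<bullet> x))
        \<le> ennreal (1 / c) * indicator (cball 0 R) x"
      by (auto simp: indicator_def intro: ennreal_leI)
  qed
  also have "\<dots> = ennreal (1 / c) * ennreal (unit_ball_vol DIM('a) * R ^ DIM('a))"
    using R by (simp add: nn_integral_cmult_indicator emeasure_cball)
  also have "\<dots> = ennreal (unit_ball_vol DIM('a) * R ^ DIM('a) / c)"
    using R c by (simp flip: ennreal_mult')
  finally show ?thesis .
qed

lemma emeasure_hyperbolic_ball_finite: "emeasure hyperbolic_volume (ball p r) < \<infinity>"
  for p :: "'a::euclidean_space hyperbolic"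
proof -
  have "emeasure hyperbolic_volume (ball (hchart (0::'a)) r)
      \<le> ennreal (unit_ball_vol DIM('a) * \<bar>sinh r\<bar> ^ DIM('a) / 1)"
    by (rule emeasure_hyperbolic_volume_le)
      (auto simp: norm_hspace htime_eq_cosh dist_commute intro: cosh_real_ge_1 order.trans[OF _ abs_ge_self])
  also have "\<dots> < \<infinity>" by simp
  finally show ?thesis using emeasure_hyperbolic_ball_transfer[of p r "hchart 0"] by simp
qed

lemma emeasure_hyperbolic_ball:
  fixes p :: "'a::euclidean_space hyperbolic"
  shows "emeasure hyperbolic_volume (ball p r) = ennreal (ball_volume TYPE('a) r)"
  unfolding ball_volume_def emeasure_hyperbolic_ball_transfer[of p r "hchart 0"]
  using emeasure_hyperbolic_ball_finite[of "hchart 0" r]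
  by (metis emeasure_eq_ennreal_measure infinity_ennreal_def less_irrefl)

lemma ball_volume_pos:
  assumes "r > 0"
  shows "ball_volume TYPE('a::euclidean_space) r > 0"
proof -
  let ?E = "ball (hchart (0::'a)) r"
  have "open (hchart -` ?E)" using continuous_hchart by (intro open_vimage) auto
  moreover have "0 \<in> hchart -` ?E" using assms by simp
  ultimately obtain d where d: "d > 0" "ball (0::'a) d \<subseteq> hchart -` ?E"
    by (meson openE)
  have "0 < ennreal (1 / sqrt (1 + d * d)) * emeasure lborel (ball (0::'a) d)"
    using d(1) unit_ball_vol_pos[of "real DIM('a)"]
    by (simp add: ennreal_zero_less_mult_iff emeasure_ball add_pos_nonneg)
  also have "\<dots> = (\<integral>\<^sup>+x. ennreal (1 / sqrt (1 + d * d)) * indicator (ball (0::'a) d) x \<partial>lborel)"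
    by (simp add: nn_integral_cmult_indicator)
  also have "\<dots> \<le> (\<integral>\<^sup>+x. indicator ?E (hchart x) * ennreal (1 / sqrt (1 + x \<bullet> x)) \<partial>lborel)"
  proof (rule nn_integral_mono)
    fix x :: 'a
    have "hchart x \<in> ?E \<and> 1 / sqrt (1 + d * d) \<le> 1 / sqrt (1 + x \<bullet> x)" if "x \<in> ball 0 d"
    proof
      show "hchart x \<in> ?E" using that d(2) by blast
      have "norm x * norm x \<le> d * d" using that d(1) by (intro mult_mono) auto
      then have "x \<bullet> x \<le> d * d" by (simp add: dot_square_norm power2_eq_square)
      then show "1 / sqrt (1 + d * d) \<le> 1 / sqrt (1 + x \<bullet> x)"
        by (intro divide_left_mono) (auto intro!: mult_pos_pos add_pos_nonneg)
    qed
    then show "ennreal (1 / sqrt (1 + d * d)) * indicator (ball 0 d) x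
        \<le> indicator ?E (hchart x) * ennreal (1 / sqrt (1 + x \<bullet> x))"
      by (auto simp: indicator_def intro: ennreal_leI)
  qed
  also have "\<dots> = emeasure hyperbolic_volume ?E"
    by (subst emeasure_hyperbolic_volume) auto
  finally show ?thesis
    by (simp add: emeasure_hyperbolic_ball)
qed

text \<open>In the chart the shell around the base point lies in a Euclidean ball of radius
  \<open>sinh b\<close>, and the density on it is at most \<open>1 / cosh a\<close>. For bounded
  \<open>b - a\<close> the bound has order \<open>exp ((n - 1) * b)\<close>, with \<open>n\<close>
  the dimension: the growth rate of the theorem.\<close>

lemma emeasure_hyperbolic_shell:
  fixes p :: "'a::euclidean_space hyperbolic"
  assumes "0 \<le> a" "a \<le> b"
  shows "emeasure hyperbolic_volume {x. a \<le> dist x p \<and> dist x p \<le> b}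
    \<le> ennreal (unit_ball_vol DIM('a) * sinh b ^ DIM('a) / cosh a)"
proof -
  let ?S = "\<lambda>p::'a hyperbolic. {x. a \<le> dist x p \<and> dist x p \<le> b}"
  have S[measurable]: "?S p \<in> sets borel" for p
    by (intro borel_closed closed_Collect_conj closed_Collect_le continuous_intros)
  obtain f where f: "hyperbolic_isometry f" "f p = hchart 0" by (rule hyperbolic_transitive)
  have "dist (f x) (f p) = dist x p" for x using f(1) by (simp add: hyperbolic_isometry_def)
  then have "f -` ?S (hchart 0) = ?S p" by (auto simp flip: f(2))
  then have "emeasure hyperbolic_volume (?S p) = emeasure hyperbolic_volume (?S (hchart 0))"
    using emeasure_hyperbolic_volume_vimage[OF f(1) S, of "hchart 0"] by simp
  also have "\<dots> \<le> ennreal (unit_ball_vol DIM('a) * sinh b ^ DIM('a) / cosh a)"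
    using assms by (intro emeasure_hyperbolic_volume_le)
      (auto simp: norm_hspace htime_eq_cosh cosh_real_nonneg_le_iff)
  finally show ?thesis .
qed

lemma packing:
  fixes q :: "'i \<Rightarrow> 'b::euclidean_space hyperbolic"
  assumes S: "finite S" and sep: "\<And>i j. i \<in> S \<Longrightarrow> j \<in> S \<Longrightarrow> i \<noteq> j \<Longrightarrow> 2 * r \<le> dist (q i) (q j)"
    and E: "E \<in> sets borel" "\<And>i. i \<in> S \<Longrightarrow> ball (q i) r \<subseteq> E"
  shows "ennreal (real (card S) * ball_volume TYPE('b) r) \<le> emeasure hyperbolic_volume E"
proof -
  have disj: "disjoint_family_on (\<lambda>i. ball (q i) r) S"
    unfolding disjoint_family_on_def
  proof (intro ballI impI equals0I)
    fix i j x assume "i \<in> S" "j \<in> S" "i \<noteq> j" "x \<in> ball (q i) r \<inter> ball (q j) r"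
    then show False using sep[of i j] dist_triangle[of "q i" "q j" x] by (simp add: dist_commute)
  qed
  have "(\<Sum>i\<in>S. emeasure hyperbolic_volume (ball (q i) r)) = emeasure hyperbolic_volume (\<Union>i\<in>S. ball (q i) r)"
    using S disj by (intro sum_emeasure) auto
  also have "\<dots> \<le> emeasure hyperbolic_volume E" using E by (intro emeasure_mono) auto
  finally show ?thesis
    by (simp add: emeasure_hyperbolic_ball ennreal_mult' ennreal_of_nat_eq_real_of_nat)
qed

lemma card_le_fibers:
  assumes "finite D" "\<And>y. y \<in> f ` D \<Longrightarrow> real (card {x \<in> D. f x = y}) \<le> M"
  shows "real (card D) \<le> M * real (card (f ` D))"
proof -
  have "D = (\<Union>y\<in>f ` D. {x \<in> D. f x = y})" by auto
  then have "card D \<le> (\<Sum>y\<in>f ` D. card {x \<in> D. f x = y})"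
    using card_UN_le[of "f ` D" "\<lambda>y. {x \<in> D. f x = y}"] assms(1) by simp
  then have "real (card D) \<le> (\<Sum>y\<in>f ` D. real (card {x \<in> D. f x = y}))"
    by (simp only: of_nat_sum[symmetric] of_nat_le_iff)
  also have "\<dots> \<le> (\<Sum>y\<in>f ` D. M)" by (intro sum_mono assms(2))
  finally show ?thesis by (simp add: mult.commute)
qed

text \<open>The shell bound with radii \<open>T + 1/8\<close> and \<open>T - 1/8\<close>, where
  \<open>T = l/2 + 1/4\<close>, has exponent \<open>n * (T + 1/8) - (T - 1/8)\<close>, that is
  \<open>(n - 1) * l/2\<close> plus the exponent here. The factor 2 comes from
  \<open>exp a / 2 \<le> cosh a\<close>, the divisor from packing balls of radius 1/16.\<close>

definition large_const :: "'a::euclidean_space itself \<Rightarrow> real" where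
  "large_const _ = 2 * unit_ball_vol DIM('a) * exp ((real DIM('a) - 1) / 4 + (real DIM('a) + 1) / 8)
    / ball_volume TYPE('a) (1/16)"

section \<open>Cocompact groups\<close>

locale closed_hyperbolic_group =
  fixes \<Gamma> :: "'a::euclidean_space isometries"
  assumes closed: "closed_hyperbolic \<Gamma>"
begin

lemma isometry [simp]: "\<gamma> \<in> \<Gamma> \<Longrightarrow> hyperbolic_isometry \<gamma>"
  and id_mem [simp]: "id \<in> \<Gamma>"
  and comp_mem [simp]: "\<gamma> \<in> \<Gamma> \<Longrightarrow> \<delta> \<in> \<Gamma> \<Longrightarrow> \<gamma> \<circ> \<delta> \<in> \<Gamma>"
  and inv_mem [simp]: "\<gamma> \<in> \<Gamma> \<Longrightarrow> inv \<gamma> \<in> \<Gamma>"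
  using closed unfolding closed_hyperbolic_def isometry_group_def by blast+

lemma bij [simp]: "\<gamma> \<in> \<Gamma> \<Longrightarrow> bij \<gamma>"
  by (simp add: hyperbolic_isometry_bij)

lemma inv_apply [simp]: "\<gamma> \<in> \<Gamma> \<Longrightarrow> \<gamma> (inv \<gamma> p) = p" "\<gamma> \<in> \<Gamma> \<Longrightarrow> inv \<gamma> (\<gamma> p) = p"
  using bij bij_is_surj surj_f_inv_f bij_inv_eq_iff by metis+

lemma dist_apply [simp]: "\<gamma> \<in> \<Gamma> \<Longrightarrow> dist (\<gamma> p) (\<gamma> q) = dist p q"
  using isometry unfolding hyperbolic_isometry_def by blast

lemma dist_inv: "\<gamma> \<in> \<Gamma> \<Longrightarrow> dist (inv \<gamma> p) q = dist p (\<gamma> q)"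
  by (metis dist_apply inv_apply(1))

lemma inv_eq_iff: "\<gamma> \<in> \<Gamma> \<Longrightarrow> inv \<gamma> p = q \<longleftrightarrow> p = \<gamma> q"
  using inv_apply by metis

lemma comp_inv_eq_id: "\<gamma> \<in> \<Gamma> \<Longrightarrow> \<delta> \<in> \<Gamma> \<Longrightarrow> inv \<gamma> \<circ> \<delta> = id \<Longrightarrow> \<gamma> = \<delta>"
  by (rule ext) (metis comp_apply id_apply inv_apply(1))

text \<open>In the topology of pointwise convergence a basic neighbourhood of \<open>id\<close>
  restricts the values at finitely many points only; these form \<open>P\<close>.\<close>

lemma ex_discreteness:
  obtains P e where "finite P" "e > 0" "\<And>\<gamma>. \<gamma> \<in> \<Gamma> \<Longrightarrow> (\<And>p. p \<in> P \<Longrightarrow> dist (\<gamma> p) p < e) \<Longrightarrow> \<gamma> = id"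
proof -
  have "discrete \<Gamma>" using closed by (simp add: closed_hyperbolic_def)
  then have "id isolated_in \<Gamma>" using id_mem by (rule discreteD)
  then obtain T where T: "open T" "T \<inter> \<Gamma> = {id}" unfolding isolated_in_def by blast
  then have "openin (product_topology (\<lambda>i. euclidean) UNIV) T" "id \<in> T"
    by (auto simp: open_fun_def)
  from product_topology_open_contains_basis[OF this]
  obtain X where X: "id \<in> (\<Pi>\<^sub>E i\<in>UNIV. X i)" "\<And>i. open (X i)"
    "finite {i. X i \<noteq> UNIV}" "(\<Pi>\<^sub>E i\<in>UNIV. X i) \<subseteq> T"
    by (auto simp: open_openin[symmetric])
  define P where "P = {i. X i \<noteq> UNIV}"
  have "\<exists>e>0. ball i e \<subseteq> X i" for i
  proof -
    have "i \<in> X i" using X(1) by (auto simp: PiE_iff)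
    then show ?thesis using X(2) open_contains_ball by blast
  qed
  then obtain e where e: "\<And>i. e i > 0" "\<And>i. ball i (e i) \<subseteq> X i" by metis
  define e' where "e' = Min (insert 1 (e ` P))"
  have fin: "finite P" using X(3) by (simp add: P_def)
  have e': "e' > 0" "\<And>i. i \<in> P \<Longrightarrow> e' \<le> e i"
    using fin e(1) by (auto simp: e'_def)
  show thesis
  proof (rule that[OF fin e'(1)])
    fix \<gamma> assume \<gamma>: "\<gamma> \<in> \<Gamma>" "\<And>p. p \<in> P \<Longrightarrow> dist (\<gamma> p) p < e'"
    have "\<gamma> i \<in> X i" for i
    proof (cases "i \<in> P")
      case True
      then have "\<gamma> i \<in> ball i (e i)" using \<gamma>(2)[of i] e'(2)[of i] by (simp add: dist_commute)
      then show ?thesis using e(2) by blast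
    qed (auto simp: P_def)
    then have "\<gamma> \<in> (\<Pi>\<^sub>E i\<in>UNIV. X i)" by (auto simp: PiE_iff)
    then show "\<gamma> = id" using X(4) T(2) \<gamma>(1) by blast
  qed
qed

text \<open>Proper discontinuity by pigeonhole: the elements in question send \<open>P\<close> into
  one compact ball. Recording for each point of \<open>P\<close> a nearby centre of a finite
  \<open>e/2\<close>-net gives a finite code, and two elements with the same code differ by one that
  moves the points of \<open>P\<close> by less than \<open>e\<close>.\<close>

lemma finite_bounded_displacement: "finite {\<gamma> \<in> \<Gamma>. dist (\<gamma> p) q \<le> r}"
proof -
  obtain P e where P: "finite P" "e > 0"
    "\<And>\<gamma>. \<gamma> \<in> \<Gamma> \<Longrightarrow> (\<And>p. p \<in> P \<Longrightarrow> dist (\<gamma> p) p < e) \<Longrightarrow> \<gamma> = id"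
    using ex_discreteness by metis
  define R where "R = r + (\<Sum>x\<in>P. dist x p)"
  have "compact (cball q R)" by (rule compact_cball_hyperbolic)
  then obtain C where C: "finite C" "cball q R \<subseteq> (\<Union>c\<in>C. ball c (e/2))"
    using P(2) seq_compact_imp_totally_bounded[OF compact_imp_seq_compact] half_gt_zero by metis
  let ?S = "{\<gamma> \<in> \<Gamma>. dist (\<gamma> p) q \<le> r}"
  have near: "\<exists>c. c \<in> C \<and> dist c (\<gamma> x) < e/2" if "\<gamma> \<in> ?S" "x \<in> P" for \<gamma> x
  proof -
    have "dist x p \<le> (\<Sum>x\<in>P. dist x p)" using P(1) that by (intro member_le_sum) auto
    moreover have "dist (\<gamma> x) q \<le> dist (\<gamma> x) (\<gamma> p) + dist (\<gamma> p) q" by (rule dist_triangle)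
    ultimately have "\<gamma> x \<in> cball q R" using that by (simp add: R_def dist_commute)
    then have "\<gamma> x \<in> (\<Union>c\<in>C. ball c (e / 2))" using C(2) by blast
    then show ?thesis by (simp only: UN_iff mem_ball Bex_def)
  qed
  define F where "F \<gamma> = restrict (\<lambda>x. SOME c. c \<in> C \<and> dist c (\<gamma> x) < e/2) P" for \<gamma>
  have F: "F \<gamma> x \<in> C \<and> dist (F \<gamma> x) (\<gamma> x) < e/2" if "\<gamma> \<in> ?S" "x \<in> P" for \<gamma> x
    using someI_ex[OF near[OF that]] that(2) by (simp add: F_def)
  have "inj_on F ?S"
  proof (rule inj_onI)
    fix \<gamma> \<delta> assume *: "\<gamma> \<in> ?S" "\<delta> \<in> ?S" "F \<gamma> = F \<delta>"
    have "inv \<gamma> \<circ> \<delta> = id"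
    proof (rule P(3))
      fix x assume "x \<in> P"
      then have "dist (\<gamma> x) (\<delta> x) < e"
        using F[OF *(1), of x] F[OF *(2), of x] *(3) dist_triangle_half_r[of "F \<gamma> x" "\<gamma> x" e "\<delta> x"]
        by simp
      moreover have "dist ((inv \<gamma> \<circ> \<delta>) x) x = dist (\<delta> x) (\<gamma> x)" using * by (simp add: dist_inv)
      ultimately show "dist ((inv \<gamma> \<circ> \<delta>) x) x < e" by (simp add: dist_commute)
    next
      show "inv \<gamma> \<circ> \<delta> \<in> \<Gamma>" using * by (intro comp_mem inv_mem) blast+
    qed
    moreover have "\<gamma> \<in> \<Gamma>" "\<delta> \<in> \<Gamma>" using * by blast+
    ultimately show "\<gamma> = \<delta>" by (metis comp_inv_eq_id)
  qed
  moreover have "F ` ?S \<subseteq> (\<Pi>\<^sub>E x\<in>P. C)"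
  proof (rule image_subsetI)
    fix \<gamma> assume "\<gamma> \<in> ?S"
    then show "F \<gamma> \<in> (\<Pi>\<^sub>E x\<in>P. C)"
      using F by (intro PiE_I) (blast, simp add: F_def)
  qed
  moreover have "finite (\<Pi>\<^sub>E x\<in>P. C)" using P C by (intro finite_PiE) auto
  ultimately show ?thesis by (rule inj_on_finite)
qed

lemma countable_group: "countable \<Gamma>"
proof -
  have "\<Gamma> = (\<Union>N::nat. {\<gamma> \<in> \<Gamma>. dist (\<gamma> (hchart 0)) (hchart 0) \<le> real N})"
    using real_nat_ceiling_ge by blast
  also have "countable \<dots>"
    by (intro countable_UN countableI_type countable_finite finite_bounded_displacement)
  finally show ?thesis .
qed

lemma power_mem: "\<gamma> \<in> \<Gamma> \<Longrightarrow> \<gamma> ^^ k \<in> \<Gamma>"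
  by (induction k) (auto simp flip: id_def)

text \<open>All powers of \<open>\<gamma>\<close> fix \<open>p\<close>, and only finitely many
  elements do, so \<open>\<gamma>\<close> has finite order and torsion-freeness applies. The action
  is therefore free.\<close>

lemma fixes_imp_id:
  assumes \<gamma>: "\<gamma> \<in> \<Gamma>" "\<gamma> p = p"
  shows "\<gamma> = id"
proof -
  have fixp: "(\<gamma> ^^ k) p = p" for k by (induction k) (auto simp: \<gamma>)
  have "range (\<lambda>k. \<gamma> ^^ k) \<subseteq> {\<gamma> \<in> \<Gamma>. dist (\<gamma> p) p \<le> 0}"
    using power_mem \<gamma>(1) fixp by auto
  then have "finite (range (\<lambda>k. \<gamma> ^^ k))"
    using finite_bounded_displacement finite_subset by blast
  then have "\<not> inj (\<lambda>k. \<gamma> ^^ k)" using finite_imageD infinite_UNIV_nat by blast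
  then obtain i j where "i \<noteq> j" "\<gamma> ^^ i = \<gamma> ^^ j" unfolding inj_def by blast
  then obtain i j where ij: "i < j" "\<gamma> ^^ i = \<gamma> ^^ j" by (metis nat_neq_iff)
  have "(\<gamma> ^^ (j - i)) q = q" for q
  proof -
    have "surj (\<gamma> ^^ i)" using power_mem[OF \<gamma>(1)] bij bij_is_surj by blast
    then obtain q' where q: "q = (\<gamma> ^^ i) q'" by (metis surjD)
    have "(\<gamma> ^^ (j - i)) ((\<gamma> ^^ i) q') = (\<gamma> ^^ (j - i + i)) q'"
      by (simp only: funpow_add comp_apply)
    then show ?thesis using ij by (simp add: q)
  qed
  then have "\<gamma> ^^ (j - i) = id" by auto
  moreover have "j - i > 0" using ij by simp
  ultimately show ?thesis
    using closed \<gamma>(1) unfolding closed_hyperbolic_def torsion_free_def by blast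
qed

lemma agree_imp_eq:
  assumes "\<gamma> \<in> \<Gamma>" "\<delta> \<in> \<Gamma>" "\<gamma> p = \<delta> p"
  shows "\<gamma> = \<delta>"
  using fixes_imp_id[of "inv \<gamma> \<circ> \<delta>" p] assms comp_inv_eq_id by (metis comp_apply comp_mem inv_apply(2) inv_mem)

subsection \<open>The quotient metric\<close>

lemma mem_orbit: "q \<in> orbit \<Gamma> p \<longleftrightarrow> (\<exists>\<gamma>\<in>\<Gamma>. q = \<gamma> p)"
  by (auto simp: orbit_def)

lemma self_mem_orbit [simp]: "p \<in> orbit \<Gamma> p"
  unfolding mem_orbit by (rule bexI[of _ id]) simp_all

lemma orbit_nonempty [simp]: "orbit \<Gamma> p \<noteq> {}"
  using self_mem_orbit by blast

lemma orbit_apply [simp]: "\<gamma> \<in> \<Gamma> \<Longrightarrow> orbit \<Gamma> (\<gamma> p) = orbit \<Gamma> p"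
proof -
  assume g: "\<gamma> \<in> \<Gamma>"
  have "orbit \<Gamma> (\<gamma> p) \<subseteq> orbit \<Gamma> p" if "\<gamma> \<in> \<Gamma>" for \<gamma> p
    using that by (auto simp: mem_orbit) (metis comp_apply comp_mem)
  from this[OF g, of p] this[of "inv \<gamma>" "\<gamma> p"] show ?thesis using g by auto
qed

lemma orbit_eq_iff: "orbit \<Gamma> p = orbit \<Gamma> q \<longleftrightarrow> (\<exists>\<gamma>\<in>\<Gamma>. p = \<gamma> q)"
  by (metis mem_orbit orbit_apply self_mem_orbit)

lemma setdist_orbit_le: "\<gamma> \<in> \<Gamma> \<Longrightarrow> setdist (orbit \<Gamma> p) (orbit \<Gamma> q) \<le> dist p (\<gamma> q)"
  by (rule setdist_le_dist) (auto simp: mem_orbit)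

lemma setdist_orbit_le_dist: "setdist (orbit \<Gamma> p) (orbit \<Gamma> q) \<le> dist p q"
  using setdist_orbit_le[of id] by simp

text \<open>Only finitely many translates of \<open>q\<close> compete with \<open>q\<close> itself,
  so the infimum is a minimum.\<close>

lemma setdist_orbit_attained:
  obtains \<gamma> where "\<gamma> \<in> \<Gamma>" "setdist (orbit \<Gamma> p) (orbit \<Gamma> q) = dist p (\<gamma> q)"
proof -
  let ?S = "{\<gamma> \<in> \<Gamma>. dist (\<gamma> q) p \<le> dist p q}"
  have S: "finite ?S" "id \<in> ?S" using finite_bounded_displacement by (auto simp: dist_commute)
  then obtain \<gamma> where g: "\<gamma> \<in> ?S" "\<And>\<delta>. \<delta> \<in> ?S \<Longrightarrow> dist (\<gamma> q) p \<le> dist (\<delta> q) p"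
    using arg_min_if_finite[of ?S "\<lambda>\<gamma>. dist (\<gamma> q) p"]
    by (metis (no_types, lifting) empty_iff not_less)
  have le: "dist p (\<gamma> q) \<le> dist p (\<delta> q)" if "\<delta> \<in> \<Gamma>" for \<delta>
    using g that by (cases "\<delta> \<in> ?S") (auto simp: dist_commute intro: order.trans)
  have "dist p (\<gamma> q) \<le> setdist (orbit \<Gamma> p) (orbit \<Gamma> q)"
  proof (rule le_setdistI)
    fix x y assume "x \<in> orbit \<Gamma> p" "y \<in> orbit \<Gamma> q"
    then obtain \<delta> \<epsilon> where d: "\<delta> \<in> \<Gamma>" "x = \<delta> p" "\<epsilon> \<in> \<Gamma>" "y = \<epsilon> q" by (auto simp: mem_orbit)
    have "dist x y = dist p ((inv \<delta> \<circ> \<epsilon>) q)"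
      using d by (metis comp_apply dist_apply inv_apply(1))
    then show "dist p (\<gamma> q) \<le> dist x y" using le[of "inv \<delta> \<circ> \<epsilon>"] d by simp
  qed auto
  then have "setdist (orbit \<Gamma> p) (orbit \<Gamma> q) = dist p (\<gamma> q)"
    using setdist_orbit_le[of \<gamma> p q] g by (intro antisym) auto
  then show thesis using that g by blast
qed

lemma Metric_space_quotient: "Metric_space (quotient_points \<Gamma>) setdist"
proof
  fix X Y Z assume X: "X \<in> quotient_points \<Gamma>" and Y: "Y \<in> quotient_points \<Gamma>" and Z: "Z \<in> quotient_points \<Gamma>"
  obtain p q r where pqr: "X = orbit \<Gamma> p" "Y = orbit \<Gamma> q" "Z = orbit \<Gamma> r"
    using X Y Z by (auto simp: quotient_points_def)
  obtain \<gamma> where g: "\<gamma> \<in> \<Gamma>" "setdist X Y = dist p (\<gamma> q)"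
    unfolding pqr using setdist_orbit_attained by metis
  obtain \<delta> where d: "\<delta> \<in> \<Gamma>" "setdist Y Z = dist q (\<delta> r)"
    unfolding pqr using setdist_orbit_attained by metis
  show "setdist X Y = 0 \<longleftrightarrow> X = Y"
  proof
    assume "setdist X Y = 0"
    then show "X = Y" using g by (simp add: pqr)
  next
    assume "X = Y"
    then have "setdist X Y \<le> 0" using setdist_orbit_le_dist[of p p] by (simp add: pqr)
    then show "setdist X Y = 0" using setdist_pos_le[of X Y] by linarith
  qed
  have "setdist X Z \<le> dist p ((\<gamma> \<circ> \<delta>) r)"
    using g d unfolding pqr by (intro setdist_orbit_le comp_mem)
  also have "\<dots> \<le> dist p (\<gamma> q) + dist (\<gamma> q) (\<gamma> (\<delta> r))"
    using dist_triangle[of p "\<gamma> (\<delta> r)" "\<gamma> q"] by simp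
  finally show "setdist X Z \<le> setdist X Y + setdist Y Z" using g d by simp
qed (auto simp: setdist_sym setdist_pos_le)

lemma cobounded:
  obtains R where "R \<ge> 0" "\<And>p. \<exists>\<gamma>\<in>\<Gamma>. dist (\<gamma> p) (hchart 0) \<le> R"
proof -
  interpret Q: Metric_space "quotient_points \<Gamma>" setdist by (rule Metric_space_quotient)
  have "compactin Q.mtopology (quotient_points \<Gamma>)"
    using closed unfolding closed_hyperbolic_def quotient_top_def compact_space_def by simp
  then have "Q.mbounded (quotient_points \<Gamma>)" by (rule Q.compactin_imp_mbounded)
  then obtain B where B: "\<And>x y. x \<in> quotient_points \<Gamma> \<Longrightarrow> y \<in> quotient_points \<Gamma> \<Longrightarrow> setdist x y \<le> B"
    unfolding Q.mbounded_alt by blast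
  have le: "setdist (orbit \<Gamma> (hchart 0)) (orbit \<Gamma> p) \<le> B" for p
    by (rule B) (auto simp: quotient_points_def)
  show thesis
  proof (rule that)
    show "B \<ge> 0" using le setdist_pos_le order.trans by metis
    fix p
    obtain \<gamma> where "\<gamma> \<in> \<Gamma>" "setdist (orbit \<Gamma> (hchart 0)) (orbit \<Gamma> p) = dist (hchart 0) (\<gamma> p)"
      using setdist_orbit_attained by metis
    then show "\<exists>\<gamma>\<in>\<Gamma>. dist (\<gamma> p) (hchart 0) \<le> B" using le[of p] by (auto simp: dist_commute)
  qed
qed

section \<open>Minimal displacements, injectivity radius and axes of group elements\<close>

lemma continuous_on_apply: "\<gamma> \<in> \<Gamma> \<Longrightarrow> continuous_on A \<gamma>"
  unfolding continuous_on_iff by (metis dist_apply)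

lemma conj_mem: "\<gamma> \<in> \<Gamma> \<Longrightarrow> \<delta> \<in> \<Gamma> \<Longrightarrow> \<delta> \<circ> \<gamma> \<circ> inv \<delta> \<in> \<Gamma>"
  by simp

lemma conj_displacement:
  assumes "\<gamma> \<in> \<Gamma>" "\<delta> \<in> \<Gamma>"
  shows "dist (\<delta> p) ((\<delta> \<circ> \<gamma> \<circ> inv \<delta>) (\<delta> p)) = dist p (\<gamma> p)"
  using assms by simp

text \<open>Hyperbolic space is not compact, so \<open>q\<close> is first moved into
  \<open>cball o' R\<close>, at the price of replacing \<open>\<gamma>\<close> by a conjugate. Only
  finitely many conjugates matter, and each attains its minimum on this ball.\<close>

lemma min_displacement_attained:
  assumes \<gamma>: "\<gamma> \<in> \<Gamma>"
  obtains p where "\<And>q. dist p (\<gamma> p) \<le> dist q (\<gamma> q)"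
proof -
  obtain R where R: "R \<ge> 0" "\<And>p. \<exists>\<gamma>\<in>\<Gamma>. dist (\<gamma> p) (hchart 0) \<le> R" using cobounded by blast
  define o' where "o' = (hchart 0 :: 'a hyperbolic)"
  \<comment> \<open>A conjugate moving \<open>o'\<close> by more than \<open>B\<close> moves every
    point of \<open>cball o' R\<close> by more than \<open>dist o' (\<gamma> o')\<close>, so it
    cannot beat \<open>\<gamma>\<close> itself.\<close>
  define B where "B = 2 * R + dist o' (\<gamma> o')"
  define S where "S = {\<gamma>' \<in> \<Gamma>. dist (\<gamma>' o') o' \<le> B} \<inter> (\<lambda>\<delta>. \<delta> \<circ> \<gamma> \<circ> inv \<delta>) ` \<Gamma>"
  have "finite S" unfolding S_def using finite_bounded_displacement by blast
  have "\<gamma> \<in> S" unfolding S_def B_def using \<gamma> R(1)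
    by (auto simp: dist_commute intro!: image_eqI[of _ _ id])
  have "\<exists>x\<in>cball o' R. \<forall>y\<in>cball o' R. dist x (\<gamma>' x) \<le> dist y (\<gamma>' y)" if "\<gamma>' \<in> S" for \<gamma>'
  proof (rule continuous_attains_inf)
    show "compact (cball o' R)" by (rule compact_cball_hyperbolic)
    show "cball o' R \<noteq> {}" using R(1) by auto
    show "continuous_on (cball o' R) (\<lambda>x. dist x (\<gamma>' x))"
      using that by (intro continuous_intros continuous_on_apply) (simp add: S_def)
  qed
  then obtain x where x: "\<And>\<gamma>' y. \<gamma>' \<in> S \<Longrightarrow> y \<in> cball o' R \<Longrightarrow> dist (x \<gamma>') (\<gamma>' (x \<gamma>')) \<le> dist y (\<gamma>' y)"
    by metis
  define v where "v \<gamma>' = dist (x \<gamma>') (\<gamma>' (x \<gamma>'))" for \<gamma>'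
  define m where "m = arg_min_on v S"
  have m: "m \<in> S" "\<And>\<gamma>'. \<gamma>' \<in> S \<Longrightarrow> v m \<le> v \<gamma>'"
    using arg_min_if_finite[OF \<open>finite S\<close>, of v] \<open>\<gamma> \<in> S\<close> unfolding m_def
    by (metis empty_iff not_less)+
  obtain \<delta> where d: "\<delta> \<in> \<Gamma>" "m = \<delta> \<circ> \<gamma> \<circ> inv \<delta>" using m(1) by (auto simp: S_def)
  define p where "p = inv \<delta> (x m)"
  have "dist p (\<gamma> p) = v m"
    using conj_displacement[OF \<gamma> d(1), of p] d by (simp add: v_def p_def)
  moreover have "v m \<le> dist q (\<gamma> q)" for q
  proof -
    obtain \<epsilon> where e: "\<epsilon> \<in> \<Gamma>" "dist (\<epsilon> q) o' \<le> R" using R(2) unfolding o'_def by blast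
    let ?c = "\<epsilon> \<circ> \<gamma> \<circ> inv \<epsilon>"
    have c: "dist (\<epsilon> q) (?c (\<epsilon> q)) = dist q (\<gamma> q)" using conj_displacement[OF \<gamma> e(1)] .
    have cm: "?c \<in> \<Gamma>" using \<gamma> e by simp
    show ?thesis
    proof (cases "dist (?c o') o' \<le> B")
      case True
      then have "?c \<in> S" using cm e by (auto simp: S_def)
      then have "v ?c \<le> dist (\<epsilon> q) (?c (\<epsilon> q))"
        unfolding v_def using e by (intro x) (simp_all add: dist_commute)
      then show ?thesis using m(2)[OF \<open>?c \<in> S\<close>] c by linarith
    next
      case False
      have "dist (?c o') o' \<le> dist (?c o') (?c (\<epsilon> q)) + dist (?c (\<epsilon> q)) (\<epsilon> q) + dist (\<epsilon> q) o'"
        using dist_triangle[of "?c o'" o' "?c (\<epsilon> q)"] dist_triangle[of "?c (\<epsilon> q)" o' "\<epsilon> q"] by linarith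
      also have "dist (?c o') (?c (\<epsilon> q)) = dist (\<epsilon> q) o'"
        using dist_apply[OF cm, of o' "\<epsilon> q"] by (simp only: dist_commute)
      finally have "dist o' (\<gamma> o') < dist q (\<gamma> q)"
        using False c e by (simp add: B_def dist_commute)
      moreover have "v \<gamma> \<le> dist o' (\<gamma> o')"
        unfolding v_def using R(1) \<open>\<gamma> \<in> S\<close> by (intro x) auto
      ultimately show ?thesis using m(2)[OF \<open>\<gamma> \<in> S\<close>] by linarith
    qed
  qed
  ultimately show thesis using that by metis
qed

text \<open>Again points are moved into \<open>cball o' R\<close>. Elements moving \<open>o'\<close>
  by more than \<open>2 * R + 1\<close> displace every point there by more than 1, and the finitely
  many other nontrivial ones have positive minimal displacement.\<close>

lemma injectivity_radius:
  obtains e where "e > 0" "\<And>\<gamma> p. \<gamma> \<in> \<Gamma> \<Longrightarrow> \<gamma> \<noteq> id \<Longrightarrow> e \<le> dist p (\<gamma> p)"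
proof -
  obtain R where R: "R \<ge> 0" "\<And>p. \<exists>\<gamma>\<in>\<Gamma>. dist (\<gamma> p) (hchart 0) \<le> R" using cobounded by blast
  define o' where "o' = (hchart 0 :: 'a hyperbolic)"
  define S where "S = {\<gamma> \<in> \<Gamma>. dist (\<gamma> o') o' \<le> 2 * R + 1} - {id}"
  have "finite S" unfolding S_def using finite_bounded_displacement by blast
  have "\<exists>m>0. \<forall>q. m \<le> dist q (\<gamma> q)" if "\<gamma> \<in> S" for \<gamma>
  proof -
    have g: "\<gamma> \<in> \<Gamma>" "\<gamma> \<noteq> id" using that by (auto simp: S_def)
    obtain p where p: "\<And>q. dist p (\<gamma> p) \<le> dist q (\<gamma> q)" using min_displacement_attained[OF g(1)] by blast
    have "dist p (\<gamma> p) > 0" using fixes_imp_id[OF g(1), of p] g(2) by auto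
    with p show ?thesis by blast
  qed
  then obtain m where m: "\<And>\<gamma>. \<gamma> \<in> S \<Longrightarrow> m \<gamma> > 0" "\<And>\<gamma> q. \<gamma> \<in> S \<Longrightarrow> m \<gamma> \<le> dist q (\<gamma> q)" by metis
  define e where "e = Min (insert 1 (m ` S))"
  have e: "e > 0" "e \<le> 1" "\<And>\<gamma>. \<gamma> \<in> S \<Longrightarrow> e \<le> m \<gamma>"
    using \<open>finite S\<close> m(1) by (auto simp: e_def)
  show thesis
  proof (rule that[OF e(1)])
    fix \<gamma> q assume g: "\<gamma> \<in> \<Gamma>" "\<gamma> \<noteq> id"
    obtain \<epsilon> where \<epsilon>: "\<epsilon> \<in> \<Gamma>" "dist (\<epsilon> q) o' \<le> R" using R(2) unfolding o'_def by blast
    let ?c = "\<epsilon> \<circ> \<gamma> \<circ> inv \<epsilon>"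
    have c: "dist (\<epsilon> q) (?c (\<epsilon> q)) = dist q (\<gamma> q)" using conj_displacement[OF g(1) \<epsilon>(1)] .
    have cm: "?c \<in> \<Gamma>" using g \<epsilon> by simp
    have cid: "?c \<noteq> id"
    proof
      assume "?c = id"
      then have "dist q (\<gamma> q) = 0" using c by simp
      then show False using fixes_imp_id[OF g(1), of q] g(2) by simp
    qed
    show "e \<le> dist q (\<gamma> q)"
    proof (cases "?c \<in> S")
      case True
      then show ?thesis using m(2)[OF True, of "\<epsilon> q"] e(3)[OF True] c by linarith
    next
      case False
      then have "dist (?c o') o' > 2 * R + 1" using cm cid by (simp add: S_def del: comp_apply)
      also have "dist (?c o') o' \<le> dist (?c o') (?c (\<epsilon> q)) + dist (?c (\<epsilon> q)) (\<epsilon> q) + dist (\<epsilon> q) o'"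
        using dist_triangle[of "?c o'" o' "?c (\<epsilon> q)"] dist_triangle[of "?c (\<epsilon> q)" o' "\<epsilon> q"] by linarith
      also have "dist (?c o') (?c (\<epsilon> q)) = dist (\<epsilon> q) o'"
        using dist_apply[OF cm, of o' "\<epsilon> q"] by (simp only: dist_commute)
      finally show ?thesis using c \<epsilon> e(2) by (simp add: dist_commute)
    qed
  qed
qed

text \<open>Let \<open>p\<close> minimise the displacement. If the path from \<open>p\<close>
  through \<open>\<gamma> p\<close> to \<open>\<gamma> (\<gamma> p)\<close> had a corner at
  \<open>\<gamma> p\<close>, the midpoint \<open>m\<close> of its first half would be moved by less
  than \<open>l\<close>. So there is no corner, and the segment extends to an invariant
  line.\<close>

lemma axis_exists:
  assumes \<gamma>: "\<gamma> \<in> \<Gamma>" "\<gamma> \<noteq> id"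
  obtains g l where "l > 0" "translates \<gamma> g l" "\<And>q. l \<le> dist q (\<gamma> q)"
proof -
  obtain p where p: "\<And>q. dist p (\<gamma> p) \<le> dist q (\<gamma> q)" using min_displacement_attained[OF \<gamma>(1)] by blast
  define l where "l = dist p (\<gamma> p)"
  have ne: "p \<noteq> \<gamma> p" using fixes_imp_id[OF \<gamma>(1), of p] \<gamma>(2) by auto
  then have l: "l > 0" by (simp add: l_def)
  obtain g where g: "geodesic_line g" "g 0 = p" "g l = \<gamma> p"
    using geodesic_line_exists[OF ne] l_def by metis
  have d: "dist (g s) (g t) = \<bar>s - t\<bar>" for s t using g(1) by (simp add: geodesic_line_def)
  define m where "m = g (l/2)"
  have 1: "dist (\<gamma> m) (\<gamma> p) = l/2" using \<gamma> d[of "l/2" 0] l by (simp add: m_def g(2))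
  have 2: "dist m (\<gamma> p) = l/2" using d[of "l/2" l] l by (simp add: m_def g(3))
  have 3: "dist (\<gamma> m) m = l"
    using dist_triangle[of "\<gamma> m" m "\<gamma> p"] p[of m] 1 2 by (simp add: l_def dist_commute)
  have "\<gamma> m = g (3 * l / 2)"
    by (rule geodesic_line_determined[OF g(1), of l "l/2"])
      (use l 1 3 in \<open>simp_all add: g(3) flip: m_def\<close>)
  then have "(\<lambda>t. \<gamma> (g t)) = (\<lambda>t. g (t + l))"
    using l by (intro geodesic_line_eqI[of _ _ 0 "l/2"] geodesic_line_shift g(1)
        geodesic_line_compose[OF g(1)]) (auto simp: \<gamma> g m_def field_simps)
  then have "translates \<gamma> g l" using g(1) by (auto simp: translates_def dest: fun_cong)
  then show thesis using that l p l_def by metis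
qed

text \<open>Every other point of the orbit of \<open>q\<close> is at least \<open>e\<close> away
  from \<open>q\<close>, hence at least \<open>e/2\<close> away from \<open>p\<close>. So the
  projection to the quotient preserves small distances.\<close>

lemma setdist_orbit_small:
  assumes e: "\<And>\<gamma> p. \<gamma> \<in> \<Gamma> \<Longrightarrow> \<gamma> \<noteq> id \<Longrightarrow> e \<le> dist p (\<gamma> p)" and pq: "dist p q \<le> e/2"
  shows "setdist (orbit \<Gamma> p) (orbit \<Gamma> q) = dist p q"
proof -
  obtain \<gamma> where g: "\<gamma> \<in> \<Gamma>" "setdist (orbit \<Gamma> p) (orbit \<Gamma> q) = dist p (\<gamma> q)"
    using setdist_orbit_attained by metis
  have "dist p q \<le> dist p (\<gamma> q)"
  proof (cases "\<gamma> = id")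
    case False
    then have "e \<le> dist q (\<gamma> q)" using e g by blast
    then show ?thesis using dist_triangle[of q "\<gamma> q" p] pq by (simp add: dist_commute)
  qed simp
  then show ?thesis using g setdist_orbit_le_dist[of p q] by linarith
qed

lemma closed_geodesic_axis:
  assumes \<gamma>: "\<gamma> \<in> \<Gamma>" and g: "translates \<gamma> g l" and l: "l > 0"
  shows "closed_geodesic \<Gamma> l (\<lambda>t. orbit \<Gamma> (g t))"
proof -
  obtain e where e: "e > 0" "\<And>\<gamma> p. \<gamma> \<in> \<Gamma> \<Longrightarrow> \<gamma> \<noteq> id \<Longrightarrow> e \<le> dist p (\<gamma> p)"
    using injectivity_radius by metis
  have d: "dist (g s) (g t) = \<bar>s - t\<bar>" for s t
    using g by (simp add: geodesic_line_def translates_def)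
  have "setdist (orbit \<Gamma> (g s)) (orbit \<Gamma> (g s')) = \<bar>s - s'\<bar>"
    if "s \<in> {t - e/4<..<t + e/4}" "s' \<in> {t - e/4<..<t + e/4}" for s s' t
  proof -
    have "dist (g s) (g s') \<le> e / 2" using that by (auto simp: d abs_if)
    then show ?thesis using setdist_orbit_small e(2) d by metis
  qed
  then have "\<exists>\<epsilon>>0. \<forall>s\<in>{t-\<epsilon><..<t+\<epsilon>}. \<forall>s'\<in>{t-\<epsilon><..<t+\<epsilon>}.
      setdist (orbit \<Gamma> (g s)) (orbit \<Gamma> (g s')) = \<bar>s - s'\<bar>" for t
    using e(1) by (intro exI[of _ "e/4"]) auto
  moreover have "orbit \<Gamma> (g (t + l)) = orbit \<Gamma> (g t)" for t
    using g \<gamma> orbit_apply by (metis translates_def)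
  ultimately show ?thesis
    using l by (auto simp: closed_geodesic_def quotient_points_def)
qed

lemma systole_le_displacement:
  assumes \<gamma>: "\<gamma> \<in> \<Gamma>" "\<gamma> \<noteq> id"
  shows "systole \<Gamma> \<le> dist p (\<gamma> p)"
proof -
  obtain g l where g: "l > 0" "translates \<gamma> g l" "\<And>q. l \<le> dist q (\<gamma> q)"
    using axis_exists[OF \<gamma>] by metis
  have "closed_geodesic \<Gamma> l (\<lambda>t. orbit \<Gamma> (g t))" by (rule closed_geodesic_axis[OF \<gamma>(1) g(2,1)])
  moreover have "bdd_below {l. \<exists>c. closed_geodesic \<Gamma> l c}"
    by (rule bdd_belowI[of _ 0]) (auto simp: closed_geodesic_def)
  ultimately have "systole \<Gamma> \<le> l" unfolding systole_def by (intro cInf_lower) auto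
  then show ?thesis using g(3)[of p] by linarith
qed


subsection \<open>Fundamental domains\<close>

lemma open_vimage_apply: "\<gamma> \<in> \<Gamma> \<Longrightarrow> open U \<Longrightarrow> open (\<gamma> -` U)"
  by (rule open_vimage) (auto intro: continuous_on_apply)

text \<open>Cover by countably many balls \<open>U i\<close> of radius \<open>e / 2\<close>, each
  meeting an orbit at most once, and take from every orbit its point in the first \<open>U i\<close>
  that it meets. The sets \<open>A i\<close> consist of the orbits meeting
  \<open>U i\<close>.\<close>

lemma fundamental_domain_exists: "\<exists>F. fundamental_domain \<Gamma> F"
proof -
  obtain e where e: "e > 0" "\<And>\<gamma> p. \<gamma> \<in> \<Gamma> \<Longrightarrow> \<gamma> \<noteq> id \<Longrightarrow> e \<le> dist p (\<gamma> p)"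
    using injectivity_radius by metis
  obtain D :: "'a hyperbolic set" where D: "countable D" "\<And>p e. e > 0 \<Longrightarrow> \<exists>q\<in>D. dist p q < e"
    using hyperbolic_countable_dense by metis
  have "D \<noteq> {}" using D(2)[of 1] by auto
  define U where "U i = ball (from_nat_into D i) (e/2)" for i
  have cover: "\<exists>i. p \<in> U i" for p
  proof -
    obtain q where q: "q \<in> D" "dist p q < e/2" using D(2)[of "e/2"] e(1) by auto
    obtain i where "from_nat_into D i = q" using from_nat_into_surj[OF D(1) q(1)] by blast
    then show ?thesis using q by (auto simp: U_def dist_commute)
  qed
  have small: "\<gamma> = id" if "p \<in> U i" "\<gamma> p \<in> U i" "\<gamma> \<in> \<Gamma>" for p i \<gamma>
  proof (rule ccontr)
    assume "\<gamma> \<noteq> id"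
    then have "e \<le> dist p (\<gamma> p)" using e(2) that by blast
    moreover have "dist p (\<gamma> p) < e"
      using that dist_triangle_half_r[of "from_nat_into D i" p e "\<gamma> p"] by (simp add: U_def)
    ultimately show False by simp
  qed
  define A where "A i = (\<Union>\<gamma>\<in>\<Gamma>. \<gamma> -` U i)" for i
  have A_iff: "p \<in> A i \<longleftrightarrow> (\<exists>\<gamma>\<in>\<Gamma>. \<gamma> p \<in> U i)" for p i by (auto simp: A_def)
  have A_inv: "\<gamma> p \<in> A i \<longleftrightarrow> p \<in> A i" if "\<gamma> \<in> \<Gamma>" for \<gamma> p i
  proof
    assume "\<gamma> p \<in> A i"
    then obtain \<delta> where "\<delta> \<in> \<Gamma>" "(\<delta> \<circ> \<gamma>) p \<in> U i" by (auto simp: A_iff)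
    then show "p \<in> A i" using that comp_mem A_iff by metis
  next
    assume "p \<in> A i"
    then obtain \<delta> where "\<delta> \<in> \<Gamma>" "\<delta> p \<in> U i" by (auto simp: A_iff)
    then have "(\<delta> \<circ> inv \<gamma>) (\<gamma> p) \<in> U i" "\<delta> \<circ> inv \<gamma> \<in> \<Gamma>"
      using that by (simp, intro comp_mem inv_mem)
    then show "\<gamma> p \<in> A i" using A_iff by metis
  qed
  define F where "F = (\<Union>i. U i - (\<Union>j<i. A j))"
  have "open (A i)" for i unfolding A_def by (intro open_UN ballI open_vimage_apply) (auto simp: U_def)
  then have "F \<in> sets borel"
    unfolding F_def U_def by (intro sets.countable_UN'' sets.Diff sets.countable_UN') auto
  moreover have *: "\<exists>!q. q \<in> orbit \<Gamma> p \<and> q \<in> F" for p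
  proof -
    define i where "i = (LEAST i. p \<in> A i)"
    have "\<exists>i. p \<in> A i" using cover[of p] id_mem A_iff by (metis id_apply)
    then have i: "p \<in> A i" "\<And>j. j < i \<Longrightarrow> p \<notin> A j"
      unfolding i_def by (metis LeastI, metis not_less_Least)
    obtain \<gamma> where g: "\<gamma> \<in> \<Gamma>" "\<gamma> p \<in> U i" using i(1) A_iff by auto
    have inF: "\<delta> p \<in> F \<longleftrightarrow> \<delta> p \<in> U i" if "\<delta> \<in> \<Gamma>" for \<delta>
    proof
      assume "\<delta> p \<in> F"
      then obtain k where k: "\<delta> p \<in> U k" "\<And>j. j < k \<Longrightarrow> \<delta> p \<notin> A j" by (auto simp: F_def)
      then have "p \<in> A k" "\<And>j. j < k \<Longrightarrow> p \<notin> A j" using that A_iff A_inv[OF that] by blast+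
      then have "k = i" using i by (metis linorder_neqE_nat)
      then show "\<delta> p \<in> U i" using k by simp
    next
      assume "\<delta> p \<in> U i"
      then show "\<delta> p \<in> F" using i(2) that A_inv by (auto simp: F_def)
    qed
    show ?thesis
    proof (rule ex1I[of _ "\<gamma> p"])
      show "\<gamma> p \<in> orbit \<Gamma> p \<and> \<gamma> p \<in> F" using g inF by (auto simp: mem_orbit)
      fix q assume q: "q \<in> orbit \<Gamma> p \<and> q \<in> F"
      then obtain \<delta> where d: "\<delta> \<in> \<Gamma>" "q = \<delta> p" by (auto simp: mem_orbit)
      then have "\<delta> p \<in> U i" using q inF by simp
      moreover have "(\<delta> \<circ> inv \<gamma>) (\<gamma> p) = \<delta> p" using g by simp
      ultimately have "\<delta> \<circ> inv \<gamma> = id"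
        using small[of "\<gamma> p" i "\<delta> \<circ> inv \<gamma>"] g d by (metis comp_mem inv_mem)
      then show "q = \<gamma> p" using d(2) \<open>(\<delta> \<circ> inv \<gamma>) (\<gamma> p) = \<delta> p\<close> by simp
    qed
  qed
  moreover have "\<forall>X\<in>quotient_points \<Gamma>. \<exists>!q. q \<in> X \<and> q \<in> F"
    unfolding quotient_points_def using * by (intro ballI) (elim rangeE, simp only:)
  ultimately show ?thesis unfolding fundamental_domain_def by (intro exI[of _ F] conjI)
qed

section \<open>Unfolding integrals along the group\<close>

lemma nn_integral_hyperbolic_isometry:
  assumes f: "hyperbolic_isometry f" and h[measurable]: "h \<in> borel_measurable borel"
  shows "(\<integral>\<^sup>+x. h (f x) \<partial>hyperbolic_volume) = (\<integral>\<^sup>+x. h x \<partial>hyperbolic_volume)"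
proof -
  have [measurable]: "f \<in> borel_measurable hyperbolic_volume"
    using borel_measurable_isometry[OF f] by (simp cong: measurable_cong_sets)
  have "distr hyperbolic_volume borel f = hyperbolic_volume"
    by (rule measure_eqI)
      (simp_all add: emeasure_distr emeasure_hyperbolic_volume_vimage[OF f])
  then have "(\<integral>\<^sup>+x. h x \<partial>hyperbolic_volume) = (\<integral>\<^sup>+x. h x \<partial>distr hyperbolic_volume borel f)"
    by simp
  also have "\<dots> = (\<integral>\<^sup>+x. h (f x) \<partial>hyperbolic_volume)"
    by (rule nn_integral_distr) measurable
  finally show ?thesis by simp
qed

lemma borel_measurable_apply: "\<gamma> \<in> \<Gamma> \<Longrightarrow> \<gamma> \<in> borel_measurable borel"
  by (intro borel_measurable_isometry isometry)

text \<open>Exchange sum and integral, move \<open>\<gamma>\<close> from \<open>f\<close> to the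
  domain by invariance of the volume, and use that for each \<open>x\<close> exactly one
  \<open>\<gamma>\<close> has \<open>inv \<gamma> x\<close> in \<open>F\<close>, the action being
  free.\<close>

lemma nn_integral_unfold:
  assumes F: "fundamental_domain \<Gamma> F" and f[measurable]: "f \<in> borel_measurable borel"
  shows "(\<integral>\<^sup>+x. (\<integral>\<^sup>+\<gamma>. f (\<gamma> x) \<partial>count_space \<Gamma>) * indicator F x \<partial>hyperbolic_volume)
    = (\<integral>\<^sup>+x. f x \<partial>hyperbolic_volume)"
proof -
  have FB[measurable]: "F \<in> sets borel" using F by (simp add: fundamental_domain_def)
  have m1: "(\<lambda>x. f (\<gamma> x) * indicator F x) \<in> borel_measurable hyperbolic_volume" if "\<gamma> \<in> \<Gamma>" for \<gamma>
  proof -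
    have [measurable]: "\<gamma> \<in> borel_measurable borel" using that by (rule borel_measurable_apply)
    have "(\<lambda>x. f (\<gamma> x) * indicator F x) \<in> borel_measurable borel" by measurable
    then show ?thesis by (simp cong: measurable_cong_sets)
  qed
  have m2: "(\<lambda>x. f x * indicator F (inv \<gamma> x)) \<in> borel_measurable borel" if "\<gamma> \<in> \<Gamma>" for \<gamma>
  proof -
    have [measurable]: "inv \<gamma> \<in> borel_measurable borel" using that by (intro borel_measurable_apply) simp
    show ?thesis by measurable
  qed
  have m3: "(\<lambda>x. f x * indicator F (inv \<gamma> x)) \<in> borel_measurable hyperbolic_volume" if "\<gamma> \<in> \<Gamma>" for \<gamma>
    using m2[OF that] by (simp cong: measurable_cong_sets)
  have "(\<integral>\<^sup>+x. (\<integral>\<^sup>+\<gamma>. f (\<gamma> x) \<partial>count_space \<Gamma>) * indicator F x \<partial>hyperbolic_volume)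
      = (\<integral>\<^sup>+x. (\<integral>\<^sup>+\<gamma>. f (\<gamma> x) * indicator F x \<partial>count_space \<Gamma>) \<partial>hyperbolic_volume)"
    by (simp add: nn_integral_multc)
  also have "\<dots> = (\<integral>\<^sup>+\<gamma>. (\<integral>\<^sup>+x. f (\<gamma> x) * indicator F x \<partial>hyperbolic_volume) \<partial>count_space \<Gamma>)"
    by (rule nn_integral_count_space_nn_integral[OF countable_group m1])
  also have "\<dots> = (\<integral>\<^sup>+\<gamma>. (\<integral>\<^sup>+x. f x * indicator F (inv \<gamma> x) \<partial>hyperbolic_volume) \<partial>count_space \<Gamma>)"
  proof (rule nn_integral_cong)
    fix \<gamma> assume "\<gamma> \<in> space (count_space \<Gamma>)"
    then have g: "\<gamma> \<in> \<Gamma>" by simp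
    show "(\<integral>\<^sup>+x. f (\<gamma> x) * indicator F x \<partial>hyperbolic_volume)
        = (\<integral>\<^sup>+x. f x * indicator F (inv \<gamma> x) \<partial>hyperbolic_volume)"
      using nn_integral_hyperbolic_isometry[OF isometry[OF g] m2[OF g]] g by simp
  qed
  also have "\<dots> = (\<integral>\<^sup>+x. (\<integral>\<^sup>+\<gamma>. f x * indicator F (inv \<gamma> x) \<partial>count_space \<Gamma>) \<partial>hyperbolic_volume)"
    by (rule nn_integral_count_space_nn_integral[symmetric, OF countable_group m3])
  also have "\<dots> = (\<integral>\<^sup>+x. f x \<partial>hyperbolic_volume)"
  proof (rule nn_integral_cong)
    fix x
    have "orbit \<Gamma> x \<in> quotient_points \<Gamma>" by (simp add: quotient_points_def)
    then have "\<exists>!q. q \<in> orbit \<Gamma> x \<and> q \<in> F"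
      using F unfolding fundamental_domain_def by (elim conjE) (rule bspec)
    then obtain q where q: "q \<in> orbit \<Gamma> x \<and> q \<in> F"
      and q3: "\<forall>q'. q' \<in> orbit \<Gamma> x \<and> q' \<in> F \<longrightarrow> q' = q"
      by (rule ex1E)
    obtain \<delta> where d: "\<delta> \<in> \<Gamma>" "q = \<delta> x" using q unfolding mem_orbit by blast
    have iff: "inv \<gamma> x \<in> F \<longleftrightarrow> \<gamma> = inv \<delta>" if "\<gamma> \<in> \<Gamma>" for \<gamma>
    proof
      assume "inv \<gamma> x \<in> F"
      moreover have "inv \<gamma> x \<in> orbit \<Gamma> x" using that unfolding mem_orbit by (metis inv_mem)
      ultimately have "inv \<gamma> x = \<delta> x" using q3 d(2) by blast
      then have "inv \<gamma> = \<delta>" using agree_imp_eq that d by simp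
      then show "\<gamma> = inv \<delta>" using that by (metis bij inv_inv_eq)
    next
      assume "\<gamma> = inv \<delta>"
      then have "inv \<gamma> = \<delta>" using d by (metis bij inv_inv_eq)
      then show "inv \<gamma> x \<in> F" using d q by simp
    qed
    have "(\<integral>\<^sup>+\<gamma>. f x * indicator F (inv \<gamma> x) \<partial>count_space \<Gamma>)
        = (\<integral>\<^sup>+\<gamma>. f x * indicator {inv \<delta>} \<gamma> \<partial>count_space \<Gamma>)"
      by (rule nn_integral_cong) (simp add: indicator_def iff)
    also have "\<dots> = f x" using d by (simp add: nn_integral_cmult_indicator)
    finally show "(\<integral>\<^sup>+\<gamma>. f x * indicator F (inv \<gamma> x) \<partial>count_space \<Gamma>) = f x" .
  qed
  finally show ?thesis .
qed

text \<open>Unfold the indicator of a ball that meets every orbit: its volume bounds that of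
  \<open>F\<close>.\<close>

lemma emeasure_fundamental_domain_finite:
  assumes F: "fundamental_domain \<Gamma> F"
  shows "emeasure hyperbolic_volume F < \<infinity>"
proof -
  obtain R where R: "R \<ge> 0" "\<And>p. \<exists>\<gamma>\<in>\<Gamma>. dist (\<gamma> p) (hchart 0) \<le> R" using cobounded by blast
  have FB[measurable]: "F \<in> sets borel" using F by (simp add: fundamental_domain_def)
  let ?B = "ball (hchart 0 :: 'a hyperbolic) (R + 1)"
  have "1 \<le> (\<integral>\<^sup>+\<gamma>. indicator ?B (\<gamma> x) \<partial>count_space \<Gamma>)" for x
  proof -
    obtain \<delta> where d: "\<delta> \<in> \<Gamma>" "dist (\<delta> x) (hchart 0) \<le> R" using R by blast
    have "1 = (\<integral>\<^sup>+\<gamma>. indicator {\<delta>} \<gamma> \<partial>count_space \<Gamma>)" using d by simp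
    also have "\<dots> \<le> (\<integral>\<^sup>+\<gamma>. indicator ?B (\<gamma> x) \<partial>count_space \<Gamma>)"
      using d by (intro nn_integral_mono) (auto simp: indicator_def dist_commute)
    finally show ?thesis .
  qed
  then have "(\<integral>\<^sup>+x. 1 * indicator F x \<partial>hyperbolic_volume)
      \<le> (\<integral>\<^sup>+x. (\<integral>\<^sup>+\<gamma>. indicator ?B (\<gamma> x) \<partial>count_space \<Gamma>) * indicator F x \<partial>hyperbolic_volume)"
    by (intro nn_integral_mono mult_right_mono) auto
  also have "\<dots> = (\<integral>\<^sup>+x. indicator ?B x \<partial>hyperbolic_volume)"
    by (rule nn_integral_unfold[OF F]) (intro borel_measurable_indicator borel_open open_ball)
  also have "\<dots> < \<infinity>" by (simp add: emeasure_hyperbolic_ball)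
  finally show ?thesis by simp
qed

definition domain :: "'a hyperbolic set" where
  "domain = (SOME F. fundamental_domain \<Gamma> F)"

lemma fundamental_domain: "fundamental_domain \<Gamma> domain"
  unfolding domain_def by (rule someI_ex[OF fundamental_domain_exists])

lemma emeasure_domain: "emeasure hyperbolic_volume domain = ennreal (vol \<Gamma>)"
  using emeasure_fundamental_domain_finite[OF fundamental_domain]
  unfolding vol_def domain_def by (metis emeasure_eq_ennreal_measure infinity_ennreal_def less_irrefl)

lemma sets_domain [measurable]: "domain \<in> sets borel"
  using fundamental_domain by (simp add: fundamental_domain_def)

subsection \<open>Lifting closed geodesics\<close>

text \<open>A Lebesgue number \<open>r\<close> makes the local condition uniform. Points
  \<open>p k\<close> over equally spaced times are lifted one after the other; since points two
  steps apart are at distance \<open>2 * \<eta>\<close>, all lie on one line \<open>g\<close>. The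
  times between them are filled in, and the element closing up the lift is seen to translate
  \<open>g\<close>.\<close>

lemma closed_geodesic_lift:
  assumes c: "closed_geodesic \<Gamma> l c"
  obtains g \<gamma> where "\<gamma> \<in> \<Gamma>" "translates \<gamma> g l" "\<And>t. c t = orbit \<Gamma> (g t)"
proof -
  obtain e where e: "e > 0" "\<And>\<gamma> p. \<gamma> \<in> \<Gamma> \<Longrightarrow> \<gamma> \<noteq> id \<Longrightarrow> e \<le> dist p (\<gamma> p)"
    using injectivity_radius by metis
  have small: "\<gamma> p = p" if "\<gamma> \<in> \<Gamma>" "dist p (\<gamma> p) < e" for \<gamma> p
    using e(2)[OF that(1), of p] that(2) by (cases "\<gamma> = id") auto
  have l: "l > 0" and range: "range c \<subseteq> quotient_points \<Gamma>" and per: "\<And>t. c (t + l) = c t"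
    and "\<And>t. \<exists>\<epsilon>>0. \<forall>s\<in>{t-\<epsilon><..<t+\<epsilon>}. \<forall>s'\<in>{t-\<epsilon><..<t+\<epsilon>}. setdist (c s) (c s') = \<bar>s - s'\<bar>"
    using c unfolding closed_geodesic_def by auto
  then obtain \<epsilon> where \<epsilon>: "\<And>t. \<epsilon> t > 0"
    "\<And>t s s'. s \<in> {t-\<epsilon> t<..<t+\<epsilon> t} \<Longrightarrow> s' \<in> {t-\<epsilon> t<..<t+\<epsilon> t} \<Longrightarrow> setdist (c s) (c s') = \<bar>s - s'\<bar>"
    by metis
  have per': "c (t + real k * l) = c t" for t k
  proof (induction k)
    case (Suc k)
    have "t + real (Suc k) * l = (t + real k * l) + l" by (simp add: algebra_simps)
    then show ?case using per Suc by metis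
  qed simp
  obtain r where r: "r > 0" "\<And>t. t \<in> {0..l} \<Longrightarrow> \<exists>G\<in>range (\<lambda>t. {t-\<epsilon> t<..<t+\<epsilon> t}). ball t r \<subseteq> G"
  proof (rule Heine_Borel_lemma[of "{0..l}" "range (\<lambda>t. {t-\<epsilon> t<..<t+\<epsilon> t})"])
    show "{0..l} \<subseteq> \<Union> (range (\<lambda>t. {t-\<epsilon> t<..<t+\<epsilon> t}))"
    proof
      fix t have "t \<in> {t-\<epsilon> t<..<t+\<epsilon> t}" using \<epsilon>(1)[of t] by simp
      then show "t \<in> \<Union> (range (\<lambda>t. {t-\<epsilon> t<..<t+\<epsilon> t}))" by blast
    qed
  qed auto
  have loc: "setdist (c s) (c s') = \<bar>s - s'\<bar>" if "s \<ge> 0" "\<bar>s - s'\<bar> < r" for s s'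
  proof -
    define k where "k = nat \<lfloor>s / l\<rfloor>"
    have k: "real k \<le> s / l" "s / l \<le> real k + 1" using that l by (auto simp: k_def)
    define t t' where "t = s - real k * l" and "t' = s' - real k * l"
    have "t \<in> {0..l}" using k l by (auto simp: t_def field_simps)
    then obtain u where u: "ball t r \<subseteq> {u-\<epsilon> u<..<u+\<epsilon> u}" using r(2) by blast
    have "t \<in> ball t r" "t' \<in> ball t r" using r(1) that by (auto simp: dist_real_def t_def t'_def)
    then have "setdist (c t) (c t') = \<bar>t - t'\<bar>" using u by (intro \<epsilon>(2)) blast+
    then show ?thesis using per'[of t k] per'[of t' k] by (simp add: t_def t'_def)
  qed
  \<comment> \<open>A step below a quarter of \<open>r\<close> keeps two successive steps in the
    range where \<open>c\<close> preserves distances; below a quarter of \<open>e\<close>, points of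
    one orbit that are at most \<open>2 * \<eta>\<close> apart coincide.\<close>
  obtain N where N: "real N > 4 * l / r + 4 * l / e + 1"  using reals_Archimedean2 by blast
  define \<eta> where "\<eta> = l / real N"
  have "4 * l / r > 0" "4 * l / e > 0" using l r e by auto
  then have N': "real N > 4 * l / r" "real N > 4 * l / e" "real N > 0" using N by linarith+
  have \<eta>: "\<eta> > 0" "4 * \<eta> < r" "4 * \<eta> < e" "real N * \<eta> = l"
    using N' l r(1) e(1) by (auto simp: \<eta>_def field_simps)
  have mem: "p \<in> c s \<longleftrightarrow> c s = orbit \<Gamma> p" for p s
  proof -
    obtain q where "c s = orbit \<Gamma> q" using range by (auto simp: quotient_points_def)
    then show ?thesis using orbit_eq_iff mem_orbit self_mem_orbit by metis
  qed
  have step: "\<exists>q. q \<in> c s' \<and> dist p q = \<bar>s - s'\<bar>" if p: "p \<in> c s" and s: "s \<ge> 0" "\<bar>s - s'\<bar> < r" for p s s'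
  proof -
    obtain q where q: "c s' = orbit \<Gamma> q" using range by (auto simp: quotient_points_def)
    have p': "c s = orbit \<Gamma> p" using p mem by simp
    obtain \<gamma> where "\<gamma> \<in> \<Gamma>" "setdist (orbit \<Gamma> p) (orbit \<Gamma> q) = dist p (\<gamma> q)"
      using setdist_orbit_attained by metis
    then show ?thesis using loc[OF s] q p' by (intro exI[of _ "\<gamma> q"]) (auto simp: mem_orbit)
  qed
  have low: "\<bar>s - s'\<bar> \<le> dist p q" if "p \<in> c s" "q \<in> c s'" "s \<ge> 0" "\<bar>s - s'\<bar> < r" for p q s s'
    using setdist_orbit_le_dist[of p q] loc[OF that(3,4)] that(1,2) mem by simp
  have "\<exists>p. \<forall>k. p k \<in> c (real k * \<eta>) \<and> dist (p k) (p (Suc k)) = \<eta>"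
  proof (rule dependent_nat_choice)
    show "\<exists>x. x \<in> c (real 0 * \<eta>)" using step mem self_mem_orbit range
      by (metis imageE quotient_points_def rangeI subsetD)
    fix x k assume "x \<in> c (real k * \<eta>)"
    then show "\<exists>y. y \<in> c (real (Suc k) * \<eta>) \<and> dist x y = \<eta>"
      using step[of x "real k * \<eta>" "real (Suc k) * \<eta>"] \<eta> by (auto simp: algebra_simps)
  qed
  then obtain p where p: "\<And>k. p k \<in> c (real k * \<eta>)" "\<And>k. dist (p k) (p (Suc k)) = \<eta>" by blast
  have p2: "dist (p k) (p (Suc (Suc k))) = 2 * \<eta>" for k
  proof (rule antisym)
    show "dist (p k) (p (Suc (Suc k))) \<le> 2 * \<eta>"
      using dist_triangle[of "p k" "p (Suc (Suc k))" "p (Suc k)"] p(2)[of k] p(2)[of "Suc k"] by simp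
    show "2 * \<eta> \<le> dist (p k) (p (Suc (Suc k)))"
      using low[OF p(1)[of k] p(1)[of "Suc (Suc k)"]] \<eta> by (simp add: algebra_simps)
  qed
  have "p 0 \<noteq> p 1" using p(2)[of 0] \<eta>(1) by auto
  then obtain g where g: "geodesic_line g" "g 0 = p 0" "g \<eta> = p 1"
    using geodesic_line_exists[of "p 0" "p 1"] p(2)[of 0] by auto
  have d: "dist (g s) (g t) = \<bar>s - t\<bar>" for s t using g(1) by (simp add: geodesic_line_def)
  have pg: "p k = g (real k * \<eta>) \<and> p (Suc k) = g (real (Suc k) * \<eta>)" for k
  proof (induction k)
    case 0
    then show ?case using g by simp
  next
    case (Suc k)
    have "p (Suc (Suc k)) = g (real (Suc (Suc k)) * \<eta>)"
    proof (rule geodesic_line_determined[OF g(1), of "real k * \<eta>" "real (Suc k) * \<eta>"])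
      show "real k * \<eta> \<noteq> real (Suc k) * \<eta>" using \<eta>(1) by simp
      show "dist (p (Suc (Suc k))) (g (real k * \<eta>)) = \<bar>real (Suc (Suc k)) * \<eta> - real k * \<eta>\<bar>"
        using p2[of k] Suc.IH \<eta>(1) by (simp add: dist_commute algebra_simps)
      show "dist (p (Suc (Suc k))) (g (real (Suc k) * \<eta>)) = \<bar>real (Suc (Suc k)) * \<eta> - real (Suc k) * \<eta>\<bar>"
        using p(2)[of "Suc k"] Suc.IH \<eta>(1) by (simp add: dist_commute algebra_simps)
    qed
    then show ?case using Suc.IH by blast
  qed
  have cg: "c t = orbit \<Gamma> (g t)" if t: "t \<ge> 0" for t
  proof -
    define k where "k = nat \<lfloor>t / \<eta>\<rfloor>"
    have "real k \<le> t / \<eta>" "t / \<eta> \<le> real k + 1" using t \<eta>(1) by (auto simp: k_def)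
    then have k: "real k * \<eta> \<le> t" "t \<le> real (Suc k) * \<eta>" using \<eta>(1) by (auto simp: field_simps)
    have sk: "real (Suc k) * \<eta> = real k * \<eta> + \<eta>" by (simp add: algebra_simps)
    \<comment> \<open>Representatives of \<open>c t\<close> near the two neighbouring sample points
      are compared: they lie in one orbit and within \<open>2 * \<eta>\<close>, so they agree, and
      the two distances put this point on \<open>g\<close>.\<close>
    obtain q where q: "q \<in> c t" "dist (p k) q = \<bar>real k * \<eta> - t\<bar>"
      using step[OF p(1)[of k], of t] \<eta> k sk by auto
    obtain q' where q': "q' \<in> c t" "dist (p (Suc k)) q' = \<bar>real (Suc k) * \<eta> - t\<bar>"
      using step[OF p(1)[of "Suc k"], of t] \<eta> k sk by auto
    obtain \<gamma> where \<gamma>: "\<gamma> \<in> \<Gamma>" "q' = \<gamma> q" using q q' mem orbit_eq_iff by metis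
    have "dist q q' \<le> dist (p k) q + dist (p k) (p (Suc k)) + dist (p (Suc k)) q'"
      using dist_triangle[of q q' "p k"] dist_triangle[of "p k" q' "p (Suc k)"] by (simp add: dist_commute)
    also have "\<dots> < e" using q q' p(2)[of k] k sk \<eta> by auto
    finally have "q' = q" using small \<gamma> by simp
    have "q = g t"
      by (rule geodesic_line_determined[OF g(1), of "real k * \<eta>" "real (Suc k) * \<eta>"])
        (use q q' \<open>q' = q\<close> pg[of k] \<eta>(1) in \<open>auto simp: dist_commute abs_minus_commute\<close>)
    then show ?thesis using q mem by simp
  qed
  have "orbit \<Gamma> (g l) = orbit \<Gamma> (g 0)" using cg[of 0] cg[of l] per[of 0] l by simp
  then obtain \<gamma> where \<gamma>: "\<gamma> \<in> \<Gamma>" "g l = \<gamma> (g 0)" using orbit_eq_iff by metis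
  have "orbit \<Gamma> (g (\<eta> + l)) = orbit \<Gamma> (g \<eta>)"
    using cg[of \<eta>] cg[of "\<eta> + l"] per[of \<eta>] l \<eta>(1) by simp
  then obtain \<delta> where \<delta>: "\<delta> \<in> \<Gamma>" "g (\<eta> + l) = \<delta> (g \<eta>)" using orbit_eq_iff by metis
  \<comment> \<open>\<open>\<gamma>\<close> closes the lift at time 0 and \<open>\<delta>\<close> at
    time \<open>\<eta>\<close>. They send \<open>g \<eta>\<close> to nearby points of one orbit, so
    \<open>\<gamma>\<close> is right at both times and hence on the whole line.\<close>
  have "dist (\<delta> (g \<eta>)) (\<gamma> (g \<eta>)) \<le> dist (\<delta> (g \<eta>)) (\<gamma> (g 0)) + dist (\<gamma> (g 0)) (\<gamma> (g \<eta>))"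
    by (rule dist_triangle)
  also have "dist (\<delta> (g \<eta>)) (\<gamma> (g 0)) = \<eta>" using \<eta>(1) by (simp add: d flip: \<gamma>(2) \<delta>(2))
  also have "dist (\<gamma> (g 0)) (\<gamma> (g \<eta>)) = \<eta>" using \<gamma>(1) \<eta>(1) by (simp add: d)
  finally have "dist (\<gamma> (g \<eta>)) (\<delta> (g \<eta>)) < e" using \<eta>(1,3) by (simp add: dist_commute)
  moreover have "dist ((inv \<delta> \<circ> \<gamma>) (g \<eta>)) (g \<eta>) = dist (\<gamma> (g \<eta>)) (\<delta> (g \<eta>))"
    using \<delta>(1) by (simp add: dist_inv)
  ultimately have "dist (g \<eta>) ((inv \<delta> \<circ> \<gamma>) (g \<eta>)) < e" by (simp add: dist_commute)
  then have "(inv \<delta> \<circ> \<gamma>) (g \<eta>) = g \<eta>" using small[of "inv \<delta> \<circ> \<gamma>" "g \<eta>"] \<gamma> \<delta> by (metis comp_mem inv_mem)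
  then have "\<gamma> (g \<eta>) = g (\<eta> + l)" using \<delta> by (metis comp_apply inv_apply(1))
  then have "(\<lambda>t. \<gamma> (g t)) = (\<lambda>t. g (t + l))"
    using \<eta>(1) \<gamma> by (intro geodesic_line_eqI[of _ _ 0 \<eta>] geodesic_line_shift g(1)
        geodesic_line_compose[OF g(1)]) auto
  then have tr: "translates \<gamma> g l" using g(1) by (auto simp: translates_def dest: fun_cong)
  have og: "orbit \<Gamma> (g (t + real k * l)) = orbit \<Gamma> (g t)" for t k
  proof (induction k)
    case (Suc k)
    have "g (t + real (Suc k) * l) = \<gamma> (g (t + real k * l))"
      using tr by (simp add: translates_def algebra_simps)
    then show ?case using Suc \<gamma>(1) by simp
  qed simp
  have "c t = orbit \<Gamma> (g t)" for t
  proof -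
    obtain k where "real k > - t / l" using reals_Archimedean2 by blast
    then have "t + real k * l \<ge> 0" using l by (simp add: field_simps)
    from cg[OF this] show ?thesis by (simp add: og per')
  qed
  with \<gamma>(1) tr show thesis using that by blast
qed

subsection \<open>Free homotopy classes\<close>

lemma continuous_map_orbit: "continuous_map euclidean (quotient_top \<Gamma>) (orbit \<Gamma>)"
proof -
  interpret Q: Metric_space "quotient_points \<Gamma>" setdist by (rule Metric_space_quotient)
  have "\<exists>U. openin euclidean U \<and> p \<in> U \<and> (\<forall>q\<in>U. orbit \<Gamma> q \<in> Q.mball (orbit \<Gamma> p) \<epsilon>)"
    if "\<epsilon> > 0" for p \<epsilon>
  proof (intro exI conjI ballI)
    show "openin euclidean (ball p \<epsilon>)" "p \<in> ball p \<epsilon>" using that by (auto simp flip: open_openin)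
    fix q assume "q \<in> ball p \<epsilon>"
    then have "setdist (orbit \<Gamma> p) (orbit \<Gamma> q) < \<epsilon>"
      using setdist_orbit_le_dist[of p q] by simp
    moreover have "orbit \<Gamma> p \<in> quotient_points \<Gamma>" "orbit \<Gamma> q \<in> quotient_points \<Gamma>"
      unfolding quotient_points_def by blast+
    ultimately show "orbit \<Gamma> q \<in> Q.mball (orbit \<Gamma> p) \<epsilon>" by simp
  qed
  then show ?thesis unfolding quotient_top_def Q.continuous_map_to_metric by simp
qed

definition axis_class :: "real \<Rightarrow> (real \<Rightarrow> 'a hyperbolic) \<Rightarrow> (real \<Rightarrow> 'a hyperbolic set) set" where
  "axis_class l g = free_homotopy_class \<Gamma> (\<lambda>s. orbit \<Gamma> (g (l * s)))"

text \<open>The homotopy slides the starting point along the line; every intermediate path closes up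
  in the quotient because \<open>\<gamma>\<close> maps its start to its end.\<close>

lemma axis_class_shift:
  assumes \<gamma>: "\<gamma> \<in> \<Gamma>" and tr: "translates \<gamma> g l"
  shows "axis_class l (\<lambda>t. g (t + a)) = axis_class l g"
proof -
  let ?P = "\<lambda>h :: real \<Rightarrow> 'a hyperbolic set. h 0 = h 1"
  have gl: "geodesic_line g" and g: "\<And>t. g (t + l) = \<gamma> (g t)" using tr by (auto simp: translates_def)
  define h where "h = orbit \<Gamma> \<circ> (\<lambda>(\<tau>::real, s). g (l * s + a * \<tau>))"
  have "continuous_on ({0..1} \<times> {0..1}) (\<lambda>(\<tau>::real, s). g (l * s + a * \<tau>))"
    unfolding case_prod_beta
    by (rule continuous_on_compose2[OF continuous_geodesic_line[OF gl, of UNIV]])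
      (auto intro!: continuous_intros)
  then have "continuous_map (top_of_set ({0..1} \<times> {0..1})) (quotient_top \<Gamma>) h"
    unfolding h_def by (intro continuous_map_compose[OF _ continuous_map_orbit]) simp
  moreover have "prod_topology (top_of_set {0..1::real}) (top_of_set {0..1::real})
      = top_of_set ({0..1} \<times> {0..1})"
    by (simp add: prod_topology_subtopology_eu)
  ultimately have "homotopic_with ?P (top_of_set {0..1}) (quotient_top \<Gamma>)
      (\<lambda>s. orbit \<Gamma> (g (l * s))) (\<lambda>s. orbit \<Gamma> (g (l * s + a)))"
    unfolding homotopic_with_def using \<gamma> g[of "a * _"]
    by (intro exI[of _ h]) (auto simp: h_def add.commute)
  then show ?thesis
    unfolding axis_class_def free_homotopy_class_def
    by (auto intro: homotopic_with_trans homotopic_with_symD)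
qed

text \<open>By uniqueness of axes \<open>h\<close> is \<open>\<delta>\<close> applied to
  \<open>g\<close>, up to a shift, and \<open>\<delta>\<close> disappears in the quotient. So
  elements representing different classes are never conjugate, and counting can be done in the
  group.\<close>

lemma axis_class_conj:
  assumes \<gamma>: "\<gamma> \<in> \<Gamma>" "\<delta> \<in> \<Gamma>" and l: "l > 0"
    and tr: "translates \<gamma> g l" "translates (\<delta> \<circ> \<gamma> \<circ> inv \<delta>) h l"
  shows "axis_class l h = axis_class l g"
proof -
  have "translates (\<delta> \<circ> \<gamma> \<circ> inv \<delta>) (\<lambda>t. \<delta> (g t)) l"
    using translates_conj[OF tr(1)] \<gamma> by simp
  then obtain a where a: "\<And>t. h t = \<delta> (g (t + a))"
    using axis_unique_positive[OF _ _ tr(2) l l] conj_mem[OF \<gamma>] isometry by blast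
  have "axis_class l h = axis_class l (\<lambda>t. g (t + a))"
    unfolding axis_class_def using \<gamma>(2) by (simp add: a)
  then show ?thesis using axis_class_shift[OF \<gamma>(1) tr(1)] by simp
qed

end

section \<open>Isometries near the identity\<close>

definition lorentz_blinfun :: "('a::euclidean_space hyperbolic \<Rightarrow> 'a hyperbolic) \<Rightarrow> ('a \<times> real) \<Rightarrow>\<^sub>L ('a \<times> real)" where
  "lorentz_blinfun f = Blinfun (rep f)"

lemma lorentz_blinfun_apply [simp]: "hyperbolic_isometry f \<Longrightarrow> blinfun_apply (lorentz_blinfun f) = rep f"
  unfolding lorentz_blinfun_def
  by (intro bounded_linear_Blinfun_apply linear_conv_bounded_linear[THEN iffD1] linear_rep)

lemma lorentz_blinfun_comp:
  assumes "hyperbolic_isometry f" "hyperbolic_isometry g"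
  shows "lorentz_blinfun (f \<circ> g) = lorentz_blinfun f o\<^sub>L lorentz_blinfun g"
  by (rule blinfun_eqI) (simp add: assms hyperbolic_isometry_comp rep_comp)

lemma lorentz_blinfun_id: "lorentz_blinfun id = id_blinfun"
  by (rule blinfun_eqI) (simp add: hyperbolic_isometry_id rep_id)

lemma lorentz_blinfun_inject:
  assumes "hyperbolic_isometry f" "hyperbolic_isometry g" "lorentz_blinfun f = lorentz_blinfun g"
  shows "f = g"
  using assms by (intro rep_inject) (auto simp flip: lorentz_blinfun_apply)

lemma lform_cauchy_schwarz: "\<bar>lform u w\<bar> \<le> norm u * norm w"
proof -
  have "lform u w = (- fst u, snd u) \<bullet> w" by (cases w) (simp add: lform_def)
  also have "\<bar>\<dots>\<bar> \<le> norm (- fst u, snd u) * norm w" by (rule Cauchy_Schwarz_ineq2)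
  also have "norm (- fst u, snd u) = norm u" by (cases u) (simp add: norm_Pair)
  finally show ?thesis .
qed

text \<open>Bounds the operator norm of an isometry moving the base point by at most 1. The estimate
  gives \<open>5 * (cosh 1)\<^sup>2\<close> for the square of the norm; 5 is rounded up to
  9.\<close>

definition lorentz_bound :: real where
  "lorentz_bound = 3 * cosh 1"

lemma lorentz_bound: "lorentz_bound \<ge> 1" "lorentz_bound > 0"
  using cosh_real_ge_1[of 1] by (auto simp: lorentz_bound_def)

text \<open>By \<open>norm_square_lform\<close> it suffices to bound the pairing of
  \<open>rep f v\<close> with the base point. It equals the pairing of \<open>v\<close> with the
  preimage of the base point, a vector of norm at most \<open>sqrt 2 * cosh 1\<close>.\<close>

lemma norm_lorentz_blinfun_le:
  fixes f :: "'a::euclidean_space hyperbolic \<Rightarrow> 'a hyperbolic"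
  assumes f: "hyperbolic_isometry f" and d: "dist (f (hchart 0)) (hchart 0) \<le> 1"
  shows "norm (lorentz_blinfun f) \<le> lorentz_bound"
proof (rule norm_blinfun_bound)
  fix v
  define o' where "o' = (hchart 0 :: 'a hyperbolic)"
  have inv: "hyperbolic_isometry (inv f)" by (rule hyperbolic_isometry_inv[OF f])
  have fi: "f (inv f o') = o'" using f by (simp add: hyperbolic_isometry_def surj_f_inv_f)
  have "dist (inv f o') o' = dist (f (inv f o')) (f o')"
    using f by (simp add: hyperbolic_isometry_def)
  then have "dist (inv f o') o' \<le> 1" using d by (simp add: fi dist_commute flip: o'_def)
  then have t: "htime (inv f o') \<le> cosh 1"
    by (simp add: htime_eq_cosh cosh_real_nonneg_le_iff flip: o'_def)
  have "lform (emb (inv f o')) (emb o') = htime (inv f o')"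
    by (simp add: o'_def emb_hchart lform_def) (simp add: emb_def)
  then have "(norm (emb (inv f o')))\<^sup>2 \<le> 2 * (htime (inv f o'))\<^sup>2"
    by (simp add: norm_square_lform flip: o'_def)
  also have "\<dots> \<le> 2 * (cosh 1)\<^sup>2"
    using t htime_pos[of "inv f o'"] by (intro mult_left_mono power_mono) auto
  finally have n: "(norm (emb (inv f o')))\<^sup>2 \<le> 2 * (cosh 1)\<^sup>2" .
  have l: "lform (rep f v) (emb o') = lform v (emb (inv f o'))"
    using lform_rep[OF f, of v "emb (inv f o')"] by (simp add: rep_emb[OF f] fi)
  have "(lform v (emb (inv f o')))\<^sup>2 \<le> (norm v)\<^sup>2 * (norm (emb (inv f o')))\<^sup>2"
    using power_mono[OF lform_cauchy_schwarz[of v "emb (inv f o')"], of 2]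
    by (simp add: power_mult_distrib)
  also have "\<dots> \<le> (norm v)\<^sup>2 * (2 * (cosh 1)\<^sup>2)" by (rule mult_left_mono[OF n]) simp
  finally have 1: "(lform v (emb (inv f o')))\<^sup>2 \<le> (norm v)\<^sup>2 * (2 * (cosh 1)\<^sup>2)" .
  have 2: "- lform v v \<le> (norm v)\<^sup>2"
    using lform_cauchy_schwarz[of v v] by (simp add: power2_eq_square)
  have 3: "(norm v)\<^sup>2 * 1 \<le> (norm v)\<^sup>2 * (cosh 1)\<^sup>2"
    using one_le_power[OF cosh_real_ge_1[of 1], of 2] by (intro mult_left_mono) auto
  have "(norm (rep f v))\<^sup>2 = 2 * (lform v (emb (inv f o')))\<^sup>2 - lform v v"
    using l by (simp add: norm_square_lform lform_rep[OF f] flip: o'_def)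
  also have "\<dots> \<le> 5 * ((norm v)\<^sup>2 * (cosh 1)\<^sup>2)" using 1 2 3 by linarith
  also have "\<dots> \<le> 9 * ((norm v)\<^sup>2 * (cosh 1)\<^sup>2)" by (rule mult_right_mono) simp_all
  also have "\<dots> = (lorentz_bound * norm v)\<^sup>2" by (simp add: lorentz_bound_def power_mult_distrib)
  finally have "norm (rep f v) \<le> lorentz_bound * norm v"
    by (rule power2_le_imp_le) (use lorentz_bound in simp)
  then show "norm (blinfun_apply (lorentz_blinfun f) v) \<le> lorentz_bound * norm v" using f by simp
qed (use lorentz_bound in simp)

text \<open>The time coordinate of the image of the base point is \<open>cosh\<close> of the
  displacement. It is at most 5/4, and this is at most \<open>cosh 1\<close>.\<close>

lemma displacement_le_of_near_id:
  fixes f :: "'a::euclidean_space hyperbolic \<Rightarrow> 'a hyperbolic"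
  assumes f: "hyperbolic_isometry f" and d: "norm (lorentz_blinfun f - id_blinfun) \<le> 1/4"
  shows "dist (f (hchart 0)) (hchart 0) \<le> 1"
proof -
  define o' where "o' = (hchart 0 :: 'a hyperbolic)"
  have o': "emb o' = (0, 1)" by (simp add: o'_def emb_hchart)
  have "norm (blinfun_apply (lorentz_blinfun f - id_blinfun) (emb o')) \<le> 1/4 * norm (emb o')"
    using norm_blinfun[of "lorentz_blinfun f - id_blinfun" "emb o'"] d
    by (meson mult_right_mono norm_ge_zero order.trans)
  moreover have "blinfun_apply (lorentz_blinfun f - id_blinfun) (emb o') = emb (f o') - emb o'"
    using f by (simp add: blinfun.diff_left rep_emb)
  ultimately have n: "norm (emb (f o') - emb o') \<le> 1/4" by (simp add: o')
  have "\<bar>snd (emb (f o') - emb o')\<bar> \<le> norm (emb (f o') - emb o')"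
    using norm_snd_le[of "snd (emb (f o') - emb o')" "fst (emb (f o') - emb o')"]
    by (simp only: prod.collapse real_norm_def)
  then have "htime (f o') \<le> 5/4" using n by (simp add: emb_def o'[unfolded emb_def])
  moreover have "(5/4::real) \<le> cosh 1"
  proof -
    have "exp (1::real) \<ge> 5/2" using exp_lower_Taylor_quadratic[of 1] by simp
    then have "5/2 \<le> exp 1 + exp (- 1 :: real)" by (intro add_increasing2) simp_all
    then show ?thesis by (simp add: cosh_field_def)
  qed
  ultimately have "cosh (dist (f o') o') \<le> cosh 1" by (simp add: htime_eq_cosh o'_def)
  then show ?thesis by (simp add: cosh_real_nonneg_le_iff o'_def)
qed

lemma blinfun_commutator:
  "(A o\<^sub>L B) - (B o\<^sub>L A)
    = ((A - id_blinfun) o\<^sub>L (B - id_blinfun)) - ((B - id_blinfun) o\<^sub>L (A - id_blinfun))"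
  by (rule blinfun_eqI) (simp add: blinfun.bilinear_simps)

text \<open>The commutator minus the identity is the difference of \<open>g \<circ> h\<close> and
  \<open>h \<circ> g\<close>, followed by multiplication with \<open>inv g \<circ> inv h\<close>;
  that difference is unchanged when the identity is subtracted from both operators. So the bound is
  quadratic in the distances to the identity.\<close>

lemma norm_commutator_le:
  assumes g: "hyperbolic_isometry g" and h: "hyperbolic_isometry h"
    and small: "norm (lorentz_blinfun g - id_blinfun) \<le> 1/4" "norm (lorentz_blinfun h - id_blinfun) \<le> 1/4"
  shows "norm (lorentz_blinfun ((g \<circ> h) \<circ> (inv g \<circ> inv h)) - id_blinfun)
    \<le> 2 * lorentz_bound\<^sup>2 * norm (lorentz_blinfun g - id_blinfun) * norm (lorentz_blinfun h - id_blinfun)"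
proof -
  let ?L = lorentz_blinfun and ?I = id_blinfun
  note iso = g h hyperbolic_isometry_inv[OF g] hyperbolic_isometry_inv[OF h]
  have inv_small: "norm (?L (inv k)) \<le> lorentz_bound"
    if k: "hyperbolic_isometry k" "norm (?L k - ?I) \<le> 1/4" for k :: "'b::euclidean_space hyperbolic \<Rightarrow> 'b hyperbolic"
  proof (rule norm_lorentz_blinfun_le[OF hyperbolic_isometry_inv[OF k(1)]])
    have "dist (inv k (hchart 0)) (hchart 0) = dist (k (inv k (hchart 0))) (k (hchart 0))"
      using k(1) by (simp add: hyperbolic_isometry_def)
    also have "\<dots> = dist (k (hchart 0)) (hchart 0)"
      using k(1) by (simp add: hyperbolic_isometry_def surj_f_inv_f dist_commute)
    finally show "dist (inv k (hchart 0)) (hchart 0) \<le> 1"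
      using displacement_le_of_near_id[OF k] by simp
  qed
  have "(h \<circ> g) \<circ> (inv g \<circ> inv h) = id"
    using g h by (auto simp: fun_eq_iff hyperbolic_isometry_def surj_f_inv_f)
  then have "?I = ?L (h \<circ> g) o\<^sub>L ?L (inv g \<circ> inv h)"
    using iso by (metis hyperbolic_isometry_comp lorentz_blinfun_comp lorentz_blinfun_id)
  moreover have "?L ((g \<circ> h) \<circ> (inv g \<circ> inv h)) = ?L (g \<circ> h) o\<^sub>L ?L (inv g \<circ> inv h)"
    using iso by (intro lorentz_blinfun_comp hyperbolic_isometry_comp)
  ultimately have "?L ((g \<circ> h) \<circ> (inv g \<circ> inv h)) - ?I
      = (?L (g \<circ> h) - ?L (h \<circ> g)) o\<^sub>L ?L (inv g \<circ> inv h)"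
    by (simp only: bounded_bilinear.diff_left[OF bounded_bilinear_blinfun_compose])
  also have "\<dots> = (((?L g - ?I) o\<^sub>L (?L h - ?I)) - ((?L h - ?I) o\<^sub>L (?L g - ?I)))
      o\<^sub>L (?L (inv g) o\<^sub>L ?L (inv h))"
    by (simp only: lorentz_blinfun_comp[OF g h] lorentz_blinfun_comp[OF h g]
        lorentz_blinfun_comp[OF iso(3,4)] blinfun_commutator[of "?L g" "?L h"])
  finally have eq: "?L ((g \<circ> h) \<circ> (inv g \<circ> inv h)) - ?I
      = (((?L g - ?I) o\<^sub>L (?L h - ?I)) - ((?L h - ?I) o\<^sub>L (?L g - ?I)))
      o\<^sub>L (?L (inv g) o\<^sub>L ?L (inv h))" .
  have "norm (?L ((g \<circ> h) \<circ> (inv g \<circ> inv h)) - ?I)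
      \<le> norm (((?L g - ?I) o\<^sub>L (?L h - ?I)) - ((?L h - ?I) o\<^sub>L (?L g - ?I)))
      * norm (?L (inv g) o\<^sub>L ?L (inv h))"
    unfolding eq by (rule norm_blinfun_compose)
  also have "\<dots> \<le> (2 * (norm (?L g - ?I) * norm (?L h - ?I))) * (lorentz_bound * lorentz_bound)"
  proof (rule mult_mono)
    have "norm (((?L g - ?I) o\<^sub>L (?L h - ?I)) - ((?L h - ?I) o\<^sub>L (?L g - ?I)))
        \<le> norm ((?L g - ?I) o\<^sub>L (?L h - ?I)) + norm ((?L h - ?I) o\<^sub>L (?L g - ?I))"
      by (rule norm_triangle_ineq4)
    also have "\<dots> \<le> norm (?L g - ?I) * norm (?L h - ?I) + norm (?L h - ?I) * norm (?L g - ?I)"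
      by (intro add_mono norm_blinfun_compose)
    finally show "norm (((?L g - ?I) o\<^sub>L (?L h - ?I)) - ((?L h - ?I) o\<^sub>L (?L g - ?I)))
        \<le> 2 * (norm (?L g - ?I) * norm (?L h - ?I))" by (simp add: mult.commute)
    have "norm (?L (inv g) o\<^sub>L ?L (inv h)) \<le> norm (?L (inv g)) * norm (?L (inv h))"
      by (rule norm_blinfun_compose)
    also have "\<dots> \<le> lorentz_bound * lorentz_bound"
      using inv_small[OF g small(1)] inv_small[OF h small(2)] lorentz_bound by (intro mult_mono) auto
    finally show "norm (?L (inv g) o\<^sub>L ?L (inv h)) \<le> lorentz_bound * lorentz_bound" .
  qed auto
  finally show ?thesis by (simp add: power2_eq_square mult_ac)
qed

text \<open>Makes the factor \<open>2 * lorentz_bound\<^sup>2 * zassenhaus_radius\<close> from the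
  commutator estimate equal to 1/2, so commutators move closer to the identity, and respects the
  threshold 1/4 of \<open>displacement_le_of_near_id\<close>.\<close>

definition zassenhaus_radius :: real where
  "zassenhaus_radius = 1 / (4 * lorentz_bound\<^sup>2)"

lemma zassenhaus_radius: "zassenhaus_radius > 0" "zassenhaus_radius \<le> 1/4"
    "2 * lorentz_bound\<^sup>2 * zassenhaus_radius < 1"
  using lorentz_bound one_le_power[OF lorentz_bound(1), of 2]
  by (auto simp: zassenhaus_radius_def field_simps)

section \<open>Group elements sharing an axis\<close>

context closed_hyperbolic_group
begin

text \<open>\<open>z\<close> carries the axis of \<open>h\<close> to an axis of \<open>h\<close>
  with the same shift, hence to the same line up to a change of starting point.\<close>

lemma commute_translates:
  assumes h: "h \<in> \<Gamma>" "translates h g l" "l > 0" and z: "z \<in> \<Gamma>" "z \<circ> h = h \<circ> z"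
  obtains \<tau> where "translates z g \<tau>"
proof -
  have gl: "geodesic_line g" and hg: "\<And>t. h (g t) = g (t + l)" using h by (auto simp: translates_def)
  have "h (z (g t)) = z (g (t + l))" for t using z(2) hg by (metis comp_apply)
  then have "translates h (\<lambda>t. z (g t)) l"
    unfolding translates_def using z(1) by (auto intro!: geodesic_line_compose[OF gl])
  then obtain a where "\<And>t. z (g t) = g (t + a)"
    using axis_unique_positive[OF isometry[OF h(1)] h(2) _ h(3) h(3)] by blast
  then show thesis using that gl by (auto simp: translates_def)
qed

lemma translates_eq:
  assumes "\<gamma> \<in> \<Gamma>" "\<delta> \<in> \<Gamma>" "translates \<gamma> g l" "translates \<delta> g l"
  shows "\<gamma> = \<delta>"
  using assms agree_imp_eq unfolding translates_def by metis

lemma translates_nonzero: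
  assumes "\<gamma> \<in> \<Gamma>" "\<gamma> \<noteq> id" "translates \<gamma> g l"
  shows "l \<noteq> 0"
  using assms fixes_imp_id[of \<gamma> "g 0"] unfolding translates_def by (metis add.right_neutral)

lemma translates_imp_ne_id:
  assumes "translates \<gamma> g l" "l \<noteq> 0"
  shows "\<gamma> \<noteq> id"
proof
  assume "\<gamma> = id"
  then have "g 0 = g l" using assms unfolding translates_def by (metis add_0 id_apply)
  moreover have "dist (g 0) (g l) = \<bar>l\<bar>" using assms by (simp add: translates_def geodesic_line_def)
  ultimately show False using assms by simp
qed

lemma translates_inv: "\<gamma> \<in> \<Gamma> \<Longrightarrow> translates \<gamma> g l \<Longrightarrow> translates (inv \<gamma>) g (- l)"
  unfolding translates_def by (metis inv_eq_iff add.assoc add.left_inverse add.right_neutral)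

text \<open>If \<open>a = \<gamma>\<^sub>1 \<gamma>\<^sub>2\<^sup>-\<^sup>1\<close> and \<open>b = \<gamma>\<^sub>2\<^sup>-\<^sup>1 \<gamma>\<^sub>1\<close> both preserve the line \<open>g\<close>, then so does
  \<open>\<gamma>\<^sub>2\<close>, since \<open>b\<close> also preserves \<open>\<gamma>\<^sub>2\<^sup>-\<^sup>1 g\<close> and has only one axis.\<close>

lemma translates_of_quotients:
  assumes \<gamma>: "\<gamma>1 \<in> \<Gamma>" "\<gamma>2 \<in> \<Gamma>" "\<gamma>1 \<noteq> \<gamma>2" "\<gamma>2 \<noteq> id"
    and a: "translates (\<gamma>1 \<circ> inv \<gamma>2) g \<tau>" and b: "translates (inv \<gamma>2 \<circ> \<gamma>1) g \<tau>'"
  obtains s where "translates \<gamma>2 g s"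
proof -
  have gl: "geodesic_line g" using a by (simp add: translates_def)
  have bid: "inv \<gamma>2 \<circ> \<gamma>1 \<noteq> id" using comp_inv_eq_id \<gamma> by metis
  have aid: "\<gamma>1 \<circ> inv \<gamma>2 \<noteq> id"
  proof
    assume "\<gamma>1 \<circ> inv \<gamma>2 = id"
    then have "\<gamma>1 (inv \<gamma>2 (\<gamma>2 p)) = \<gamma>2 p" for p by (metis comp_apply id_apply)
    then show False using \<gamma> by auto
  qed
  have t0: "\<tau> \<noteq> 0" "\<tau>' \<noteq> 0"
    using translates_nonzero[OF _ aid a] translates_nonzero[OF _ bid b] \<gamma> by (auto intro: comp_mem inv_mem)
  \<comment> \<open>\<open>inv \<gamma>2 \<circ> \<gamma>1\<close> is the conjugate of
    \<open>\<gamma>1 \<circ> inv \<gamma>2\<close> by \<open>inv \<gamma>2\<close>.\<close>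
  have "translates (inv \<gamma>2 \<circ> \<gamma>1) (\<lambda>t. inv \<gamma>2 (g t)) \<tau>"
    using a \<gamma> unfolding translates_def by (auto intro!: geodesic_line_compose[OF gl])
  then obtain c where "\<bar>\<tau>\<bar> = \<bar>\<tau>'\<bar>" and c: "\<And>t. inv \<gamma>2 (g t) = g (t * (\<tau> / \<tau>') + c)"
    using axis_unique[OF _ b _ t0(2,1)] \<gamma> by (metis comp_mem inv_mem isometry)
  then consider "\<tau> / \<tau>' = 1" | "\<tau> / \<tau>' = - 1" using t0 by (auto simp: abs_if split: if_splits)
  then show thesis
  proof cases
    case 1
    then have "translates (inv \<gamma>2) g c" using c gl by (simp add: translates_def)
    then have "translates (inv (inv \<gamma>2)) g (- c)" using \<gamma> by (intro translates_inv) simp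
    then show thesis using that \<gamma> by (simp add: inv_inv_eq)
  next
    case 2
    \<comment> \<open>Here \<open>inv \<gamma>2\<close> would reverse \<open>g\<close> and fix its
      point at time \<open>c / 2\<close>, impossible for a free action.\<close>
    then have "inv \<gamma>2 (g (c / 2)) = g (c / 2)" using c[of "c / 2"] by simp
    then have "\<gamma>2 (g (c / 2)) = g (c / 2)" using \<gamma>(2) by (metis inv_apply(1))
    then show thesis using fixes_imp_id \<gamma> by blast
  qed
qed

subsection \<open>Systolic elements\<close>

definition systolic :: "('a hyperbolic \<Rightarrow> 'a hyperbolic) set" where
  "systolic = {\<gamma> \<in> \<Gamma>. \<exists>g. translates \<gamma> g (systole \<Gamma>)}"

text \<open>For a positive systole, \<open>axis_unique_positive\<close> leaves only the starting
  point on the axis to the choice.\<close>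

definition sys_axis :: "('a hyperbolic \<Rightarrow> 'a hyperbolic) \<Rightarrow> real \<Rightarrow> 'a hyperbolic" where
  "sys_axis \<gamma> = (SOME g. translates \<gamma> g (systole \<Gamma>))"

lemma translates_axis: "\<gamma> \<in> systolic \<Longrightarrow> translates \<gamma> (sys_axis \<gamma>) (systole \<Gamma>)"
  unfolding systolic_def sys_axis_def mem_Collect_eq
  using someI_ex[of "\<lambda>g. translates \<gamma> g (systole \<Gamma>)"] by blast

lemma systolic_mem: "\<gamma> \<in> systolic \<Longrightarrow> \<gamma> \<in> \<Gamma>"
  by (simp add: systolic_def)

definition near :: "'a hyperbolic \<Rightarrow> ('a hyperbolic \<Rightarrow> 'a hyperbolic) set" where
  "near x = {\<gamma> \<in> systolic. \<exists>t. dist x (sys_axis \<gamma> t) < 1/16}"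

lemma near_displacement:
  assumes "\<gamma> \<in> near x" "systole \<Gamma> > 0"
  shows "dist (\<gamma> x) x \<le> systole \<Gamma> + 1/8"
proof -
  obtain t where t: "\<gamma> \<in> systolic" "dist x (sys_axis \<gamma> t) < 1/16" using assms by (auto simp: near_def)
  have tr: "translates \<gamma> (sys_axis \<gamma>) (systole \<Gamma>)" by (rule translates_axis[OF t(1)])
  have "dist (\<gamma> x) x \<le> dist (\<gamma> x) (\<gamma> (sys_axis \<gamma> t)) + dist (\<gamma> (sys_axis \<gamma> t)) (sys_axis \<gamma> t) + dist (sys_axis \<gamma> t) x"
    using dist_triangle[of "\<gamma> x" x "\<gamma> (sys_axis \<gamma> t)"] dist_triangle[of "\<gamma> (sys_axis \<gamma> t)" x "sys_axis \<gamma> t"] by linarith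
  also have "dist (\<gamma> x) (\<gamma> (sys_axis \<gamma> t)) = dist x (sys_axis \<gamma> t)" using systolic_mem[OF t(1)] by simp
  also have "dist (\<gamma> (sys_axis \<gamma> t)) (sys_axis \<gamma> t) = systole \<Gamma>"
    using tr assms(2) by (simp add: translates_def geodesic_line_def)
  finally show ?thesis using t(2) by (simp add: dist_commute)
qed

lemma finite_near:
  assumes "systole \<Gamma> > 0"
  shows "finite (near x)"
proof (rule finite_subset)
  show "near x \<subseteq> {\<gamma> \<in> \<Gamma>. dist (\<gamma> x) x \<le> systole \<Gamma> + 1/8}"
    using near_displacement[OF _ assms] systolic_mem by (auto simp: near_def)
qed (rule finite_bounded_displacement)

lemma eq_if_small_displacement:
  assumes "\<gamma> \<in> \<Gamma>" "\<delta> \<in> \<Gamma>" "dist (\<gamma> p) (\<delta> p) < systole \<Gamma>"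
  shows "\<gamma> = \<delta>"
proof -
  have "dist ((inv \<gamma> \<circ> \<delta>) p) p = dist (\<delta> p) (\<gamma> p)" using assms by (simp add: dist_inv)
  then have "inv \<gamma> \<circ> \<delta> = id"
    using systole_le_displacement[of "inv \<gamma> \<circ> \<delta>" p] assms
    by (metis comp_mem dist_commute inv_mem linorder_not_le)
  then show ?thesis using comp_inv_eq_id assms by metis
qed

subsection \<open>Multiplicity when the systole is large\<close>

lemma near_separated:
  assumes l: "systole \<Gamma> \<ge> 1/2" and \<gamma>: "\<gamma>1 \<in> near x" "\<gamma>2 \<in> near x" "\<gamma>1 \<noteq> \<gamma>2"
    and t: "dist x (sys_axis \<gamma>1 t1) < 1/16" "dist x (sys_axis \<gamma>2 t2) < 1/16"
  defines "T \<equiv> systole \<Gamma> / 2 + 1/4"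
  shows "1/8 \<le> dist (sys_axis \<gamma>1 (t1 + T)) (sys_axis \<gamma>2 (t2 + T))"
proof (rule ccontr)
  let ?l = "systole \<Gamma>"
  assume "\<not> ?thesis"
  then have small: "dist (sys_axis \<gamma>1 (t1 + T)) (sys_axis \<gamma>2 (t2 + T)) < 1/8" by simp
  have mem: "\<gamma>1 \<in> \<Gamma>" "\<gamma>2 \<in> \<Gamma>" using \<gamma> systolic_mem by (auto simp: near_def)
  have tr: "translates \<gamma>1 (sys_axis \<gamma>1) ?l" "translates \<gamma>2 (sys_axis \<gamma>2) ?l"
    using \<gamma> translates_axis by (auto simp: near_def)
  have d: "dist (sys_axis \<gamma>1 s) (sys_axis \<gamma>1 t) = \<bar>s - t\<bar>" "dist (sys_axis \<gamma>2 s) (sys_axis \<gamma>2 t) = \<bar>s - t\<bar>" for s t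
    using tr by (simp_all add: translates_def geodesic_line_def)
  define p1 p2 where "p1 = sys_axis \<gamma>1 (t1 + T - ?l)" and "p2 = sys_axis \<gamma>2 (t2 + T - ?l)"
  have g: "\<gamma>1 p1 = sys_axis \<gamma>1 (t1 + T)" "\<gamma>2 p2 = sys_axis \<gamma>2 (t2 + T)"
    using tr by (simp_all add: translates_def p1_def p2_def)
  have "\<bar>T - ?l\<bar> = ?l / 2 - 1/4" using l by (simp add: T_def abs_if)
  then have e: "dist p1 (sys_axis \<gamma>1 t1) = ?l/2 - 1/4" "dist p2 (sys_axis \<gamma>2 t2) = ?l/2 - 1/4"
    by (simp_all add: p1_def p2_def d)
  have "dist p1 p2 \<le> dist p1 (sys_axis \<gamma>1 t1) + dist x (sys_axis \<gamma>1 t1) + dist x (sys_axis \<gamma>2 t2) + dist p2 (sys_axis \<gamma>2 t2)"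
    using dist_triangle[of p1 p2 "sys_axis \<gamma>1 t1"] dist_triangle[of "sys_axis \<gamma>1 t1" p2 x]
      dist_triangle[of x p2 "sys_axis \<gamma>2 t2"] by (simp add: dist_commute)
  \<comment> \<open>Twice \<open>l/2 - 1/4\<close> and twice 1/16 for the passage near
    \<open>x\<close>; together with the 1/8 assumed at time \<open>T\<close> this stays below
    \<open>l - 1/4\<close>, hence below the systole.\<close>
  then have pp: "dist p1 p2 < ?l - 1/2 + 1/8" using e t by simp
  have "dist (\<gamma>1 p1) (\<gamma>2 p1) \<le> dist (\<gamma>1 p1) (\<gamma>2 p2) + dist (\<gamma>2 p2) (\<gamma>2 p1)" by (rule dist_triangle)
  also have "dist (\<gamma>2 p2) (\<gamma>2 p1) = dist p1 p2" using mem by (simp add: dist_commute)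
  finally have "dist (\<gamma>1 p1) (\<gamma>2 p1) < ?l" using small pp g by simp
  then show False using eq_if_small_displacement mem \<gamma>(3) by blast
qed

lemma card_near_large:
  assumes l: "systole \<Gamma> \<ge> 1/2"
  shows "real (card (near x)) \<le> large_const TYPE('a) * exp ((real DIM('a) - 1) * systole \<Gamma> / 2)"
proof -
  let ?l = "systole \<Gamma>" and ?n = "real DIM('a)"
  define T where "T = ?l / 2 + 1/4"
  have T: "T \<ge> 1/2" using l by (simp add: T_def)
  define A where "A = (?n - 1) / 4 + (?n + 1) / 8"
  have bv: "ball_volume TYPE('a) (1/16) > 0" by (rule ball_volume_pos) simp
  have "\<forall>\<gamma>\<in>near x. \<exists>t. dist x (sys_axis \<gamma> t) < 1/16" by (simp add: near_def)
  then obtain t where t: "\<And>\<gamma>. \<gamma> \<in> near x \<Longrightarrow> dist x (sys_axis \<gamma> (t \<gamma>)) < 1/16" by metis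
  define q where "q \<gamma> = sys_axis \<gamma> (t \<gamma> + T)" for \<gamma>
  \<comment> \<open>The margin 1/8 is 1/16 for the distance from \<open>x\<close> to the axis plus
    1/16 for the packing radius.\<close>
  define E where "E = {y. T - 1/8 \<le> dist y x \<and> dist y x \<le> T + 1/8}"
  have "ennreal (real (card (near x)) * ball_volume TYPE('a) (1/16)) \<le> emeasure hyperbolic_volume E"
  proof (rule packing)
    show "finite (near x)" using finite_near l by simp
    show "2 * (1/16) \<le> dist (q \<gamma>1) (q \<gamma>2)" if "\<gamma>1 \<in> near x" "\<gamma>2 \<in> near x" "\<gamma>1 \<noteq> \<gamma>2" for \<gamma>1 \<gamma>2
      using near_separated[OF l that t[OF that(1)] t[OF that(2)]] by (simp add: q_def T_def)
    show "E \<in> sets borel" unfolding E_def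
      by (intro borel_closed closed_Collect_conj closed_Collect_le continuous_intros)
    fix \<gamma> assume \<gamma>: "\<gamma> \<in> near x"
    have "translates \<gamma> (sys_axis \<gamma>) ?l" using \<gamma> translates_axis by (simp add: near_def)
    then have "dist (q \<gamma>) (sys_axis \<gamma> (t \<gamma>)) = T"
      using T by (simp add: q_def translates_def geodesic_line_def)
    then have T1: "T - 1/16 \<le> dist (q \<gamma>) x" "dist (q \<gamma>) x \<le> T + 1/16"
      using t[OF \<gamma>] dist_triangle[of "q \<gamma>" "sys_axis \<gamma> (t \<gamma>)" x] dist_triangle[of "q \<gamma>" x "sys_axis \<gamma> (t \<gamma>)"]
      by (simp_all add: dist_commute)
    show "ball (q \<gamma>) (1/16) \<subseteq> E"
    proof
      fix y assume "y \<in> ball (q \<gamma>) (1/16)"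
      then show "y \<in> E"
        using T1 dist_triangle[of y x "q \<gamma>"] dist_triangle[of "q \<gamma>" x y]
        by (simp add: E_def dist_commute)
    qed
  qed
  also have "\<dots> \<le> ennreal (unit_ball_vol ?n * sinh (T + 1/8) ^ DIM('a) / cosh (T - 1/8))"
    unfolding E_def using T by (intro emeasure_hyperbolic_shell) auto
  also have "\<dots> \<le> ennreal (2 * unit_ball_vol ?n * exp (?n * (T + 1/8) - (T - 1/8)))"
  proof (rule ennreal_leI)
    have "- exp (- (T + 1/8)) \<le> exp (T + 1/8)"
      using exp_gt_zero[of "T + 1/8"] exp_gt_zero[of "- (T + 1/8)"] by linarith
    then have "sinh (T + 1/8) \<le> exp (T + 1/8)" by (simp add: sinh_def)
    then have s: "sinh (T + 1/8) ^ DIM('a) \<le> exp (?n * (T + 1/8))"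
      using T by (simp add: exp_of_nat_mult power_mono)
    have c: "exp (T - 1/8) / 2 \<le> cosh (T - 1/8)" by (simp add: cosh_def)
    have "unit_ball_vol ?n * sinh (T + 1/8) ^ DIM('a) / cosh (T - 1/8)
        \<le> (unit_ball_vol ?n * exp (?n * (T + 1/8))) / (exp (T - 1/8) / 2)"
      using s c T by (intro frac_le mult_left_mono) auto
    then show "unit_ball_vol ?n * sinh (T + 1/8) ^ DIM('a) / cosh (T - 1/8)
        \<le> 2 * unit_ball_vol ?n * exp (?n * (T + 1/8) - (T - 1/8))"
      by (simp add: exp_diff mult_ac)
  qed
  finally have "real (card (near x)) * ball_volume TYPE('a) (1/16)
      \<le> 2 * unit_ball_vol ?n * exp (?n * (T + 1/8) - (T - 1/8))"
    by (subst (asm) ennreal_le_iff) auto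
  also have "?n * (T + 1/8) - (T - 1/8) = A + (?n - 1) * ?l / 2"
    by (simp add: T_def A_def algebra_simps) (simp add: field_simps)
  also have "2 * unit_ball_vol ?n * exp (A + (?n - 1) * ?l / 2)
      = (large_const TYPE('a) * exp ((?n - 1) * ?l / 2)) * ball_volume TYPE('a) (1/16)"
    using bv by (simp add: large_const_def A_def[symmetric] exp_add)
  finally show ?thesis using bv by (rule mult_right_le_imp_le)
qed

subsection \<open>Multiplicity when the systole is small\<close>

text \<open>\<open>C\<close> is a net of a ball of operators. Elements of \<open>near x\<close>
  alone in their cell are counted by \<open>C\<close>; those sharing a cell with another one
  translate along a single line, by plus or minus the systole, whence the summand 2.\<close>

lemma card_near_small:
  fixes C :: "(('a \<times> real) \<Rightarrow>\<^sub>L ('a \<times> real)) set"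
  assumes l: "0 < systole \<Gamma>" "systole \<Gamma> < 1/2" and C: "finite C"
    "cball 0 lorentz_bound \<subseteq> (\<Union>c\<in>C. ball c (zassenhaus_radius / (2 * lorentz_bound)))"
  shows "card (near x) \<le> card C + 2"
proof -
  let ?r = zassenhaus_radius and ?B = lorentz_bound and ?I = "id_blinfun :: ('a \<times> real) \<Rightarrow>\<^sub>L ('a \<times> real)"
  obtain f where f: "hyperbolic_isometry f" "f (hchart 0) = x" by (rule hyperbolic_transitive)
  have finv: "f (inv f p) = p" "inv f (f p) = p" for p
    using hyperbolic_isometry_bij[OF f(1)] by (simp_all add: bij_is_inj bij_is_surj surj_f_inv_f)
  have fi: "hyperbolic_isometry (inv f)" by (rule hyperbolic_isometry_inv[OF f(1)])
  \<comment> \<open>Conjugation by \<open>f\<close> moves \<open>x\<close> to the base point, so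
    that one bound and one net serve every \<open>x\<close>.\<close>
  define k where "k \<gamma> = inv f \<circ> \<gamma> \<circ> f" for \<gamma>
  define m where "m \<gamma> = lorentz_blinfun (k \<gamma>)" for \<gamma>
  have k: "hyperbolic_isometry (k \<gamma>)" if "\<gamma> \<in> \<Gamma>" for \<gamma>
    unfolding k_def by (intro hyperbolic_isometry_comp fi f(1) isometry[OF that])
  have k_comp: "k (\<gamma> \<circ> \<delta>) = k \<gamma> \<circ> k \<delta>" for \<gamma> \<delta> by (simp add: k_def fun_eq_iff finv)
  have k_inv: "k (inv \<gamma>) = inv (k \<gamma>)" if "\<gamma> \<in> \<Gamma>" for \<gamma>
    by (rule sym, rule inv_unique_comp) (auto simp: k_def fun_eq_iff finv that)
  have k_id: "k id = id" by (simp add: k_def fun_eq_iff finv)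
  have k_disp: "dist (k \<gamma> (hchart 0)) (hchart 0) = dist (\<gamma> x) x" if "\<gamma> \<in> \<Gamma>" for \<gamma>
  proof -
    have "dist (inv f (\<gamma> x)) (inv f x) = dist (\<gamma> x) x" using fi by (simp add: hyperbolic_isometry_def)
    then show ?thesis using f(2) finv(2)[of "hchart 0"] by (simp add: k_def)
  qed
  have m_comp: "m (\<gamma> \<circ> \<delta>) = m \<gamma> o\<^sub>L m \<delta>" if "\<gamma> \<in> \<Gamma>" "\<delta> \<in> \<Gamma>" for \<gamma> \<delta>
    unfolding m_def k_comp using that by (intro lorentz_blinfun_comp k)
  have m_id: "m id = ?I" by (simp add: m_def k_id lorentz_blinfun_id)
  have m_eq_I: "\<gamma> = id" if "\<gamma> \<in> \<Gamma>" "m \<gamma> = ?I" for \<gamma>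
  proof -
    have "k \<gamma> = id"
      using that lorentz_blinfun_inject[OF k[OF that(1)] hyperbolic_isometry_id]
      by (simp add: m_def lorentz_blinfun_id)
    then have "inv f (\<gamma> (f p)) = p" for p by (simp add: k_def fun_eq_iff)
    then have "\<gamma> (f p) = f p" for p by (metis finv(1))
    then show ?thesis using fixes_imp_id that(1) by blast
  qed
  have m_norm: "norm (m \<gamma>) \<le> ?B" if "\<gamma> \<in> \<Gamma>" "dist (\<gamma> x) x \<le> 1" for \<gamma>
    unfolding m_def using that by (intro norm_lorentz_blinfun_le k) (simp_all add: k_disp)
  define Z where "Z = {\<gamma> \<in> \<Gamma>. norm (m \<gamma> - ?I) < ?r}"
  have Z_disp: "dist (\<gamma> x) x \<le> 1" if "\<gamma> \<in> Z" for \<gamma>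
    using that displacement_le_of_near_id[OF k, of \<gamma>] zassenhaus_radius(2) k_disp
    by (simp add: Z_def m_def)
  have "finite Z"
    by (rule finite_subset[OF _ finite_bounded_displacement[of x x 1]]) (use Z_disp in \<open>auto simp: Z_def\<close>)
  have near_disp: "dist (\<gamma> x) x \<le> 1" if "\<gamma> \<in> near x" for \<gamma>
    using near_displacement[OF that l(1)] l by linarith
  have near_mem: "\<gamma> \<in> \<Gamma>" and near_ne: "\<gamma> \<noteq> id" if "\<gamma> \<in> near x" for \<gamma>
  proof -
    have "\<gamma> \<in> systolic" using that by (simp add: near_def)
    then show "\<gamma> \<in> \<Gamma>" "\<gamma> \<noteq> id"
      using systolic_mem translates_imp_ne_id[OF translates_axis] l(1) by auto
  qed
  have cell_ex: "\<exists>c\<in>C. m \<gamma> \<in> ball c (?r / (2 * ?B))" if "\<gamma> \<in> near x" for \<gamma>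
  proof -
    have "m \<gamma> \<in> cball 0 ?B" using m_norm near_mem near_disp that by simp
    then show ?thesis using C(2) by blast
  qed
  define cell where "cell \<gamma> = (SOME c. c \<in> C \<and> m \<gamma> \<in> ball c (?r / (2 * ?B)))" for \<gamma>
  have cell: "cell \<gamma> \<in> C" "m \<gamma> \<in> ball (cell \<gamma>) (?r / (2 * ?B))" if "\<gamma> \<in> near x" for \<gamma>
    using someI_ex[of "\<lambda>c. c \<in> C \<and> m \<gamma> \<in> ball c (?r / (2 * ?B))"] cell_ex[OF that]
    unfolding cell_def by blast+
  \<comment> \<open>Passing from a difference of operators to a quotient of group elements costs the
    norm of an inverse, at most \<open>?B\<close>; two elements of a cell of radius
    \<open>?r / (2 * ?B)\<close> thus have quotients within \<open>?r\<close> of the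
    identity.\<close>
  have close: "norm (m \<gamma> - m \<delta>) < ?r / ?B" if "\<gamma> \<in> near x" "\<delta> \<in> near x" "cell \<gamma> = cell \<delta>" for \<gamma> \<delta>
  proof -
    have "dist (m \<gamma>) (m \<delta>) < ?r / ?B"
      using dist_triangle_half_r[of "cell \<gamma>" "m \<gamma>" "?r / ?B" "m \<delta>"] cell[OF that(1)] cell[OF that(2)] that(3)
      by (simp add: mult.commute)
    then show ?thesis by (simp add: dist_norm)
  qed
  have Bpos: "?B > 0" using lorentz_bound by simp
  have quotients: "\<gamma> \<circ> inv \<delta> \<in> Z" "inv \<delta> \<circ> \<gamma> \<in> Z"
    if "\<gamma> \<in> near x" "\<delta> \<in> near x" "cell \<gamma> = cell \<delta>" for \<gamma> \<delta>
  proof -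
    have mem: "\<gamma> \<in> \<Gamma>" "\<delta> \<in> \<Gamma>" "inv \<delta> \<in> \<Gamma>" using near_mem that by auto
    have "dist (inv \<delta> x) x \<le> 1"
      using near_disp[OF that(2)] dist_inv[OF mem(2), of x x] dist_commute[of x "\<delta> x"] by simp
    then have n: "norm (m (inv \<delta>)) \<le> ?B" using m_norm mem by blast
    have "inv \<delta> \<circ> \<delta> = id" "\<delta> \<circ> inv \<delta> = id" using mem by auto
    then have I: "m \<delta> o\<^sub>L m (inv \<delta>) = ?I" "m (inv \<delta>) o\<^sub>L m \<delta> = ?I" using m_comp m_id mem by metis+
    have "m (\<gamma> \<circ> inv \<delta>) - ?I = (m \<gamma> - m \<delta>) o\<^sub>L m (inv \<delta>)"
      unfolding m_comp[OF mem(1,3)] I(1)[symmetric]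
      by (simp add: bounded_bilinear.diff_left[OF bounded_bilinear_blinfun_compose])
    then have "norm (m (\<gamma> \<circ> inv \<delta>) - ?I) \<le> norm (m \<gamma> - m \<delta>) * norm (m (inv \<delta>))"
      by (metis norm_blinfun_compose)
    also have "\<dots> \<le> norm (m \<gamma> - m \<delta>) * ?B" using n by (intro mult_left_mono) auto
    also have "\<dots> < ?r" using close[OF that] Bpos by (simp add: pos_less_divide_eq)
    finally show "\<gamma> \<circ> inv \<delta> \<in> Z" using mem unfolding Z_def by (intro CollectI conjI comp_mem)
    have "m (inv \<delta> \<circ> \<gamma>) - ?I = m (inv \<delta>) o\<^sub>L (m \<gamma> - m \<delta>)"
      unfolding m_comp[OF mem(3,1)] I(2)[symmetric]
      by (simp add: bounded_bilinear.diff_right[OF bounded_bilinear_blinfun_compose])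
    then have "norm (m (inv \<delta> \<circ> \<gamma>) - ?I) \<le> norm (m (inv \<delta>)) * norm (m \<gamma> - m \<delta>)"
      by (metis norm_blinfun_compose)
    also have "\<dots> \<le> ?B * norm (m \<gamma> - m \<delta>)" using n by (intro mult_right_mono) auto
    also have "\<dots> < ?r" using close[OF that] Bpos by (simp add: pos_less_divide_eq mult.commute)
    finally show "inv \<delta> \<circ> \<gamma> \<in> Z" using mem unfolding Z_def by (intro CollectI conjI comp_mem)
  qed
  show ?thesis
  proof (cases "Z \<subseteq> {id}")
    case True
    have "inj_on cell (near x)"
    proof (rule inj_onI)
      fix \<gamma> \<delta> assume *: "\<gamma> \<in> near x" "\<delta> \<in> near x" "cell \<gamma> = cell \<delta>"
      then have "inv \<delta> \<circ> \<gamma> = id" using quotients(2)[OF *] True by blast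
      then show "\<gamma> = \<delta>" using comp_inv_eq_id near_mem * by metis
    qed
    moreover have "cell ` near x \<subseteq> C" using cell by blast
    ultimately have "card (near x) \<le> card C" using card_inj_on_le C(1) by blast
    then show ?thesis by simp
  next
    case False
    define v where "v \<gamma> = norm (m \<gamma> - ?I)" for \<gamma>
    have "finite (Z - {id})" "Z - {id} \<noteq> {}" using False \<open>finite Z\<close> by auto
    \<comment> \<open>\<open>h\<close> is a nontrivial element of \<open>Z\<close> closest to the
      identity. Its commutator with any element of \<open>Z\<close> is closer still, hence trivial,
      so the axis of \<open>h\<close> is invariant under all of \<open>Z\<close>.\<close>
    then obtain h where h: "h \<in> Z - {id}" "\<And>\<gamma>. \<gamma> \<in> Z - {id} \<Longrightarrow> v h \<le> v \<gamma>"
      using arg_min_if_finite[of "Z - {id}" v] by (metis not_less)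
    have hmem: "h \<in> \<Gamma>" "h \<noteq> id" using h by (auto simp: Z_def)
    have vh: "v h > 0" using m_eq_I hmem by (auto simp: v_def)
    have comm: "z \<circ> h = h \<circ> z" if z: "z \<in> Z" for z
    proof -
      have zmem: "z \<in> \<Gamma>" using z by (simp add: Z_def)
      let ?c = "(z \<circ> h) \<circ> (inv z \<circ> inv h)"
      have cmem: "?c \<in> \<Gamma>" using zmem hmem by (intro comp_mem inv_mem)
      have small: "norm (m z - ?I) < ?r" "norm (m h - ?I) < ?r" using z h by (auto simp: Z_def)
      have "v ?c \<le> 2 * ?B\<^sup>2 * v z * v h"
        unfolding v_def m_def k_comp k_inv[OF zmem] k_inv[OF hmem(1)]
        using small zassenhaus_radius(2) zmem hmem by (intro norm_commutator_le k) (auto simp: m_def)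
      also have "\<dots> \<le> 2 * ?B\<^sup>2 * ?r * v h"
        using small vh by (intro mult_right_mono mult_left_mono) (auto simp: v_def)
      also have "\<dots> < 1 * v h" using vh zassenhaus_radius(3) by (intro mult_strict_right_mono)
      finally have lt: "v ?c < v h" by simp
      then have "?c \<in> Z" using cmem small by (simp add: Z_def v_def del: comp_apply)
      then have "?c = id" using h(2)[of ?c] lt by force
      then have "z (h (inv z (inv h p))) = p" for p by (simp add: fun_eq_iff)
      from this[of "h (z _)"] have "z (h q) = h (z q)" for q using zmem hmem by simp
      then show ?thesis by (auto simp: fun_eq_iff)
    qed
    obtain g \<mu> where g: "\<mu> > 0" "translates h g \<mu>" using axis_exists[OF hmem] by metis
    let ?l = "systole \<Gamma>"
    define Q where "Q = {\<gamma> \<in> \<Gamma>. translates \<gamma> g ?l \<or> translates \<gamma> g (- ?l)}"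
    have Q: "finite Q" "card Q \<le> 2"
    proof -
      have A: "\<exists>a. {\<gamma> \<in> \<Gamma>. translates \<gamma> g s} \<subseteq> {a}" for s
      proof (cases "\<exists>a\<in>\<Gamma>. translates a g s")
        case True
        then obtain a where "a \<in> \<Gamma>" "translates a g s" by blast
        then show ?thesis using translates_eq by blast
      qed auto
      obtain a where a: "{\<gamma> \<in> \<Gamma>. translates \<gamma> g ?l} \<subseteq> {a}" using A[of ?l] by (rule exE)
      obtain b where b: "{\<gamma> \<in> \<Gamma>. translates \<gamma> g (- ?l)} \<subseteq> {b}" using A[of "- ?l"] by (rule exE)
      have sub: "Q \<subseteq> {a, b}" using a b unfolding Q_def by blast
      then show "finite Q" by (rule finite_subset) simp
      have "card Q \<le> card {a, b}" using sub by (intro card_mono) auto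
      also have "\<dots> \<le> 2" by (simp add: card_insert_if)
      finally show "card Q \<le> 2" .
    qed
    have inQ: "\<delta> \<in> Q" if *: "\<gamma> \<in> near x" "\<delta> \<in> near x" "cell \<gamma> = cell \<delta>" "\<gamma> \<noteq> \<delta>" for \<gamma> \<delta>
    proof -
      have mem: "\<gamma> \<in> \<Gamma>" "\<delta> \<in> \<Gamma>" "\<gamma> \<circ> inv \<delta> \<in> \<Gamma>" "inv \<delta> \<circ> \<gamma> \<in> \<Gamma>"
        using near_mem * by (auto intro: comp_mem inv_mem)
      obtain \<tau> where \<tau>: "translates (\<gamma> \<circ> inv \<delta>) g \<tau>"
        using commute_translates[OF hmem(1) g(2,1) mem(3) comm[OF quotients(1)[OF *(1,2,3)]]] .
      obtain \<tau>' where \<tau>': "translates (inv \<delta> \<circ> \<gamma>) g \<tau>'"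
        using commute_translates[OF hmem(1) g(2,1) mem(4) comm[OF quotients(2)[OF *(1,2,3)]]] .
      obtain s where s: "translates \<delta> g s"
        using translates_of_quotients[OF mem(1,2) *(4) near_ne[OF *(2)] \<tau> \<tau>'] .
      have s0: "s \<noteq> 0" using translates_nonzero[OF mem(2) near_ne[OF *(2)] s] .
      have tr: "translates \<delta> (sys_axis \<delta>) ?l" using * translates_axis by (simp add: near_def)
      have "?l \<noteq> 0" using l(1) by simp
      from axis_unique[OF isometry[OF mem(2)] tr s this s0] have "\<bar>s\<bar> = \<bar>?l\<bar>" by (rule conjunct1)
      then have "s = ?l \<or> s = - ?l" by (auto simp: abs_if split: if_splits)
      then show ?thesis using s mem by (auto simp: Q_def)
    qed
    have "inj_on cell (near x - Q)" using inQ by (intro inj_onI) blast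
    moreover have "cell ` (near x - Q) \<subseteq> C" using cell by blast
    ultimately have "card (near x - Q) \<le> card C" using card_inj_on_le C(1) by blast
    moreover have "card (near x) \<le> card (near x - Q) + card Q"
      using finite_near[OF l(1)] Q(1) by (metis diff_card_le_card_Diff le_diff_conv)
    ultimately show ?thesis using Q(2) by linarith
  qed
qed


subsection \<open>Counting\<close>

text \<open>The lift of the geodesic and the chosen axis of the same element differ by a shift,
  which \<open>axis_class_conj\<close> with conjugator \<open>id\<close> absorbs.\<close>

lemma systolic_class_rep:
  assumes "X \<in> systolic_classes \<Gamma>"
  obtains \<gamma> where "\<gamma> \<in> systolic" "axis_class (systole \<Gamma>) (sys_axis \<gamma>) = X"
proof -
  obtain c where c: "X = free_homotopy_class \<Gamma> (\<lambda>s. c (systole \<Gamma> * s))" "closed_geodesic \<Gamma> (systole \<Gamma>) c"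
    using assms by (auto simp: systolic_classes_def)
  have l: "systole \<Gamma> > 0" using c(2) by (simp add: closed_geodesic_def)
  obtain g \<gamma> where g: "\<gamma> \<in> \<Gamma>" "translates \<gamma> g (systole \<Gamma>)" "\<And>t. c t = orbit \<Gamma> (g t)"
    using closed_geodesic_lift[OF c(2)] by metis
  have \<gamma>: "\<gamma> \<in> systolic" using g by (auto simp: systolic_def)
  have "translates (id \<circ> \<gamma> \<circ> inv id) (sys_axis \<gamma>) (systole \<Gamma>)" using translates_axis[OF \<gamma>] by simp
  then have "axis_class (systole \<Gamma>) (sys_axis \<gamma>) = axis_class (systole \<Gamma>) g"
    by (rule axis_class_conj[OF g(1) id_mem l g(2)])
  also have "\<dots> = X" unfolding axis_class_def c(1) g(3) ..
  finally show thesis using that \<gamma> by blast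
qed

lemma systolic_conj:
  assumes \<gamma>: "\<gamma> \<in> systolic" and \<delta>: "\<delta> \<in> \<Gamma>" and l: "systole \<Gamma> > 0"
  shows "inv \<delta> \<circ> \<gamma> \<circ> \<delta> \<in> systolic"
    and "axis_class (systole \<Gamma>) (sys_axis (inv \<delta> \<circ> \<gamma> \<circ> \<delta>)) = axis_class (systole \<Gamma>) (sys_axis \<gamma>)"
    and "\<exists>a. \<forall>t. inv \<delta> (sys_axis \<gamma> t) = sys_axis (inv \<delta> \<circ> \<gamma> \<circ> \<delta>) (t + a)"
proof -
  let ?c = "inv \<delta> \<circ> \<gamma> \<circ> \<delta>" and ?l = "systole \<Gamma>"
  have mem: "\<gamma> \<in> \<Gamma>" "inv \<delta> \<in> \<Gamma>" "?c \<in> \<Gamma>"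
    using systolic_mem[OF \<gamma>] \<delta> by (auto intro: comp_mem inv_mem simp del: comp_apply)
  have ii: "inv (inv \<delta>) = \<delta>" using \<delta> by (simp add: inv_inv_eq)
  have tr: "translates ?c (\<lambda>t. inv \<delta> (sys_axis \<gamma> t)) ?l"
    using translates_conj[OF translates_axis[OF \<gamma>] isometry[OF mem(2)]] ii by simp
  then show c: "?c \<in> systolic" using mem by (auto simp: systolic_def)
  then have trc: "translates ?c (sys_axis ?c) ?l" by (rule translates_axis)
  show "axis_class ?l (sys_axis ?c) = axis_class ?l (sys_axis \<gamma>)"
    by (rule axis_class_conj[OF mem(1,2) l translates_axis[OF \<gamma>]]) (simp only: ii trc)
  show "\<exists>a. \<forall>t. inv \<delta> (sys_axis \<gamma> t) = sys_axis ?c (t + a)"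
    using axis_unique_positive[OF isometry[OF mem(3)] trc tr l l] by blast
qed

text \<open>Members of \<open>D\<close> give the same conjugate as \<open>\<delta>0\<close>, so they
  differ from it by elements commuting with \<open>\<gamma>\<close>, which translate its axis. The
  shifts lie in an interval of length below \<open>N\<close>, and those of different elements are at
  least the systole apart, because a nontrivial element cannot move a point by less.\<close>

lemma card_conjugators_le:
  assumes \<gamma>: "\<gamma> \<in> systolic" and l: "systole \<Gamma> > 0" and \<delta>0: "\<delta>0 \<in> \<Gamma>"
    and near: "\<And>\<delta>. \<delta> \<in> D \<Longrightarrow> \<exists>k<N. dist (\<delta> x) (sys_axis \<gamma> (real k)) < 1/16"
    and near0: "dist (\<delta>0 x) (sys_axis \<gamma> (real k0)) < 1/16"
    and D: "\<And>\<delta>. \<delta> \<in> D \<Longrightarrow> \<delta> \<in> \<Gamma>" "\<And>\<delta>. \<delta> \<in> D \<Longrightarrow> inv \<delta> \<circ> \<gamma> \<circ> \<delta> = inv \<delta>0 \<circ> \<gamma> \<circ> \<delta>0"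
    and N: "systole \<Gamma> \<le> real N"
  shows "real (card D) \<le> 3 * real N / systole \<Gamma>"
proof -
  let ?l = "systole \<Gamma>" and ?g = "sys_axis \<gamma>"
  have mem: "\<gamma> \<in> \<Gamma>" using systolic_mem[OF \<gamma>] .
  have tr: "translates \<gamma> ?g ?l" using translates_axis[OF \<gamma>] .
  have d: "dist (?g s) (?g t) = \<bar>s - t\<bar>" for s t using tr by (simp add: translates_def geodesic_line_def)
  have "\<exists>\<tau>. translates (\<delta> \<circ> inv \<delta>0) ?g \<tau>" if "\<delta> \<in> D" for \<delta>
  proof -
    have eq: "inv \<delta> (\<gamma> (\<delta> q)) = inv \<delta>0 (\<gamma> (\<delta>0 q))" for q
      using D(2)[OF that] by (metis comp_apply)
    have "\<gamma> (\<delta> q) = \<delta> (inv \<delta>0 (\<gamma> (\<delta>0 q)))" for q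
      using eq[of q] D(1)[OF that] by (metis inv_apply(1))
    from this[of "inv \<delta>0 _"] have "\<gamma> (\<delta> (inv \<delta>0 q)) = \<delta> (inv \<delta>0 (\<gamma> q))" for q
      using \<delta>0 by simp
    then have "(\<delta> \<circ> inv \<delta>0) \<circ> \<gamma> = \<gamma> \<circ> (\<delta> \<circ> inv \<delta>0)" by (simp add: fun_eq_iff)
    moreover have "\<delta> \<circ> inv \<delta>0 \<in> \<Gamma>" using D(1)[OF that] \<delta>0 by (intro comp_mem inv_mem)
    ultimately show ?thesis using commute_translates[OF mem tr l] by metis
  qed
  then obtain \<tau> where \<tau>: "\<And>\<delta>. \<delta> \<in> D \<Longrightarrow> translates (\<delta> \<circ> inv \<delta>0) ?g (\<tau> \<delta>)" by metis
  have shift: "\<delta> (inv \<delta>0 (?g t)) = ?g (t + \<tau> \<delta>)" if "\<delta> \<in> D" for \<delta> t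
    using \<tau>[OF that] by (simp add: translates_def)
  \<comment> \<open>The sample times run from 0 to \<open>N - 1\<close>, and two distances below
    1/16 allow an error of 1/8 on either side.\<close>
  define a where "a = - real k0 - 1/8"
  define b where "b = real N - 1 - real k0 + 1/8"
  have range: "a \<le> \<tau> \<delta> \<and> \<tau> \<delta> \<le> b" if "\<delta> \<in> D" for \<delta>
  proof -
    have "\<exists>k<N. dist (\<delta> x) (?g (real k)) < 1/16" using that by (rule near)
    then obtain k where k: "k < N" "dist (\<delta> x) (?g (real k)) < 1/16" by blast
    have "dist (\<delta> (inv \<delta>0 (?g (real k0)))) (\<delta> x) = dist (?g (real k0)) (\<delta>0 x)"
      using D(1)[OF that] \<delta>0 by (simp add: dist_inv)
    then have "dist (?g (real k0 + \<tau> \<delta>)) (?g (real k)) < 1/8"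
      using near0 k dist_triangle[of "?g (real k0 + \<tau> \<delta>)" "?g (real k)" "\<delta> x"] shift[OF that, of "real k0"]
      by (simp add: dist_commute)
    then have "\<bar>real k0 + \<tau> \<delta> - real k\<bar> < 1/8" by (simp add: d)
    moreover have "real k \<le> real N - 1" using k(1) by linarith
    ultimately show ?thesis by (auto simp: a_def b_def abs_if split: if_splits)
  qed
  define j where "j \<delta> = \<lfloor>\<tau> \<delta> / ?l\<rfloor>" for \<delta>
  have "inj_on j D"
  proof (rule inj_onI)
    fix \<delta> \<epsilon> assume *: "\<delta> \<in> D" "\<epsilon> \<in> D" "j \<delta> = j \<epsilon>"
    have "\<bar>\<tau> \<delta> / ?l - \<tau> \<epsilon> / ?l\<bar> < 1"
      using *(3) floor_correct[of "\<tau> \<delta> / ?l"] floor_correct[of "\<tau> \<epsilon> / ?l"]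
      unfolding j_def by (simp add: abs_less_iff) linarith
    then have "\<bar>(\<tau> \<delta> - \<tau> \<epsilon>) / ?l\<bar> < 1" by (simp only: diff_divide_distrib)
    then have "\<bar>\<tau> \<delta> - \<tau> \<epsilon>\<bar> < ?l" using l by (simp add: abs_divide)
    then have "dist (\<delta> (inv \<delta>0 (?g 0))) (\<epsilon> (inv \<delta>0 (?g 0))) < ?l"
      using * by (simp add: shift d)
    then show "\<delta> = \<epsilon>" using eq_if_small_displacement D(1) * by blast
  qed
  moreover have sub: "j ` D \<subseteq> {\<lfloor>a / ?l\<rfloor>..\<lfloor>b / ?l\<rfloor>}"
    using range l by (auto simp: j_def intro!: floor_mono divide_right_mono)
  ultimately have "card D \<le> card {\<lfloor>a / ?l\<rfloor>..\<lfloor>b / ?l\<rfloor>}" by (intro card_inj_on_le) auto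
  then have "real (card D) \<le> real (nat (\<lfloor>b / ?l\<rfloor> - \<lfloor>a / ?l\<rfloor> + 1))" by simp
  also have "\<dots> \<le> b / ?l - a / ?l + 2"
  proof (cases "0 \<le> \<lfloor>b / ?l\<rfloor> - \<lfloor>a / ?l\<rfloor> + 1")
    case True
    then have "real (nat (\<lfloor>b / ?l\<rfloor> - \<lfloor>a / ?l\<rfloor> + 1)) = of_int \<lfloor>b / ?l\<rfloor> - of_int \<lfloor>a / ?l\<rfloor> + 1"
      by simp
    then show ?thesis using floor_correct[of "b / ?l"] floor_correct[of "a / ?l"] by linarith
  next
    case False
    have N0: "real N \<ge> 1" using N l by (cases N) auto
    then have "a / ?l \<le> b / ?l" using l by (intro divide_right_mono) (auto simp: a_def b_def)
    then show ?thesis using False by simp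
  qed
  also have "b / ?l - a / ?l + 2 = (real N - 3/4) / ?l + 2"
    by (simp add: a_def b_def flip: diff_divide_distrib)
  also have "\<dots> \<le> real N / ?l + 2" using l by (intro add_right_mono divide_right_mono) auto
  \<comment> \<open>The rounding term 2 is absorbed because \<open>?l \<le> real N\<close>; this is
    the origin of the factor 3.\<close>
  also have "\<dots> \<le> real N / ?l + 2 * (real N / ?l)"
    using N l by (simp add: field_simps)
  also have "\<dots> = 3 * real N / ?l" by simp
  finally show ?thesis .
qed

text \<open>Each class contributes a union \<open>W\<close> of about \<open>l\<close> balls along its axis. A translate of
  \<open>W\<close> containing \<open>x\<close> yields an element of \<^term>\<open>near x\<close>, and the number of translates yielding
  the same element is at most about \<open>max 1 (1 / l)\<close>.\<close>

lemma card_systolic_classes_le: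
  assumes l: "systole \<Gamma> > 0" and K: "\<And>x. real (card (near x)) \<le> K"
    and \<C>: "finite \<C>" "\<C> \<subseteq> systolic_classes \<Gamma>"
  shows "real (card \<C>) * ball_volume TYPE('a) (1/16) * systole \<Gamma> \<le> 3 * K * vol \<Gamma>"
proof -
  let ?l = "systole \<Gamma>" and ?v = "ball_volume TYPE('a) (1/16)"
  have K0: "K \<ge> 0" using K[of undefined] by (meson of_nat_0_le_iff order.trans)
  have "\<exists>\<gamma>. \<gamma> \<in> systolic \<and> axis_class ?l (sys_axis \<gamma>) = X" if "X \<in> \<C>" for X
    using systolic_class_rep \<C>(2) that by (metis subsetD)
  then obtain G where G: "\<And>X. X \<in> \<C> \<Longrightarrow> G X \<in> systolic" "\<And>X. X \<in> \<C> \<Longrightarrow> axis_class ?l (sys_axis (G X)) = X"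
    by metis
  \<comment> \<open>Rounding up leaves one ball even for a tiny systole; unit spacing keeps the
    balls disjoint.\<close>
  define N where "N = nat \<lceil>?l\<rceil>"
  have N: "?l \<le> real N" "real N > 0" using l by (auto simp: N_def)
  define W where "W X = (\<Union>k<N. ball (sys_axis (G X) (real k)) (1/16))" for X
  have W_iff: "p \<in> W X \<longleftrightarrow> (\<exists>k<N. dist p (sys_axis (G X) (real k)) < 1/16)" for p X
    by (auto simp: W_def dist_commute)
  have W[measurable]: "W X \<in> sets borel" for X unfolding W_def by (intro borel_open open_UN) auto
  have volW: "ennreal (real N * ?v) \<le> emeasure hyperbolic_volume (W X)" if "X \<in> \<C>" for X
  proof -
    have tr: "translates (G X) (sys_axis (G X)) ?l" using translates_axis[OF G(1)[OF that]] .
    have "ennreal (real (card {..<N}) * ?v) \<le> emeasure hyperbolic_volume (W X)"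
    proof (rule packing[where q = "\<lambda>k. sys_axis (G X) (real k)"])
      fix i k :: nat assume "i \<noteq> k"
      then have "1 \<le> \<bar>real i - real k\<bar>" by linarith
      then show "2 * (1/16) \<le> dist (sys_axis (G X) (real i)) (sys_axis (G X) (real k))"
        using tr by (simp add: translates_def geodesic_line_def)
    qed (auto simp: W_def)
    then show ?thesis by simp
  qed
  \<comment> \<open>\<open>D X x\<close> indexes the translates of \<open>W X\<close> that contain
    \<open>x\<close>, and \<open>F X\<close> assigns to such a translate the conjugate of
    \<open>G X\<close> whose axis passes near \<open>x\<close>.\<close>
  define D where "D X x = {\<delta> \<in> \<Gamma>. \<delta> x \<in> W X}" for X x
  define F where "F X \<delta> = inv \<delta> \<circ> G X \<circ> \<delta>" for X and \<delta> :: "'a hyperbolic \<Rightarrow> 'a hyperbolic"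
  have finD: "finite (D X x)" for X x
  proof (rule finite_subset)
    show "D X x \<subseteq> (\<Union>k<N. {\<delta> \<in> \<Gamma>. dist (\<delta> x) (sys_axis (G X) (real k)) \<le> 1/16})"
      by (force simp: D_def W_iff)
    show "finite (\<Union>k<N. {\<delta> \<in> \<Gamma>. dist (\<delta> x) (sys_axis (G X) (real k)) \<le> 1/16})"
      by (intro finite_UN_I finite_lessThan finite_bounded_displacement)
  qed
  have F_near: "F X \<delta> \<in> near x" and F_class: "axis_class ?l (sys_axis (F X \<delta>)) = X"
    if "X \<in> \<C>" "\<delta> \<in> D X x" for X \<delta> x
  proof -
    have \<delta>: "\<delta> \<in> \<Gamma>" "\<delta> x \<in> W X" using that(2) by (auto simp: D_def)
    note c = systolic_conj[OF G(1)[OF that(1)] \<delta>(1) l, folded F_def]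
    show "axis_class ?l (sys_axis (F X \<delta>)) = X" using c(2) G(2)[OF that(1)] by simp
    obtain k where k: "dist (\<delta> x) (sys_axis (G X) (real k)) < 1/16" using \<delta>(2) W_iff by blast
    obtain a where a: "\<And>t. inv \<delta> (sys_axis (G X) t) = sys_axis (F X \<delta>) (t + a)" using c(3) by blast
    have "dist x (sys_axis (F X \<delta>) (real k + a)) = dist (\<delta> x) (sys_axis (G X) (real k))"
      using \<delta>(1) by (simp add: dist_inv dist_commute[of x] dist_commute[of "\<delta> x"] flip: a)
    then have "dist x (sys_axis (F X \<delta>) (real k + a)) < 1/16" using k by simp
    then show "F X \<delta> \<in> near x" using c(1) unfolding near_def by blast
  qed
  have cardD: "real (card (D X x)) \<le> 3 * real N / ?l * real (card (F X ` D X x))" if X: "X \<in> \<C>" for X x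
  proof (rule card_le_fibers[OF finD])
    fix y assume "y \<in> F X ` D X x"
    then obtain \<delta>0 where d0: "\<delta>0 \<in> D X x" "y = F X \<delta>0" by blast
    then obtain k0 where k0: "dist (\<delta>0 x) (sys_axis (G X) (real k0)) < 1/16" "\<delta>0 \<in> \<Gamma>"
      using W_iff by (auto simp: D_def)
    show "real (card {\<delta> \<in> D X x. F X \<delta> = y}) \<le> 3 * real N / ?l"
      by (rule card_conjugators_le[OF G(1)[OF X] l k0(2) _ k0(1) _ _ N(1)])
        (auto simp: D_def W_iff d0(2) simp flip: F_def)
  qed
  have point: "(\<Sum>X\<in>\<C>. real (card (D X x))) \<le> 3 * real N / ?l * K" for x
  proof -
    have M: "3 * real N / ?l \<ge> 0" using l by simp
    \<comment> \<open>Different classes cannot share a conjugate, since \<open>F_class\<close>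
      recovers the class from it; so the images for all classes fit disjointly into
      \<open>near x\<close>.\<close>
    have "disjoint_family_on (\<lambda>X. F X ` D X x) \<C>"
      unfolding disjoint_family_on_def
    proof (intro ballI impI equals0I)
      fix X Y y assume X: "X \<in> \<C>" "Y \<in> \<C>" "X \<noteq> Y" and "y \<in> F X ` D X x \<inter> F Y ` D Y x"
      then obtain \<delta> \<epsilon> where "\<delta> \<in> D X x" "y = F X \<delta>" "\<epsilon> \<in> D Y x" "y = F Y \<epsilon>" by blast
      then show False using F_class X by metis
    qed
    then have "(\<Sum>X\<in>\<C>. card (F X ` D X x)) = card (\<Union>X\<in>\<C>. F X ` D X x)"
      using \<C>(1) finD by (intro card_UN_disjoint[symmetric]) (auto simp: disjoint_family_on_def)
    also have "\<dots> \<le> card (near x)" using F_near finite_near[OF l] by (intro card_mono) auto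
    finally have "real (\<Sum>X\<in>\<C>. card (F X ` D X x)) \<le> K" using K[of x] by linarith
    then have le: "(\<Sum>X\<in>\<C>. real (card (F X ` D X x))) \<le> K" by simp
    have "(\<Sum>X\<in>\<C>. real (card (D X x))) \<le> (\<Sum>X\<in>\<C>. 3 * real N / ?l * real (card (F X ` D X x)))"
      by (intro sum_mono cardD)
    also have "\<dots> = 3 * real N / ?l * (\<Sum>X\<in>\<C>. real (card (F X ` D X x)))"
      by (simp add: sum_distrib_left)
    also have "\<dots> \<le> 3 * real N / ?l * K" by (rule mult_left_mono[OF le M])
    finally show ?thesis .
  qed
  define f where "f x = (\<Sum>X\<in>\<C>. indicator (W X) x :: ennreal)" for x
  have fm[measurable]: "f \<in> borel_measurable borel" unfolding f_def by measurable
  have count: "(\<integral>\<^sup>+\<gamma>. f (\<gamma> x) \<partial>count_space \<Gamma>) = ennreal (\<Sum>X\<in>\<C>. real (card (D X x)))" for x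
  proof -
    have "(\<integral>\<^sup>+\<gamma>. f (\<gamma> x) \<partial>count_space \<Gamma>) = (\<Sum>X\<in>\<C>. \<integral>\<^sup>+\<gamma>. indicator (W X) (\<gamma> x) \<partial>count_space \<Gamma>)"
      unfolding f_def by (rule nn_integral_sum) simp
    also have "\<dots> = (\<Sum>X\<in>\<C>. ennreal (real (card (D X x))))"
    proof (rule sum.cong)
      fix X
      have "(\<integral>\<^sup>+\<gamma>. indicator (W X) (\<gamma> x) \<partial>count_space \<Gamma>) = (\<integral>\<^sup>+\<gamma>. indicator (D X x) \<gamma> \<partial>count_space \<Gamma>)"
        by (rule nn_integral_cong) (auto simp: D_def indicator_def)
      also have "\<dots> = emeasure (count_space \<Gamma>) (D X x)"
        by (rule nn_integral_indicator) (auto simp: D_def)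
      also have "\<dots> = of_nat (card (D X x))"
        using finD by (intro emeasure_count_space_finite) (auto simp: D_def)
      finally show "(\<integral>\<^sup>+\<gamma>. indicator (W X) (\<gamma> x) \<partial>count_space \<Gamma>) = ennreal (real (card (D X x)))"
        by (simp add: ennreal_of_nat_eq_real_of_nat)
    qed simp
    finally show ?thesis by simp
  qed
  have "ennreal (real (card \<C>) * (real N * ?v)) = (\<Sum>X\<in>\<C>. ennreal (real N * ?v))"
    by (simp add: ennreal_mult' ennreal_of_nat_eq_real_of_nat)
  also have "\<dots> \<le> (\<Sum>X\<in>\<C>. emeasure hyperbolic_volume (W X))" by (intro sum_mono volW)
  also have "\<dots> = (\<integral>\<^sup>+x. f x \<partial>hyperbolic_volume)"
    unfolding f_def by (subst nn_integral_sum) (auto simp: W)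
  also have "\<dots> = (\<integral>\<^sup>+x. (\<integral>\<^sup>+\<gamma>. f (\<gamma> x) \<partial>count_space \<Gamma>) * indicator domain x \<partial>hyperbolic_volume)"
    by (rule nn_integral_unfold[OF fundamental_domain fm, symmetric])
  also have "\<dots> \<le> (\<integral>\<^sup>+x. ennreal (3 * real N / ?l * K) * indicator domain x \<partial>hyperbolic_volume)"
    unfolding count by (intro nn_integral_mono mult_right_mono ennreal_leI point) simp
  also have "\<dots> = ennreal (3 * real N / ?l * K) * ennreal (vol \<Gamma>)"
    by (simp add: nn_integral_cmult_indicator emeasure_domain)
  also have "\<dots> = ennreal (3 * real N / ?l * K * vol \<Gamma>)"
    using K0 l by (intro ennreal_mult'[symmetric]) simp
  finally have "real (card \<C>) * (real N * ?v) \<le> 3 * real N / ?l * K * vol \<Gamma>"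
    using K0 l by (subst (asm) ennreal_le_iff) (auto simp: vol_def)
  \<comment> \<open>\<open>N\<close> occurs both in the volume of \<open>W X\<close> and in the
    fibre bound \<open>3 * real N / ?l\<close>; it cancels and leaves the factor \<open>?l\<close>
    on the left.\<close>
  then have "real N * (real (card \<C>) * ?v * ?l) \<le> real N * (3 * K * vol \<Gamma>)"
    using l by (simp add: field_simps)
  then show ?thesis using N(2) by (rule mult_left_le_imp_le)
qed

text \<open>The infimum has to range over a nonempty set. The group is nontrivial because hyperbolic
  space is unbounded, and the axis of a nontrivial element gives a closed geodesic.\<close>

lemma systole_nonneg: "systole \<Gamma> \<ge> 0"
proof -
  obtain R where R: "R \<ge> 0" "\<And>p. \<exists>\<gamma>\<in>\<Gamma>. dist (\<gamma> p) (hchart 0) \<le> R" using cobounded by blast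
  have "\<exists>\<gamma>\<in>\<Gamma>. \<gamma> \<noteq> id"
  proof (rule ccontr)
    assume no: "\<not> ?thesis"
    obtain b :: 'a where b: "b \<in> Basis" using nonempty_Basis by blast
    define p where "p = hchart (sinh (R + 1) *\<^sub>R b)"
    have "dist p (hchart 0) \<le> R" using R(2)[of p] no by force
    then have "norm (hspace p) \<le> sinh R" by (simp add: norm_hspace)
    moreover have "norm (hspace p) = sinh (R + 1)" using b R(1) by (simp add: p_def)
    ultimately show False using R(1) by simp
  qed
  then obtain \<gamma> where \<gamma>: "\<gamma> \<in> \<Gamma>" "\<gamma> \<noteq> id" by blast
  obtain g l where "l > 0" "translates \<gamma> g l" using axis_exists[OF \<gamma>] by metis
  then have "closed_geodesic \<Gamma> l (\<lambda>t. orbit \<Gamma> (g t))" using closed_geodesic_axis \<gamma>(1) by blast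
  then show ?thesis unfolding systole_def
    by (intro cInf_greatest) (auto simp: closed_geodesic_def)
qed

lemma systolic_classes_bound:
  fixes C :: "(('a \<times> real) \<Rightarrow>\<^sub>L ('a \<times> real)) set"
  assumes C: "finite C" "cball 0 lorentz_bound \<subseteq> (\<Union>c\<in>C. ball c (zassenhaus_radius / (2 * lorentz_bound)))"
  shows "finite (systolic_classes \<Gamma>) \<and> real (kissing_number \<Gamma>) \<le>
    3 * (large_const TYPE('a) + real (card C + 2)) / ball_volume TYPE('a) (1/16) * vol \<Gamma> *
    (exp ((real DIM('a) - 1) * systole \<Gamma> / 2) / systole \<Gamma>)"
proof (cases "systolic_classes \<Gamma> = {}")
  case True
  have "large_const TYPE('a) \<ge> 0"
    using ball_volume_pos[of "1/16", where 'a='a] by (simp add: large_const_def less_imp_le)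
  then have "0 \<le> 3 * (large_const TYPE('a) + real (card C + 2)) / ball_volume TYPE('a) (1/16) * vol \<Gamma> *
      (exp ((real DIM('a) - 1) * systole \<Gamma> / 2) / systole \<Gamma>)"
    using ball_volume_pos[of "1/16", where 'a='a] systole_nonneg
    by (intro mult_nonneg_nonneg divide_nonneg_nonneg) (auto simp: vol_def)
  then show ?thesis using True by (simp add: kissing_number_def)
next
  case False
  let ?l = "systole \<Gamma>" and ?v = "ball_volume TYPE('a) (1/16)"
  let ?e = "exp ((real DIM('a) - 1) * ?l / 2)"
  define A where "A = large_const TYPE('a) + real (card C + 2)"
  have v: "?v > 0" by (rule ball_volume_pos) simp
  have lc: "large_const TYPE('a) \<ge> 0" using v by (simp add: large_const_def less_imp_le)
  have l: "?l > 0" using False by (auto simp: systolic_classes_def closed_geodesic_def)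
  have "real DIM('a) - 1 \<ge> 0" using DIM_positive[where 'a='a] by linarith
  then have e1: "?e \<ge> 1" using l by simp
  have K: "real (card (near x)) \<le> A * ?e" for x
  proof (cases "?l \<ge> 1/2")
    case True
    then have "real (card (near x)) \<le> large_const TYPE('a) * ?e" by (rule card_near_large)
    also have "\<dots> \<le> A * ?e" by (intro mult_right_mono) (auto simp: A_def)
    finally show ?thesis .
  next
    case False
    then have "real (card (near x)) \<le> real (card C + 2)"
      using card_near_small[OF l _ C, of x] by simp
    also have "\<dots> \<le> A" using lc by (simp add: A_def)
    also have "A = A * 1" by simp
    also have "\<dots> \<le> A * ?e" using lc e1 by (intro mult_left_mono) (auto simp: A_def)
    finally show ?thesis .
  qed
  define U where "U = 3 * A / ?v * vol \<Gamma> * (?e / ?l)"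
  \<comment> \<open>\<open>U\<close> is the same for all finite sets of classes, so an infinite set
    of classes is impossible.\<close>
  have bound: "real (card \<C>) \<le> U" if "finite \<C>" "\<C> \<subseteq> systolic_classes \<Gamma>" for \<C>
    using card_systolic_classes_le[OF l K that] v l by (simp add: U_def field_simps)
  have fin: "finite (systolic_classes \<Gamma>)"
  proof (rule ccontr)
    assume "infinite (systolic_classes \<Gamma>)"
    then obtain \<C> where "finite \<C>" "card \<C> = nat \<lceil>U\<rceil> + 1" "\<C> \<subseteq> systolic_classes \<Gamma>"
      using infinite_arbitrarily_large by metis
    then show False using bound[of \<C>] by (simp, linarith)
  qed
  with bound[OF fin order.refl] show ?thesis
    by (simp add: kissing_number_def U_def A_def)
qed

end

theorem theorem1p1:
  assumes "DIM('a::euclidean_space) \<ge> 2"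
  shows "\<exists>A::real. A > 0 \<and>
    (\<forall>\<Gamma> :: 'a isometries. closed_hyperbolic \<Gamma> \<longrightarrow>
      finite (systolic_classes \<Gamma>) \<and>
      real (kissing_number \<Gamma>) \<le>
        A * vol \<Gamma> * (exp ((real DIM('a) - 1) * systole \<Gamma> / 2) / systole \<Gamma>))"
proof -
  \<comment> \<open>The operator space is finite-dimensional, so the net \<open>C\<close> exists; it
    is chosen before any group, which makes \<open>A\<close> depend on the dimension alone.\<close>
  have "compact (cball (0 :: ('a \<times> real) \<Rightarrow>\<^sub>L ('a \<times> real)) lorentz_bound)" by (rule compact_cball)
  moreover have "zassenhaus_radius / (2 * lorentz_bound) > 0" using zassenhaus_radius lorentz_bound by simp
  ultimately obtain C :: "(('a \<times> real) \<Rightarrow>\<^sub>L ('a \<times> real)) set" where C: "finite C"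
    "cball 0 lorentz_bound \<subseteq> (\<Union>c\<in>C. ball c (zassenhaus_radius / (2 * lorentz_bound)))"
    using seq_compact_imp_totally_bounded[OF compact_imp_seq_compact] by metis
  define c where "c = large_const TYPE('a)"
  define A where "A = 3 * (c + real (card C + 2)) / ball_volume TYPE('a) (1/16)"
  have v: "ball_volume TYPE('a) (1/16) > 0" by (rule ball_volume_pos) simp
  then have "c \<ge> 0" by (simp add: c_def large_const_def less_imp_le)
  then have "A > 0" using v by (simp add: A_def add_nonneg_pos)
  moreover have "finite (systolic_classes \<Gamma>) \<and> real (kissing_number \<Gamma>) \<le>
      A * vol \<Gamma> * (exp ((real DIM('a) - 1) * systole \<Gamma> / 2) / systole \<Gamma>)"
    if "closed_hyperbolic \<Gamma>" for \<Gamma> :: "'a isometries"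
  proof -
    interpret closed_hyperbolic_group \<Gamma> using that by unfold_locales
    show ?thesis
      using systolic_classes_bound[OF C] by (simp only: A_def c_def)
  qed
  ultimately show ?thesis by blast
qed

end
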